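(* There exist numbers $\beta,\varrho\in(0,1]$, both irrational with bounded continued fraction entries and neither with eventually periodic continued fraction expansion, such that: (i) for every $\alpha\in(0,1)$ and every $x\in\Omega_1(\beta)$, $\lim_{n\to\infty}\ln(n)\,\mathcal{P}_1^n(v_{\beta,\alpha})(x)=\big(\int v_{\beta,\alpha}\,\mathrm{d}\lambda\big)h_1(x)$; (ii) for every $\alpha\in(0,1/2)$ and every $x\in\Omega_1(\varrho)$, $\lim_{n\to\infty}\ln(n)\,\mathcal{P}_1^n(v_{\varrho,\alpha})(x)=\big(\int v_{\varrho,\alpha}\,\mathrm{d}\lambda\big)h_1(x)$; (iii) for every $\alpha\in(1/2,1)$ and every $x\in\Omega_1(\varrho)$, $\liminf_{n\to\infty}\ln(n)\,\mathcal{P}_1^n(v_{\varrho,\alpha})(x)=\big(\int v_{\varrho,\alpha}\,\mathrm{d}\lambda\big)h_1(x)$ and $\limsup_{n\to\infty}\ln(n)\,\mathcal{P}_1^n(v_{\varrho,\alpha})(x)=+\infty$.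
   Context: $T_1$ is the Farey map: $T_1(x)=\frac{x}{1-x}$ for $0\le x\le1/2$, $T_1(x)=\frac{1-x}{x}$ for $1/2<x\le1$, inverse branches $f_{1,0}(x)=\frac{x}{1+x}$, $f_{1,1}(x)=\frac1{1+x}$; $\mathcal{P}_1(f)=|f_{1,0}'|\, f\circ f_{1,0}+|f_{1,1}'|\, f\circ f_{1,1}$; $h_1(x)=1/x$; $\lambda$ is Lebesgue measure. For $\tau\in[0,1]$, $\alpha\in(0,1)$, $v_{\tau,\alpha}(x)=|\tau-x|^{-\alpha}$. $\Omega_1(\tau)=\bigcap_{k\ge0}\overline{\{T_1^\ell(\tau):\ell\ge k\}}$ is the $\omega$-limit set of $\tau$ under $T_1$. *)

theory Defs
  imports "HOL-Analysis.Analysis" "HOL-Library.Extended_Real"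
begin

definition farey :: "real \<Rightarrow> real" where
  "farey x = (if x \<le> 1/2 then x / (1 - x) else (1 - x) / x)"

text \<open>Transfer operator P_1, acting on extended-real-valued functions
  (so that v(tau)=+infinity is allowed); |f_{1,0}'(x)| = |f_{1,1}'(x)| = 1/(1+x)^2.\<close>
definition P1 :: "(real \<Rightarrow> ereal) \<Rightarrow> real \<Rightarrow> ereal" where
  "P1 f x = ereal (1 / (1 + x)\<^sup>2) * f (x / (1 + x)) + ereal (1 / (1 + x)\<^sup>2) * f (1 / (1 + x))"

definition h1 :: "real \<Rightarrow> real" where
  "h1 x = 1 / x"

definition v :: "real \<Rightarrow> real \<Rightarrow> real \<Rightarrow> ereal" where
  "v \<tau> \<alpha> x = (if x = \<tau> then \<infinity> else ereal (\<bar>\<tau> - x\<bar> powr (- \<alpha>)))"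

definition v_int :: "real \<Rightarrow> real \<Rightarrow> real" where
  "v_int \<tau> \<alpha> = (LINT x:{0..1}|lborel. \<bar>\<tau> - x\<bar> powr (- \<alpha>))"

definition Omega1 :: "real \<Rightarrow> real set" where
  "Omega1 \<tau> = (\<Inter>k. closure {(farey ^^ l) \<tau> | l. l \<ge> k})"

text \<open>Continued fraction entries via the Gauss map: x = [0; a_1, a_2, ...],
  cf_entry x n = a_{n+1}.\<close>
definition gauss :: "real \<Rightarrow> real" where
  "gauss x = frac (1 / x)"

definition cf_entry :: "real \<Rightarrow> nat \<Rightarrow> int" where
  "cf_entry x n = \<lfloor>1 / (gauss ^^ n) x\<rfloor>"

definition bounded_cf :: "real \<Rightarrow> bool" where
  "bounded_cf x \<longleftrightarrow> (\<exists>M. \<forall>n. cf_entry x n \<le> M)"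

definition eventually_periodic_cf :: "real \<Rightarrow> bool" where
  "eventually_periodic_cf x \<longleftrightarrow>
     (\<exists>N p. p > 0 \<and> (\<forall>n\<ge>N. cf_entry x (n + p) = cf_entry x n))"

end

theory Submission
  imports Defs "HOL-Real_Asymp.Real_Asymp"
begin

text \<open>
  For smooth \<open>f\<close> the convergence \<open>ln n * P^n f \<rightarrow> (\<integral>f) / x\<close> is a renewal argument. Functions \<open>f\<close> with
  \<open>x f(x)\<close> concave, increasing and nonnegative form a cone invariant under \<open>P\<close>, and in this cone
  \<open>a_n = P^n f(1)\<close> is decreasing. Splitting the mass of \<open>f\<close> according to the last visit to \<open>[1/2, 1]\<close>
  gives \<open>\<Sum>i. a_(n-1-i) / (i+1) \<approx> \<integral>f\<close>, and monotonicity turns this into \<open>a_n * ln n \<rightarrow> \<integral>f\<close>. Differences of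
  cone elements contain the polynomials, which are dense in the continuous functions.

  For \<open>v = |\<tau> - x|^(-\<alpha>)\<close> one peels off, step by step, the half of the current cylinder that does not
  contain \<open>\<tau>\<close>. If \<open>\<tau>\<close> has bounded entries this writes \<open>P^n v\<close> as a dominated sum of iterates of
  continuous functions, which yields the expected limit, plus the contribution of the single branch
  \<open>f_w\<close> around \<open>\<tau>\<close>, of order \<open>|f_w'|^(1-\<alpha>) |x - T^n \<tau>|^(-\<alpha>)\<close>. Here \<open>|f_w'|\<close> is about \<open>\<phi>^(-2n)\<close> when
  almost all Farey digits of \<open>\<tau>\<close> are \<open>1\<close>, and \<open>|x - T^n \<tau>|\<close> is about \<open>\<phi>^(-2m)\<close> when \<open>x\<close> and \<open>T^n \<tau>\<close>
  share exactly \<open>m\<close> digits. For \<open>\<beta>\<close> the digit \<open>0\<close> sits at the squares, so \<open>m = o(n)\<close> and the extra term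
  vanishes. For \<open>\<rho>\<close> it sits at the powers of \<open>2\<close>, so \<open>m \<le> n + O(1)\<close> with near-equality infinitely often,
  and the threshold is \<open>\<alpha> = 1/2\<close>.
\<close>

section \<open>Invariant cone and renewal estimate\<close>

text \<open>Real-valued form of \<open>P1\<close>, for the finite pieces into which the singular
  function is decomposed.\<close>

definition transfer :: "(real \<Rightarrow> real) \<Rightarrow> real \<Rightarrow> real" where
  "transfer f x = (f (x / (1 + x)) + f (1 / (1 + x))) / (1 + x)\<^sup>2"

text \<open>Membership is tested on x f(x), that is, on f divided by the invariant density 1/x; in
  this normalisation the transfer operator becomes a weighted average over the two inverse
  branches.\<close>

definition farey_cone :: "(real \<Rightarrow> real) set" where
  "farey_cone = {u. concave_on {0..1} u \<and> mono_on {0..1} u \<and> (\<forall>x\<in>{0..1}. 0 \<le> u x)}"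

lemma inverse_branches_mem:
  fixes x :: real
  assumes "x \<in> {0..1}"
  shows "x / (1 + x) \<in> {0..1}" "1 / (1 + x) \<in> {0..1}"
    "x / (1 + x) \<le> 1/2" "1 / (1 + x) \<ge> 1/2"
  using assms by (auto simp: field_simps)

lemma farey_coneD:
  assumes "u \<in> farey_cone"
  shows "concave_on {0..1} u" "mono_on {0..1} u" "\<And>x. x \<in> {0..1} \<Longrightarrow> 0 \<le> u x"
    "\<And>x y. 0 \<le> x \<Longrightarrow> x \<le> y \<Longrightarrow> y \<le> 1 \<Longrightarrow> u x \<le> u y"
  using assms by (auto simp: farey_cone_def mono_on_def)

lemma concave_on_reflect:
  assumes "concave_on {0..1} (u :: real \<Rightarrow> real)"
  shows "concave_on {0..1} (\<lambda>s. u (1 - s))"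
  unfolding concave_on_iff
proof (intro conjI ballI allI impI)
  fix x y a b :: real
  assume *: "x \<in> {0..1}" "y \<in> {0..1}" "0 \<le> a" "0 \<le> b" "a + b = 1"
  have "1 - (a * x + b * y) = a * (1 - x) + b * (1 - y)"
    using *(5) by (simp add: algebra_simps)
  then show "a * u (1 - x) + b * u (1 - y) \<le> u (1 - (a *\<^sub>R x + b *\<^sub>R y))"
    using assms * by (simp add: concave_on_iff)
qed auto

text \<open>Each summand is a product of nonnegative concave functions, one increasing and the other
  decreasing; in the smooth case all three terms of (gh)'' = g''h + 2g'h' + gh'' are then
  nonpositive.\<close>

lemma concave_on_symmetrised:
  assumes "u \<in> farey_cone"
  shows "concave_on {0..1} (\<lambda>s. (1 - s) * u s + s * u (1 - s))"
proof (rule concave_on_add)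
  have "concave_on {0..1} (\<lambda>s. u s * (1 - s))"
  proof (rule concave_on_mul)
    show "concave_on {0..1} (\<lambda>s::real. 1 - s)"
      by (rule concave_on_diff) (auto simp: concave_on_const convex_on_ident)
  qed (use farey_coneD[OF assms] in \<open>auto simp: monotone_on_def\<close>)
  then show "concave_on {0..1} (\<lambda>s. (1 - s) * u s)"
    by (simp add: mult.commute)
  show "concave_on {0..1} (\<lambda>s. s * u (1 - s))"
    by (rule concave_on_mul)
      (use farey_coneD[OF assms] concave_on_reflect[OF farey_coneD(1)[OF assms]]
        in \<open>auto simp: monotone_on_def concave_on_ident\<close>)
qed

text \<open>The symmetrised function is invariant under s -> 1 - s, so concavity forces it to
  increase up to 1/2.\<close>

lemma symmetrised_mono:
  assumes "u \<in> farey_cone" "0 \<le> s" "s \<le> t" "t \<le> 1/2"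
  shows "(1 - s) * u s + s * u (1 - s) \<le> (1 - t) * u t + t * u (1 - t)"
proof (cases "s = 1/2")
  case True
  then have "t = s" using assms by simp
  then show ?thesis by simp
next
  case False
  define G where "G = (\<lambda>s. (1 - s) * u s + s * u (1 - s))"
  \<comment> \<open>Weight for which t is the convex combination of s and its mirror image 1 - s,
    two points where \<open>G\<close> agrees.\<close>
  define r where "r = (t - s) / (1 - 2 * s)"
  have s: "s < 1/2" using False assms by simp
  have r: "0 \<le> r" "r \<le> 1"
    using assms s by (auto simp: r_def field_simps)
  have "(1 - r) * s + r * (1 - s) = s + r * (1 - 2 * s)"
    by (simp add: algebra_simps)
  also have "\<dots> = t" using s by (simp add: r_def)
  finally have t: "(1 - r) * s + r * (1 - s) = t" .
  have "concave_on {0..1} G"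
    unfolding G_def by (rule concave_on_symmetrised[OF assms(1)])
  from concave_onD[OF this r, of s "1 - s"]
  have "(1 - r) * G s + r * G (1 - s) \<le> G t"
    using assms s t by simp
  moreover have "G (1 - s) = G s" by (simp add: G_def)
  ultimately show ?thesis by (simp add: G_def algebra_simps)
qed

text \<open>With \<sigma> = x/(1+x) the branches are \<sigma> and 1 - \<sigma>, and x/(1+x)^2 =
  \<sigma>(1 - \<sigma>). In terms of x f(x) the operator therefore averages with weights 1 -
  \<sigma> and \<sigma>.\<close>

lemma transfer_times_id:
  assumes "0 \<le> x"
  shows "x * transfer f x = (1 - x/(1+x)) * ((x/(1+x)) * f (x/(1+x)))
           + (x/(1+x)) * ((1 - x/(1+x)) * f (1 - x/(1+x)))"
proof -
  have "1 - x / (1+x) = 1 / (1+x)" using assms by (simp add: field_simps)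
  moreover have "1 + x \<noteq> 0" using assms by simp
  ultimately show ?thesis
    by (simp add: transfer_def power2_eq_square add_divide_distrib distrib_left)
qed

text \<open>The image is G composed with \<sigma>, where G is the symmetrisation. G is concave and
  increases on [0, 1/2]; \<sigma> is concave, increasing and maps into [0, 1/2], so the composition
  inherits both properties.\<close>

lemma transfer_cone:
  assumes "(\<lambda>x. x * f x) \<in> farey_cone"
  shows "(\<lambda>x. x * transfer f x) \<in> farey_cone"
proof -
  define u where "u = (\<lambda>x. x * f x)"
  define G where "G = (\<lambda>s. (1 - s) * u s + s * u (1 - s))"
  define \<sigma> where "\<sigma> = (\<lambda>x::real. x / (1 + x))"
  have u: "u \<in> farey_cone" using assms by (simp add: u_def)
  have eq: "x * transfer f x = G (\<sigma> x)" if "0 \<le> x" for x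
    using transfer_times_id[OF that, of f] by (simp add: G_def u_def \<sigma>_def)
  have \<sigma>: "0 \<le> \<sigma> x" "\<sigma> x \<le> 1/2" if "0 \<le> x" "x \<le> 1" for x
    using that by (auto simp: \<sigma>_def field_simps)
  have \<sigma>_mono: "\<sigma> x \<le> \<sigma> y" if "0 \<le> x" "x \<le> y" for x y
    using that by (auto simp: \<sigma>_def field_simps)
  have G_mono: "G s \<le> G t" if "0 \<le> s" "s \<le> t" "t \<le> 1/2" for s t
    using symmetrised_mono[OF u that] by (simp add: G_def)
  have G_conc: "concave_on {0..1} G"
    unfolding G_def by (rule concave_on_symmetrised[OF u])
  have \<sigma>_conc: "a * \<sigma> x + b * \<sigma> y \<le> \<sigma> (a * x + b * y)"
    if "0 \<le> x" "0 \<le> y" "0 \<le> a" "0 \<le> b" "a + b = 1" for a b x y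
  proof -
    define X Y where "X = 1 + x" and "Y = 1 + y"
    have XY: "0 < X" "0 < Y" using that by (auto simp: X_def Y_def)
    have Z: "1 + (a * x + b * y) = a * X + b * Y" "b = 1 - a"
      using that(5) by (auto simp: X_def Y_def algebra_simps)
    have Zpos: "0 < a * X + b * Y"
      using that unfolding Z(1)[symmetric] by (intro add_pos_nonneg) auto
    have \<sigma>_eq: "\<sigma> t = 1 - 1 / (1 + t)" if "0 \<le> t" for t
      using that by (simp add: \<sigma>_def field_simps)
    \<comment> \<open>Convexity of 1/t in denominator-free form; it makes \<sigma> = 1 - 1/(1+x)
      concave.\<close>
    have "(a * Y + b * X) * (a * X + b * Y) = X * Y + a * b * (X - Y)\<^sup>2"
      unfolding Z(2) by (simp add: algebra_simps power2_eq_square)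
    then have "X * Y \<le> (a * Y + b * X) * (a * X + b * Y)" using that by simp
    then have "1 / (a * X + b * Y) \<le> (a * Y + b * X) / (X * Y)"
      using XY Zpos by (simp add: divide_le_eq pos_le_divide_eq)
    also have "\<dots> = a * (1 / X) + b * (1 / Y)" using XY by (simp add: add_divide_distrib)
    finally have "1 / (1 + (a * x + b * y)) \<le> a * (1 / (1 + x)) + b * (1 / (1 + y))"
      unfolding Z(1) by (simp add: X_def Y_def)
    moreover have "a * \<sigma> x + b * \<sigma> y = 1 - (a * (1 / (1 + x)) + b * (1 / (1 + y)))"
      using that(5) unfolding \<sigma>_eq[OF that(1)] \<sigma>_eq[OF that(2)] by (simp add: algebra_simps)
    moreover have "\<sigma> (a * x + b * y) = 1 - 1 / (1 + (a * x + b * y))"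
      using that by (intro \<sigma>_eq) auto
    ultimately show ?thesis by linarith
  qed
  have "concave_on {0..1} (\<lambda>x. x * transfer f x)"
    unfolding concave_on_iff
  proof (intro conjI ballI allI impI)
    fix x y a b :: real
    assume *: "x \<in> {0..1}" "y \<in> {0..1}" "0 \<le> a" "0 \<le> b" "a + b = 1"
    have c: "0 \<le> a * x + b * y" "a * x + b * y \<le> 1"
      using * convex_bound_le[of x 1 y a b] by auto
    have 1: "a * \<sigma> x + b * \<sigma> y \<le> \<sigma> (a * x + b * y)" using * by (intro \<sigma>_conc) auto
    have 2: "0 \<le> a * \<sigma> x + b * \<sigma> y" using * \<sigma>[of x] \<sigma>[of y] by simp
    have "a * G (\<sigma> x) + b * G (\<sigma> y) \<le> G (a * \<sigma> x + b * \<sigma> y)"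
      using G_conc * \<sigma>[of x] \<sigma>[of y] by (simp add: concave_on_iff)
    also have "\<dots> \<le> G (\<sigma> (a * x + b * y))"
      by (intro G_mono 1 2 \<sigma>(2) c)
    finally show "a * (x * transfer f x) + b * (y * transfer f y)
        \<le> (a *\<^sub>R x + b *\<^sub>R y) * transfer f (a *\<^sub>R x + b *\<^sub>R y)"
      using * c eq by simp
  qed auto
  moreover have "mono_on {0..1} (\<lambda>x. x * transfer f x)"
  proof (rule mono_onI)
    fix x y :: real assume "x \<in> {0..1}" "y \<in> {0..1}" "x \<le> y"
    then show "x * transfer f x \<le> y * transfer f y"
      using eq[of x] eq[of y] \<sigma>[of x] \<sigma>[of y] \<sigma>_mono[of x y] G_mono by auto
  qed
  moreover have "0 \<le> x * transfer f x" if "x \<in> {0..1}" for x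
  proof -
    have "\<sigma> x \<in> {0..1}" "1 - \<sigma> x \<in> {0..1}" using \<sigma>[of x] that by auto
    then have "0 \<le> u (\<sigma> x)" "0 \<le> u (1 - \<sigma> x)" "0 \<le> \<sigma> x" "0 \<le> 1 - \<sigma> x"
      using farey_coneD(3)[OF u] by auto
    then show ?thesis using that eq[of x] by (simp add: G_def)
  qed
  ultimately show ?thesis by (auto simp: farey_cone_def)
qed

lemma transfer_funpow_cone:
  "(\<lambda>x. x * f x) \<in> farey_cone \<Longrightarrow> (\<lambda>x. x * (transfer ^^ n) f x) \<in> farey_cone"
  by (induction n) (auto intro: transfer_cone)

text \<open>The concave function x f(x) vanishes at 0, so its slope from the origin, which is f(x),
  decreases.\<close>

lemma cone_imp_decreasing:
  assumes "(\<lambda>x. x * f x) \<in> farey_cone" "0 < x" "x \<le> y" "y \<le> 1"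
  shows "f y \<le> f x"
proof -
  from concave_onD[OF farey_coneD(1)[OF assms(1)], of "x / y" 0 y]
  have "(x / y) * (y * f y) \<le> x * f x"
    using assms by (simp add: field_simps)
  then show ?thesis using assms by simp
qed

section \<open>The transfer operator on primitives and the last-visit decomposition\<close>

definition transfer_anti :: "(real \<Rightarrow> real) \<Rightarrow> real \<Rightarrow> real" where
  "transfer_anti F x = F (x / (1 + x)) - F (1 / (1 + x))"

definition antideriv :: "(real \<Rightarrow> real) \<Rightarrow> (real \<Rightarrow> real) \<Rightarrow> bool" where
  "antideriv F f \<longleftrightarrow>
     (\<forall>x\<in>{0..1}. (F has_real_derivative f x) (at x within {0..1}))"

text \<open>The minus sign in \<open>transfer_anti\<close> cancels the negative derivative of
  1/(1+x). Integrals of iterates thus become increments of iterated primitives.\<close>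

lemma antideriv_Qr:
  assumes "antideriv F f"
  shows "antideriv (transfer_anti F) (transfer f)"
  unfolding antideriv_def
proof
  fix x :: real assume x: "x \<in> {0..1}"
  have ne: "1 + x \<noteq> 0" using x by auto
  have d0: "((\<lambda>x::real. x / (1 + x)) has_real_derivative 1 / (1 + x)\<^sup>2) (at x within {0..1})"
    using ne by (auto intro!: derivative_eq_intros simp: divide_simps power2_eq_square)
  have d1: "((\<lambda>x::real. 1 / (1 + x)) has_real_derivative - 1 / (1 + x)\<^sup>2) (at x within {0..1})"
    using ne by (auto intro!: derivative_eq_intros simp: divide_simps power2_eq_square)
  have D: "((\<lambda>x. F (g x)) has_real_derivative f (g x) * g') (at x within {0..1})"
    if "g ` {0..1} \<subseteq> {0..1}" "(g has_real_derivative g') (at x within {0..1})" for g g'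
  proof -
    have "g x \<in> {0..1}" using that(1) x by blast
    then have "(F has_real_derivative f (g x)) (at (g x) within g ` {0..1})"
      using assms DERIV_subset[OF _ that(1)] unfolding antideriv_def by blast
    from DERIV_image_chain[OF this that(2)] show ?thesis by (simp add: o_def)
  qed
  have "((\<lambda>x. F (x / (1 + x)) - F (1 / (1 + x))) has_real_derivative
      f (x / (1 + x)) * (1 / (1 + x)\<^sup>2) - f (1 / (1 + x)) * (- 1 / (1 + x)\<^sup>2)) (at x within {0..1})"
    by (intro DERIV_diff D[OF _ d0] D[OF _ d1]) (use inverse_branches_mem in blast)+
  then show "(transfer_anti F has_real_derivative transfer f x) (at x within {0..1})"
    by (simp add: transfer_anti_def[abs_def] transfer_def add_divide_distrib)
qed

lemma antideriv_Qr_funpow: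
  "antideriv F f \<Longrightarrow> antideriv ((transfer_anti ^^ n) F) ((transfer ^^ n) f)"
  by (induction n) (auto intro: antideriv_Qr)

lemma antideriv_continuous: "antideriv F f \<Longrightarrow> continuous_on {0..1} F"
  unfolding antideriv_def by (intro DERIV_continuous_on[where D=f]) auto

lemma antideriv_interior:
  assumes "antideriv F f" "0 < x" "x < 1"
  shows "(F has_real_derivative f x) (at x)"
proof -
  have "(F has_real_derivative f x) (at x within {0..1})"
    using assms by (simp add: antideriv_def)
  then have "(F has_real_derivative f x) (at x within {0<..<1})"
    by (rule DERIV_subset) auto
  then show ?thesis using assms by (subst (asm) at_within_open) auto
qed

lemma antideriv_increment_bounds:
  assumes "antideriv F f" "0 \<le> a" "a < b" "b \<le> 1"
    and "\<And>x. a < x \<Longrightarrow> x < b \<Longrightarrow> m \<le> f x \<and> f x \<le> M"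
  shows "m * (b - a) \<le> F b - F a \<and> F b - F a \<le> M * (b - a)"
proof -
  have cont: "continuous_on {a..b} F"
    by (rule continuous_on_subset[OF antideriv_continuous[OF assms(1)]]) (use assms in auto)
  have "(F has_real_derivative f x) (at x)" if "a < x" "x < b" for x
    by (rule antideriv_interior[OF assms(1)]) (use assms that in auto)
  then obtain z where z: "a < z" "z < b" "F b - F a = f z * (b - a)"
    using mvt[OF assms(3) cont, of "\<lambda>x. (*) (f x)"]
    by (auto simp: has_field_derivative_def)
  with assms(5)[OF z(1,2)] assms(3) show ?thesis
    by (simp add: mult.commute mult_left_mono)
qed

text \<open>The mass of \<open>f\<close> after \<open>n\<close> steps, split according to the last visit to \<open>[1/2, 1]\<close>:
  a point outside \<open>[0, 1/(j+1)]\<close> enters \<open>[1/2, 1]\<close> within \<open>j\<close> steps.\<close>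

lemma transfer_anti_total: "transfer_anti F 1 - transfer_anti F 0 = F 1 - F 0"
  by (simp add: transfer_anti_def)

text \<open>The Farey preimage of [0, 1/(j+1)] is [0, 1/(j+2)] together with [1 - 1/(j+2), 1]; the
  second piece lies in [1/2, 1] and is split off.\<close>

lemma transfer_anti_increment:
  "transfer_anti F (1 / (real j + 1)) - transfer_anti F 0
     = F (1 / (real (Suc j) + 1)) - F 0 + (F 1 - F (1 - 1 / (real j + 2)))"
proof -
  have "1 / (real j + 1) / (1 + 1 / (real j + 1)) = 1 / (real j + 2)"
    "1 / (1 + 1 / (real j + 1)) = 1 - 1 / (real j + 2)"
    by (auto simp: field_simps)
  then show ?thesis by (simp add: transfer_anti_def add.commute)
qed

lemma last_visit_decomposition:
  "F 1 - F 0 = F (1 / (real n + 1)) - F 0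
     + (\<Sum>i<n. (transfer_anti ^^ (n - 1 - i)) F 1 - (transfer_anti ^^ (n - 1 - i)) F (1 - 1 / (real i + 2)))"
proof -
  have tot: "(transfer_anti ^^ n) F 1 - (transfer_anti ^^ n) F 0 = F 1 - F 0" for n
    by (induction n) (auto simp: transfer_anti_total)
  \<comment> \<open>Going j steps back in time leaves the interval [0, 1/(j+1)], starting from
    [0, 1] at j = 0; the claim is the case j = n.\<close>
  have "j \<le> n \<Longrightarrow> (transfer_anti ^^ n) F 1 - (transfer_anti ^^ n) F 0
      = (transfer_anti ^^ (n - j)) F (1 / (real j + 1)) - (transfer_anti ^^ (n - j)) F 0
        + (\<Sum>i<j. (transfer_anti ^^ (n - 1 - i)) F 1 - (transfer_anti ^^ (n - 1 - i)) F (1 - 1 / (real i + 2)))" for j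
  proof (induction j)
    case 0
    then show ?case by simp
  next
    case (Suc j)
    have "n - j = Suc (n - Suc j)" using Suc by simp
    then have "(transfer_anti ^^ (n - j)) F = transfer_anti ((transfer_anti ^^ (n - Suc j)) F)" by simp
    with Suc transfer_anti_increment[of "(transfer_anti ^^ (n - Suc j)) F" j] show ?case by simp
  qed
  from this[of n] show ?thesis by (simp add: tot)
qed

section \<open>From the renewal inequalities to logarithmic decay\<close>

lemma harm_le_ln: "n \<ge> 1 \<Longrightarrow> harm n \<le> ln (real n) + 1"
proof (induction n rule: dec_induct)
  case base
  then show ?case by (simp add: harm_def)
next
  case (step n)
  have "ln (real n / real (Suc n)) \<le> real n / real (Suc n) - 1"
    using step by (intro ln_le_minus_one) auto
  also have "\<dots> = - inverse (real (Suc n))" by (simp add: field_simps)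
  finally have "ln (real n) - ln (real (Suc n)) \<le> - inverse (real (Suc n))"
    using step by (simp add: ln_div)
  then show ?case using step by (simp add: harm_Suc)
qed

lemma one_less_ln: "1 < ln (real n + 3)"
proof -
  have "exp (1::real) < real n + 3" using e_less_272 by linarith
  then have "ln (exp 1) < ln (real n + 3)" by (subst ln_less_cancel_iff) auto
  then show ?thesis by simp
qed

lemma cesaro_zero:
  fixes a :: "nat \<Rightarrow> real"
  assumes "a \<longlonglongrightarrow> 0" "\<And>n. 0 \<le> a n"
  shows "(\<lambda>m. (\<Sum>k<m. a k) / real m) \<longlonglongrightarrow> 0"
proof (rule LIMSEQ_I)
  fix e :: real assume e: "0 < e"
  then obtain N where N: "\<And>n. n \<ge> N \<Longrightarrow> a n < e / 2"
    using assms LIMSEQ_D[OF assms(1), of "e/2"] by auto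
  define C where "C = (\<Sum>k<N. a k)"
  have C0: "0 \<le> C" using assms by (auto simp: C_def intro: sum_nonneg)
  have le: "(\<Sum>k<m. a k) \<le> C + real m * (e / 2)" for m
  proof (induction m)
    case 0
    then show ?case using C0 by simp
  next
    case (Suc m)
    show ?case
    proof (cases "m < N")
      case True
      then have "(\<Sum>k<Suc m. a k) \<le> C"
        unfolding C_def by (intro sum_mono2) (auto simp: assms)
      moreover have "0 \<le> real (Suc m) * (e/2)" using e by simp
      ultimately show ?thesis by linarith
    next
      case False
      then have "a m \<le> e / 2" using N[of m] by simp
      moreover have "real (Suc m) * (e / 2) = real m * (e / 2) + e / 2"
        by (simp add: distrib_right)
      ultimately show ?thesis using Suc by (simp only: sum.lessThan_Suc)
    qed
  qed
  obtain M :: nat where M: "real M > 2 * C / e" using reals_Archimedean2 by blast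
  show "\<exists>no. \<forall>m\<ge>no. norm ((\<Sum>k<m. a k) / real m - 0) < e"
  proof (intro exI allI impI)
    fix m assume m: "m \<ge> M + 1"
    then have "2 * C / e < real m" using M by linarith
    then have "C < real m * (e / 2)" using e by (simp add: field_simps)
    with le[of m] have "(\<Sum>k<m. a k) < real m * e" by (simp add: algebra_simps)
    moreover have "0 \<le> (\<Sum>k<m. a k)" using assms by (auto intro: sum_nonneg)
    ultimately show "norm ((\<Sum>k<m. a k) / real m - 0) < e"
      using m by (simp add: field_simps)
  qed
qed

text \<open>Monotonicity takes the place of a Tauberian theorem. From above, a n is the smallest
  value in the sum of length n + 1, so a n times a partial harmonic sum is at most \<open>I\<close>.
  From below, at length 2m, half of the sum is at most a m times \<open>harm m\<close> and the other
  half is at most a Cesaro mean of a null sequence.\<close>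

lemma monotone_renewal:
  fixes a e :: "nat \<Rightarrow> real"
  assumes dec: "decseq a" and nonneg: "\<And>n. 0 \<le> a n"
    and upper: "\<And>n. (\<Sum>i<n. a (n - 1 - i) / (real i + 2)) \<le> I"
    and lower: "\<And>n. I - e n \<le> (\<Sum>i<n. a (n - 1 - i) / (real i + 1))"
    and e: "e \<longlonglongrightarrow> 0"
  shows "(\<lambda>n. ln (real n) * a n) \<longlonglongrightarrow> I"
proof -
  have up: "a n * (ln (real n + 3) - 1) \<le> I" for n
  proof -
    have "(\<Sum>i<Suc n. 1 / (real i + 2)) = harm (Suc (Suc n)) - 1"
      by (simp only: harm_altdef sum.lessThan_Suc_shift[of _ "Suc n"])
        (simp add: inverse_eq_divide add.commute)
    moreover have "harm (Suc (Suc n)) \<ge> ln (real n + 3)"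
      using ln_le_harm[of "Suc (Suc n)"] by (simp add: add.commute)
    ultimately have "a n * (ln (real n + 3) - 1) \<le> a n * (\<Sum>i<Suc n. 1 / (real i + 2))"
      using nonneg[of n] by (intro mult_left_mono) auto
    also have "\<dots> \<le> (\<Sum>i<Suc n. a (Suc n - 1 - i) / (real i + 2))"
      unfolding sum_distrib_left
      by (intro sum_mono) (use dec in \<open>auto simp: decseq_def intro!: divide_right_mono\<close>)
    also have "\<dots> \<le> I" by (rule upper)
    finally show ?thesis .
  qed
  have I0: "0 \<le> I" using upper[of 0] by simp
  have a0: "a \<longlonglongrightarrow> 0"
  proof (rule tendsto_sandwich[where f = "\<lambda>_. 0"])
    show "\<forall>\<^sub>F n in sequentially. a n \<le> I / (ln (real n + 3) - 1)"
    proof (rule always_eventually, rule allI)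
      fix n
      have "1 < ln (real n + 3)" by (rule one_less_ln)
      then show "a n \<le> I / (ln (real n + 3) - 1)" using up[of n] by (simp add: field_simps)
    qed
    show "(\<lambda>n. I / (ln (real n + 3) - 1)) \<longlonglongrightarrow> 0" by real_asymp
  qed (use nonneg in auto)
  have lo: "I - e (2 * m) - (\<Sum>k<m. a k) / real m \<le> a m * (ln (2 * real m) + 1)" if "m \<ge> 1" for m
  proof -
    \<comment> \<open>For i < m the index 2m - 1 - i is at least m, so the value is at most a m; for
      i >= m the weight is at most 1/m.\<close>
    have split: "{..<2*m} = {..<m} \<union> {m..<2*m}" "{..<m} \<inter> {m..<2*m} = {}" by auto
    have "(\<Sum>i<m. a (2*m - 1 - i) / (real i + 1)) \<le> (\<Sum>i<m. a m * (1 / (real i + 1)))"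
      by (intro sum_mono) (use dec in \<open>auto simp: decseq_def intro!: divide_right_mono\<close>)
    also have "\<dots> = a m * harm m"
      by (simp add: harm_altdef sum_distrib_left inverse_eq_divide add.commute)
    also have "\<dots> \<le> a m * (ln (2 * real m) + 1)"
    proof (intro mult_left_mono nonneg)
      have "ln (real m) \<le> ln (2 * real m)" using that by simp
      then show "harm m \<le> ln (2 * real m) + 1" using harm_le_ln[OF that] by linarith
    qed
    finally have 1: "(\<Sum>i<m. a (2*m - 1 - i) / (real i + 1)) \<le> a m * (ln (2 * real m) + 1)" .
    have "(\<Sum>i\<in>{m..<2*m}. a (2*m - 1 - i) / (real i + 1)) \<le> (\<Sum>i\<in>{m..<2*m}. a (2*m - 1 - i) / real m)"
      using that nonneg by (intro sum_mono divide_left_mono) auto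
    also have "\<dots> = (\<Sum>k<m. a k / real m)"
      by (rule sum.reindex_bij_witness[of _ "\<lambda>k. 2*m - 1 - k" "\<lambda>k. 2*m - 1 - k"]) auto
    also have "\<dots> = (\<Sum>k<m. a k) / real m" by (simp add: sum_divide_distrib)
    finally have 2: "(\<Sum>i\<in>{m..<2*m}. a (2*m - 1 - i) / (real i + 1)) \<le> (\<Sum>k<m. a k) / real m" .
    have "I - e (2*m) \<le> (\<Sum>i<2*m. a (2*m - 1 - i) / (real i + 1))" by (rule lower)
    also have "\<dots> = (\<Sum>i<m. a (2*m - 1 - i) / (real i + 1))
        + (\<Sum>i\<in>{m..<2*m}. a (2*m - 1 - i) / (real i + 1))"
      unfolding split(1) by (rule sum.union_disjoint) auto
    finally show ?thesis using 1 2 by linarith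
  qed
  show ?thesis
  proof (rule tendsto_sandwich)
    show "\<forall>\<^sub>F n in sequentially. ln (real n) * a n \<le> ln (real n) / (ln (real n + 3) - 1) * I"
      using eventually_ge_at_top[of 3]
    proof eventually_elim
      case (elim n)
      have "1 < ln (real n + 3)" by (rule one_less_ln)
      then have "a n \<le> I / (ln (real n + 3) - 1)" using up[of n] by (simp add: field_simps)
      then have "ln (real n) * a n \<le> ln (real n) * (I / (ln (real n + 3) - 1))"
        using elim by (intro mult_left_mono) auto
      then show ?case by simp
    qed
    show "\<forall>\<^sub>F n in sequentially.
        ln (real n) / (ln (2 * real n) + 1) * (I - e (2 * n) - (\<Sum>k<n. a k) / real n) \<le> ln (real n) * a n"
      using eventually_ge_at_top[of 3]
    proof eventually_elim
      case (elim n)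
      have "0 < ln (2 * real n) + 1" using elim by (intro add_nonneg_pos ln_ge_zero) auto
      then have "(I - e (2 * n) - (\<Sum>k<n. a k) / real n) / (ln (2 * real n) + 1) \<le> a n"
        using lo[of n] elim by (simp add: pos_divide_le_eq)
      then have "ln (real n) * ((I - e (2 * n) - (\<Sum>k<n. a k) / real n) / (ln (2 * real n) + 1)) \<le> ln (real n) * a n"
        using elim by (intro mult_left_mono) auto
      then show ?case by simp
    qed
    have "(\<lambda>n. e (2 * n)) \<longlonglongrightarrow> 0"
      using LIMSEQ_subseq_LIMSEQ[OF e, of "\<lambda>n. 2 * n"] by (simp add: strict_mono_def o_def)
    then have "(\<lambda>n. ln (real n) / (ln (2 * real n) + 1) * (I - e (2 * n) - (\<Sum>k<n. a k) / real n)) \<longlonglongrightarrow> 1 * (I - 0 - 0)"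
      by (intro tendsto_mult tendsto_diff tendsto_const cesaro_zero a0 nonneg) real_asymp+
    then show "(\<lambda>n. ln (real n) / (ln (2 * real n) + 1) * (I - e (2 * n) - (\<Sum>k<n. a k) / real n)) \<longlonglongrightarrow> I"
      by simp
    have "(\<lambda>n. ln (real n) / (ln (real n + 3) - 1) * I) \<longlonglongrightarrow> 1 * I"
      by (intro tendsto_mult tendsto_const) real_asymp
    then show "(\<lambda>n. ln (real n) / (ln (real n + 3) - 1) * I) \<longlonglongrightarrow> I" by simp
  qed
qed

lemma cone_asymptotics_at_1:
  assumes cone: "(\<lambda>x. x * f x) \<in> farey_cone" and F: "antideriv F f"
  shows "(\<lambda>n. ln (real n) * (transfer ^^ n) f 1) \<longlonglongrightarrow> F 1 - F 0"
proof (rule monotone_renewal)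
  let ?a = "\<lambda>n. (transfer ^^ n) f 1"
  have cn: "(\<lambda>x. x * (transfer ^^ n) f x) \<in> farey_cone" for n by (rule transfer_funpow_cone[OF cone])
  show "decseq ?a"
  proof (rule decseq_SucI)
    fix n
    \<comment> \<open>Both branches send 1 to 1/2, so one step compares x f(x) at 1/2 and at 1,
      where it is increasing.\<close>
    have "?a (Suc n) = (1/2) * (transfer ^^ n) f (1/2)" by (simp add: transfer_def)
    also have "\<dots> \<le> 1 * ?a n" using farey_coneD(4)[OF cn, of "1/2" 1 n] by simp
    finally show "?a (Suc n) \<le> ?a n" by simp
  qed
  show "0 \<le> ?a n" for n using farey_coneD(3)[OF cn, of 1 n] by simp
  \<comment> \<open>On [l, 1] the iterate lies between its value at 1, since it decreases, and that
    value divided by l, since x times it increases. With l = (i+1)/(i+2) the interval length 1/(i+2)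
    yields the two weights.\<close>
  have incr: "?a k / (real i + 2) \<le> (transfer_anti ^^ k) F 1 - (transfer_anti ^^ k) F (1 - 1 / (real i + 2)) \<and>
      (transfer_anti ^^ k) F 1 - (transfer_anti ^^ k) F (1 - 1 / (real i + 2)) \<le> ?a k / (real i + 1)" for k i
  proof -
    let ?l = "1 - 1 / (real i + 2)"
    have l: "0 < ?l" "?l < 1" by (auto simp: field_simps)
    have "?a k \<le> (transfer ^^ k) f x \<and> (transfer ^^ k) f x \<le> ?a k / ?l" if "?l < x" "x < 1" for x
    proof
      have x: "0 < x" using that l by linarith
      show lo: "?a k \<le> (transfer ^^ k) f x" by (rule cone_imp_decreasing[OF cn]) (use that x in auto)
      have "x * (transfer ^^ k) f x \<le> ?a k" using farey_coneD(4)[OF cn, of x 1 k] that x by simp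
      moreover have "0 \<le> (transfer ^^ k) f x" using farey_coneD(3)[OF cn, of 1 k] lo by simp
      moreover from this have "?l * (transfer ^^ k) f x \<le> x * (transfer ^^ k) f x"
        by (rule mult_right_mono[OF less_imp_le[OF that(1)]])
      ultimately have "?l * (transfer ^^ k) f x \<le> ?a k" by linarith
      then show "(transfer ^^ k) f x \<le> ?a k / ?l" using l(1) by (simp add: pos_le_divide_eq mult.commute)
    qed
    from antideriv_increment_bounds[OF antideriv_Qr_funpow[OF F] less_imp_le[OF l(1)] l(2) order.refl this]
    have "?a k * (1 - ?l) \<le> (transfer_anti ^^ k) F 1 - (transfer_anti ^^ k) F ?l \<and>
      (transfer_anti ^^ k) F 1 - (transfer_anti ^^ k) F ?l \<le> ?a k / ?l * (1 - ?l)" .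
    moreover have "?a k / ?l * (1 - ?l) = ?a k / (real i + 1)"
    proof -
      have *: "A / l * m = A / (real i + 1)"
        if "l = (real i + 1) / (real i + 2)" "m = 1 / (real i + 2)" for A l m :: real
        using that by simp
      show ?thesis by (rule *) (simp_all add: field_simps)
    qed
    moreover have "?a k * (1 - ?l) = ?a k / (real i + 2)" by simp
    ultimately show ?thesis by (simp only:)
  qed
  \<comment> \<open>Mass within 1/(n+1) of the neutral fixed point 0; it vanishes in the limit by
    continuity of the primitive.\<close>
  let ?e = "\<lambda>n. F (1 / (real n + 1)) - F 0"
  have dec: "F 1 - F 0 = ?e n
     + (\<Sum>i<n. (transfer_anti ^^ (n - 1 - i)) F 1 - (transfer_anti ^^ (n - 1 - i)) F (1 - 1 / (real i + 2)))" for n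
    by (rule last_visit_decomposition)
  show "(\<Sum>i<n. ?a (n - 1 - i) / (real i + 2)) \<le> F 1 - F 0" for n
  proof -
    have fpos: "0 \<le> f x" if "0 < x" "x < 1" for x
      using farey_coneD(3)[OF cone, of x] that by (simp add: zero_le_mult_iff)
    have "0 \<le> ?e n"
    proof -
      let ?b = "1 / (real n + 1)"
      have b: "0 < ?b" "?b \<le> 1" by (auto simp: field_simps)
      have "continuous_on {0..?b} F"
        by (rule continuous_on_subset[OF antideriv_continuous[OF F]]) (use b in auto)
      moreover have ex: "\<exists>y. (F has_real_derivative y) (at x) \<and> 0 \<le> y" if "0 < x" "x < ?b" for x
      proof (intro exI conjI)
        show "(F has_real_derivative f x) (at x)"
          by (rule antideriv_interior[OF F that(1) order.strict_trans2[OF that(2) b(2)]])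
        show "0 \<le> f x" by (rule fpos[OF that(1) order.strict_trans2[OF that(2) b(2)]])
      qed
      ultimately have "F 0 \<le> F ?b"
        using DERIV_nonneg_imp_increasing_open[OF less_imp_le[OF b(1)] ex] by blast
      then show ?thesis by simp
    qed
    moreover have "(\<Sum>i<n. ?a (n - 1 - i) / (real i + 2))
      \<le> (\<Sum>i<n. (transfer_anti ^^ (n - 1 - i)) F 1 - (transfer_anti ^^ (n - 1 - i)) F (1 - 1 / (real i + 2)))"
      by (intro sum_mono conjunct1[OF incr])
    ultimately show ?thesis using dec[of n] by linarith
  qed
  show "F 1 - F 0 - ?e n \<le> (\<Sum>i<n. ?a (n - 1 - i) / (real i + 1))" for n
  proof -
    have "(\<Sum>i<n. (transfer_anti ^^ (n - 1 - i)) F 1 - (transfer_anti ^^ (n - 1 - i)) F (1 - 1 / (real i + 2)))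
      \<le> (\<Sum>i<n. ?a (n - 1 - i) / (real i + 1))"
      by (intro sum_mono conjunct2[OF incr])
    then show ?thesis using dec[of n] by linarith
  qed
  note antideriv_continuous[OF F]
  moreover have "(\<lambda>n. 1 / (real n + 1)) \<longlonglongrightarrow> 0" by real_asymp
  ultimately have "(\<lambda>n. F (1 / (real n + 1))) \<longlonglongrightarrow> F 0"
    by (rule continuous_on_tendsto_compose) auto
  then show "?e \<longlonglongrightarrow> 0" by (simp add: LIM_zero)
qed

text \<open>On [1/2, 1] the increasing function u_n(x) = x P^n f(x) is squeezed between u_n(1/2) =
  u_(n+1)(1) and u_n(1). On [1/3, 1/2) the averaging relation at x/(1-x), a point of [1/2, 1], is
  solved for the value at x.\<close>

lemma cone_asymptotics:
  assumes cone: "(\<lambda>x. x * f x) \<in> farey_cone" and F: "antideriv F f" and x: "x \<in> {1/3..1}"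
  shows "(\<lambda>n. ln (real n) * (transfer ^^ n) f x) \<longlonglongrightarrow> (F 1 - F 0) / x"
proof -
  define I where "I = F 1 - F 0"
  define u where "u = (\<lambda>n x. x * (transfer ^^ n) f x)"
  have cn: "u n \<in> farey_cone" for n unfolding u_def by (rule transfer_funpow_cone[OF cone])
  have rec: "u (Suc n) z = (1 - z/(1+z)) * u n (z/(1+z)) + (z/(1+z)) * u n (1 - z/(1+z))"
    if "0 \<le> z" for n z
    using transfer_times_id[OF that, of "(transfer ^^ n) f"] by (simp add: u_def)
  have lim1: "(\<lambda>n. ln (real n) * u n 1) \<longlonglongrightarrow> I"
    using cone_asymptotics_at_1[OF cone F] by (simp add: u_def I_def)
  have shift: "(\<lambda>n. ln (real n) * u (Suc n) z) \<longlonglongrightarrow> I"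
    if "(\<lambda>n. ln (real n) * u n z) \<longlonglongrightarrow> I" for z
  proof -
    have "(\<lambda>n. ln (real (Suc n)) * u (Suc n) z) \<longlonglongrightarrow> I"
      using that by (rule LIMSEQ_Suc)
    moreover have "(\<lambda>n. ln (real n) / ln (real (Suc n))) \<longlonglongrightarrow> 1" by real_asymp
    ultimately have "(\<lambda>n. ln (real n) / ln (real (Suc n)) * (ln (real (Suc n)) * u (Suc n) z)) \<longlonglongrightarrow> 1 * I"
      by (intro tendsto_mult)
    moreover have "\<forall>\<^sub>F n in sequentially. ln (real n) / ln (real (Suc n)) * (ln (real (Suc n)) * u (Suc n) z)
        = ln (real n) * u (Suc n) z"
      using eventually_ge_at_top[of 1] by eventually_elim simp
    ultimately show ?thesis by (simp add: tendsto_cong)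
  qed
  have upper_half: "(\<lambda>n. ln (real n) * u n z) \<longlonglongrightarrow> I" if "z \<in> {1/2..1}" for z
  proof (rule tendsto_sandwich[OF _ _ shift[OF lim1] lim1])
    show "\<forall>\<^sub>F n in sequentially. ln (real n) * u (Suc n) 1 \<le> ln (real n) * u n z"
      using eventually_ge_at_top[of 1]
    proof eventually_elim
      case (elim n)
      have "u (Suc n) 1 = u n (1/2)" using rec[of 1 n] by simp
      also have "\<dots> \<le> u n z" using farey_coneD(4)[OF cn] that by auto
      finally show ?case using elim by (intro mult_left_mono) auto
    qed
    show "\<forall>\<^sub>F n in sequentially. ln (real n) * u n z \<le> ln (real n) * u n 1"
      using eventually_ge_at_top[of 1]
      by eventually_elim (use farey_coneD(4)[OF cn] that in \<open>auto intro!: mult_left_mono\<close>)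
  qed
  have "(\<lambda>n. ln (real n) * u n x) \<longlonglongrightarrow> I"
  proof (cases "x \<ge> 1/2")
    case True
    then show ?thesis using upper_half x by simp
  next
    case False
    define z where "z = x / (1 - x)"
    have z: "z \<in> {1/2..1}" "z / (1 + z) = x" using x False by (auto simp: z_def field_simps)
    have eq: "ln (real n) * u n x = (ln (real n) * u (Suc n) z - x * (ln (real n) * u n (1 - x))) / (1 - x)" for n
    proof -
      have "u (Suc n) z = (1 - x) * u n x + x * u n (1 - x)"
        using rec[of z n] z by simp
      then have "ln (real n) * u (Suc n) z - x * (ln (real n) * u n (1 - x)) = (1 - x) * (ln (real n) * u n x)"
        by (simp only:) (simp add: algebra_simps)
      then show ?thesis using False by simp
    qed
    have "(\<lambda>n. (ln (real n) * u (Suc n) z - x * (ln (real n) * u n (1 - x))) / (1 - x))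
        \<longlonglongrightarrow> (I - x * I) / (1 - x)"
      using z False x
      by (intro tendsto_divide tendsto_diff shift upper_half tendsto_mult tendsto_const) auto
    moreover have "(I - x * I) / (1 - x) = I" using False by (simp add: field_simps)
    ultimately show ?thesis by (simp add: eq)
  qed
  then have "(\<lambda>n. ln (real n) * u n x / x) \<longlonglongrightarrow> I / x"
    using x by (intro tendsto_divide tendsto_const) auto
  then show ?thesis using x by (simp add: u_def I_def)
qed

section \<open>Asymptotics for continuous functions\<close>

lemma transfer_funpow_lincomb:
  "(transfer ^^ n) (\<lambda>x. a * f x + b * g x) x = a * (transfer ^^ n) f x + b * (transfer ^^ n) g x"
proof (induction n arbitrary: x)
  case (Suc n)
  have "(transfer ^^ n) (\<lambda>x. a * f x + b * g x) = (\<lambda>x. a * (transfer ^^ n) f x + b * (transfer ^^ n) g x)"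
    using Suc by blast
  then have "(transfer ^^ Suc n) (\<lambda>x. a * f x + b * g x) x = transfer (\<lambda>x. a * (transfer ^^ n) f x + b * (transfer ^^ n) g x) x"
    by simp
  also have "\<dots> = a * transfer ((transfer ^^ n) f) x + b * transfer ((transfer ^^ n) g) x"
    unfolding transfer_def times_divide_eq_right add_divide_distrib[symmetric]
    by (rule arg_cong[where f = "\<lambda>t. t / (1 + x)\<^sup>2"]) (simp add: algebra_simps)
  finally show ?case by simp
qed simp

lemma transfer_funpow_Suc:
  "(transfer ^^ Suc n) f x = ((transfer ^^ n) f (x / (1 + x)) + (transfer ^^ n) f (1 / (1 + x))) / (1 + x)\<^sup>2"
  by (simp add: transfer_def)

lemma transfer_funpow_sum:
  "(transfer ^^ n) (\<lambda>x. \<Sum>i\<le>m::nat. a i * f i x) x = (\<Sum>i\<le>m. a i * (transfer ^^ n) (f i) x)"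
proof (induction m)
  case 0
  show ?case using transfer_funpow_lincomb[of n "a 0" "f 0" 0 "f 0" x] by simp
next
  case (Suc m)
  show ?case
    using Suc transfer_funpow_lincomb[of n 1 "\<lambda>x. \<Sum>i\<le>m. a i * f i x" "a (Suc m)" "f (Suc m)" x] by simp
qed

lemma transfer_funpow_abs_le:
  assumes "\<And>x. x \<in> {0..1} \<Longrightarrow> \<bar>f x\<bar> \<le> c" "x \<in> {0..1}"
  shows "\<bar>(transfer ^^ n) f x\<bar> \<le> c * (transfer ^^ n) (\<lambda>_. 1) x"
  using assms(2)
proof (induction n arbitrary: x)
  case 0
  then show ?case using assms by simp
next
  case (Suc n)
  let ?y = "x / (1 + x)" and ?z = "1 / (1 + x)"
  let ?f = "(transfer ^^ n) f" and ?o = "(transfer ^^ n) (\<lambda>_. 1)"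
  have pos: "0 < (1 + x)\<^sup>2" using Suc by auto
  have "\<bar>?f ?y + ?f ?z\<bar> \<le> c * (?o ?y + ?o ?z)"
    using Suc.IH[of ?y] Suc.IH[of ?z] inverse_branches_mem[OF Suc.prems] by (simp add: distrib_left)
  then show ?case
    using pos unfolding transfer_funpow_Suc abs_divide times_divide_eq_right
    by (simp add: divide_right_mono)
qed

lemma transfer_funpow_nonneg:
  assumes "\<And>x. x \<in> {0..1} \<Longrightarrow> 0 \<le> f x" "x \<in> {0..1}"
  shows "0 \<le> (transfer ^^ n) f x"
  using assms(2)
proof (induction n arbitrary: x)
  case (Suc n)
  then show ?case using inverse_branches_mem[OF Suc.prems] unfolding transfer_funpow_Suc by auto
qed (use assms in auto)

lemma id_in_cone: "(\<lambda>x. x * 1) \<in> farey_cone"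
  by (auto simp: farey_cone_def concave_on_ident monotone_on_def)

lemma one_asymptotics:
  assumes "y \<in> {1/3..1}"
  shows "(\<lambda>n. ln (real n) * (transfer ^^ n) (\<lambda>_. 1) y) \<longlonglongrightarrow> 1 / y"
proof -
  have "antideriv (\<lambda>x. x) (\<lambda>_. 1)" by (auto simp: antideriv_def)
  from cone_asymptotics[OF id_in_cone this assms] show ?thesis by simp
qed

lemma convex_power_unit: "convex_on {0..1::real} (\<lambda>x. x ^ n)"
proof (cases "even n")
  case True
  show ?thesis by (rule convex_on_subset[OF convex_power_even[OF True]]) auto
next
  case False
  show ?thesis by (rule convex_on_subset[OF convex_power_odd[OF False]]) auto
qed

text \<open>j + 1 is the least constant c for which x(c - x^j) increases on [0, 1]. The power x^j is
  then the difference of the cone elements j + 1 and (j + 1) - x^j.\<close>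

lemma power_cone:
  "(\<lambda>x. x * (real (Suc j) - x ^ j)) \<in> farey_cone"
proof -
  let ?u = "\<lambda>x::real. real (Suc j) * x - x ^ Suc j"
  have "concave_on {0..1} ?u"
    by (intro concave_on_diff convex_power_unit concave_on_cmul) (auto simp: concave_on_ident)
  moreover have mono: "?u x \<le> ?u y" if "0 \<le> x" "x \<le> y" "y \<le> 1" for x y
  proof (rule DERIV_nonneg_imp_nondecreasing[OF that(2)])
    fix z assume z: "x \<le> z" "z \<le> y"
    show "\<exists>D. (?u has_real_derivative D) (at z) \<and> 0 \<le> D"
    proof (intro exI conjI)
      show "(?u has_real_derivative real (Suc j) - real (Suc j) * z ^ j) (at z)"
        by (rule derivative_eq_intros refl | simp)+
      have "z ^ j \<le> 1" using z that by (intro power_le_one) auto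
      then show "0 \<le> real (Suc j) - real (Suc j) * z ^ j"
        by (metis diff_ge_0_iff_ge mult.right_neutral mult_left_mono of_nat_0_le_iff)
    qed
  qed
  moreover have "0 \<le> ?u x" if "0 \<le> x" "x \<le> 1" for x
    using mono[of 0 x] that by simp
  ultimately have "?u \<in> farey_cone" by (auto simp: farey_cone_def monotone_on_def)
  moreover have "?u = (\<lambda>x. x * (real (Suc j) - x ^ j))" by (auto simp: algebra_simps)
  ultimately show ?thesis by simp
qed

lemma power_asymptotics:
  assumes "y \<in> {1/3..1}"
  shows "(\<lambda>n. ln (real n) * (transfer ^^ n) (\<lambda>x. x ^ j) y) \<longlonglongrightarrow> (1 / real (Suc j)) / y"
proof -
  let ?f = "\<lambda>x::real. real (Suc j) - x ^ j"
  let ?F = "\<lambda>x::real. real (Suc j) * x - x ^ Suc j / real (Suc j)"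
  have "antideriv ?F ?f"
    unfolding antideriv_def
    by (intro ballI) (rule derivative_eq_intros refl | simp)+
  from cone_asymptotics[OF power_cone this assms]
  have "(\<lambda>n. ln (real n) * (transfer ^^ n) ?f y) \<longlonglongrightarrow> (real (Suc j) - 1 / real (Suc j)) / y"
    by simp
  from tendsto_diff[OF tendsto_mult[OF tendsto_const[of "real (Suc j)"] one_asymptotics[OF assms]] this]
  have *: "(\<lambda>n. real (Suc j) * (ln (real n) * (transfer ^^ n) (\<lambda>_. 1) y) - ln (real n) * (transfer ^^ n) ?f y)
      \<longlonglongrightarrow> real (Suc j) * (1 / y) - (real (Suc j) - 1 / real (Suc j)) / y" .
  have "(transfer ^^ n) (\<lambda>x. x ^ j) y = real (Suc j) * (transfer ^^ n) (\<lambda>_. 1) y - (transfer ^^ n) ?f y" for n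
    using transfer_funpow_lincomb[of n "real (Suc j)" "\<lambda>_. 1" "-1" ?f y] by simp
  moreover have "real (Suc j) * (1 / y) - (real (Suc j) - 1 / real (Suc j)) / y = (1 / real (Suc j)) / y"
    by (simp add: diff_divide_distrib)
  moreover have "(\<lambda>n. real (Suc j) * (ln (real n) * (transfer ^^ n) (\<lambda>_. 1) y) - ln (real n) * (transfer ^^ n) ?f y)
      = (\<lambda>n. ln (real n) * (real (Suc j) * (transfer ^^ n) (\<lambda>_. 1) y - (transfer ^^ n) ?f y))"
    by (rule ext) (simp only: right_diff_distrib mult.left_commute)
  ultimately show ?thesis using * by (simp only:)
qed

text \<open>A polynomial approximation within \<epsilon> costs at most \<epsilon> P^n 1 by
  positivity, and ln n P^n 1 tends to 1/y, which is at most 3; so the error stays small after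
  scaling.\<close>

proposition continuous_asymptotics:
  assumes g: "continuous_on {0..1} g" and B: "antideriv B g" and y: "y \<in> {1/3..1}"
  shows "(\<lambda>n. ln (real n) * (transfer ^^ n) g y) \<longlonglongrightarrow> (B 1 - B 0) / y"
proof (rule LIMSEQ_I)
  fix e :: real assume e: "0 < e"
  \<comment> \<open>The errors 4\<epsilon>, \<epsilon> and 3\<epsilon> add up to 8\<epsilon> =
    e/2.\<close>
  define \<epsilon> where "\<epsilon> = e / 16"
  have \<epsilon>: "0 < \<epsilon>" using e by (simp add: \<epsilon>_def)
  obtain p where "real_polynomial_function p" and p: "\<And>x. x \<in> {0..1} \<Longrightarrow> \<bar>g x - p x\<bar> < \<epsilon>"
    using Stone_Weierstrass_real_polynomial_function[OF compact_Icc g \<epsilon>] by metis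
  then obtain a m where pa: "p = (\<lambda>x. \<Sum>i\<le>m::nat. a i * x ^ i)"
    using real_polynomial_function_iff_sum by metis
  define J where "J = (\<Sum>i\<le>m. a i * (1 / real (Suc i)))"
  define F where "F = (\<lambda>x. \<Sum>i\<le>m. a i * (x ^ Suc i / real (Suc i)))"
  have "antideriv F p"
    unfolding antideriv_def pa F_def
    by (intro ballI) (rule derivative_eq_intros refl | simp add: mult.commute)+
  then have "antideriv (\<lambda>x. B x - F x) (\<lambda>x. g x - p x)"
    using B unfolding antideriv_def by (auto intro: DERIV_diff)
  moreover have "- \<epsilon> \<le> g x - p x \<and> g x - p x \<le> \<epsilon>" if "0 < x" "x < 1" for x
    using p[of x] that by (simp add: abs_less_iff less_imp_le)
  ultimately have "- \<epsilon> * (1 - 0) \<le> B 1 - F 1 - (B 0 - F 0) \<and> B 1 - F 1 - (B 0 - F 0) \<le> \<epsilon> * (1 - 0)"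
    by (intro antideriv_increment_bounds[where f = "\<lambda>x. g x - p x"]) auto
  then have "\<bar>(B 1 - B 0) - (F 1 - F 0)\<bar> \<le> \<epsilon>"
    by (auto simp: abs_le_iff)
  moreover have "F 1 - F 0 = J" by (simp add: J_def F_def)
  ultimately have BJ: "\<bar>(B 1 - B 0) - J\<bar> \<le> \<epsilon>" by simp
  have "(\<lambda>n. \<Sum>i\<le>m. a i * (ln (real n) * (transfer ^^ n) (\<lambda>x. x ^ i) y)) \<longlonglongrightarrow> (\<Sum>i\<le>m. a i * ((1 / real (Suc i)) / y))"
    by (intro tendsto_sum tendsto_mult tendsto_const power_asymptotics y)
  moreover have "ln (real n) * (transfer ^^ n) p y = (\<Sum>i\<le>m. a i * (ln (real n) * (transfer ^^ n) (\<lambda>x. x ^ i) y))" for n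
    unfolding pa by (simp add: transfer_funpow_sum[where f = "\<lambda>i x. x ^ i"] sum_distrib_left algebra_simps)
  moreover have "(\<Sum>i\<le>m. a i * ((1 / real (Suc i)) / y)) = J / y"
    by (simp add: J_def sum_divide_distrib)
  ultimately have lp: "(\<lambda>n. ln (real n) * (transfer ^^ n) p y) \<longlonglongrightarrow> J / y" by simp
  have y3: "1 / y \<le> 3" "0 < y" using y by (auto simp: field_simps)
  then have "1 / y < 4" by linarith
  then have ev1: "\<forall>\<^sub>F n in sequentially. ln (real n) * (transfer ^^ n) (\<lambda>_. 1) y < 4"
    by (rule order_tendstoD(2)[OF one_asymptotics[OF y]])
  have ev2: "\<forall>\<^sub>F n in sequentially. \<bar>ln (real n) * (transfer ^^ n) p y - J / y\<bar> < \<epsilon>"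
    using tendstoD[OF lp \<epsilon>] by (simp add: dist_real_def)
  have "\<forall>\<^sub>F n in sequentially. norm (ln (real n) * (transfer ^^ n) g y - (B 1 - B 0) / y) < e"
    using ev1 ev2 eventually_ge_at_top[of 1]
  proof eventually_elim
    case (elim n)
    have y01: "y \<in> {0..1}" using y by auto
    have "(transfer ^^ n) (\<lambda>x. g x - p x) y = (transfer ^^ n) g y - (transfer ^^ n) p y"
      using transfer_funpow_lincomb[of n 1 g "-1" p y] by simp
    with transfer_funpow_abs_le[of "\<lambda>x. g x - p x" \<epsilon> y n] p y01
    have "\<bar>(transfer ^^ n) g y - (transfer ^^ n) p y\<bar> \<le> \<epsilon> * (transfer ^^ n) (\<lambda>_. 1) y"
      by (auto simp: less_imp_le)
    then have "ln (real n) * \<bar>(transfer ^^ n) g y - (transfer ^^ n) p y\<bar> \<le> ln (real n) * (\<epsilon> * (transfer ^^ n) (\<lambda>_. 1) y)"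
      using elim by (intro mult_left_mono) auto
    also have "\<dots> = \<epsilon> * (ln (real n) * (transfer ^^ n) (\<lambda>_. 1) y)" by simp
    also have "\<dots> \<le> \<epsilon> * 4" using elim \<epsilon> by (intro mult_left_mono) auto
    finally have 1: "\<bar>ln (real n) * (transfer ^^ n) g y - ln (real n) * (transfer ^^ n) p y\<bar> \<le> \<epsilon> * 4"
      using elim by (simp add: abs_mult right_diff_distrib[symmetric])
    have "\<bar>(B 1 - B 0) / y - J / y\<bar> = \<bar>(B 1 - B 0) - J\<bar> * (1 / y)"
      using y3 by (simp add: diff_divide_distrib[symmetric] abs_divide)
    also have "\<dots> \<le> \<epsilon> * 3" using BJ y3 \<epsilon> by (intro mult_mono) auto
    finally have 2: "\<bar>(B 1 - B 0) / y - J / y\<bar> \<le> \<epsilon> * 3" .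
    from 1 2 elim(2) have "\<bar>ln (real n) * (transfer ^^ n) g y - (B 1 - B 0) / y\<bar> \<le> \<epsilon> * 8" by linarith
    also have "\<dots> < e" using e by (simp add: \<epsilon>_def)
    finally show ?case by simp
  qed
  then show "\<exists>no. \<forall>n\<ge>no. norm (ln (real n) * (transfer ^^ n) g y - (B 1 - B 0) / y) < e"
    by (simp add: eventually_sequentially)
qed

text \<open>The shift by 2 keeps the logarithm away from 0 for every n, so one constant controls P^n
  1 as well as its logarithmic multiple in the domination argument.\<close>

lemma one_bound:
  assumes "y \<in> {1/3..1}"
  obtains C where "C > 0" "\<And>n. ln (real n + 2) * (transfer ^^ n) (\<lambda>_. 1) y \<le> C"
proof -
  have "(\<lambda>n. ln (real n + 2) / ln (real n)) \<longlonglongrightarrow> 1" by real_asymp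
  from tendsto_mult[OF this one_asymptotics[OF assms]]
  have "(\<lambda>n. ln (real n + 2) / ln (real n) * (ln (real n) * (transfer ^^ n) (\<lambda>_. 1) y)) \<longlonglongrightarrow> 1 * (1 / y)" .
  moreover have "\<forall>\<^sub>F n in sequentially. ln (real n + 2) / ln (real n) * (ln (real n) * (transfer ^^ n) (\<lambda>_. 1) y)
      = ln (real n + 2) * (transfer ^^ n) (\<lambda>_. 1) y"
    using eventually_ge_at_top[of 2] by eventually_elim simp
  ultimately have "(\<lambda>n. ln (real n + 2) * (transfer ^^ n) (\<lambda>_. 1) y) \<longlonglongrightarrow> 1 / y"
    by (simp add: tendsto_cong)
  then have "Bseq (\<lambda>n. ln (real n + 2) * (transfer ^^ n) (\<lambda>_. 1) y)"
    using convergent_imp_Bseq convergentI by blast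
  then obtain C where "C > 0" "\<And>n. norm (ln (real n + 2) * (transfer ^^ n) (\<lambda>_. 1) y) \<le> C"
    by (auto simp: Bseq_def)
  then show ?thesis by (intro that[of C]) (auto simp: abs_le_iff)
qed

section \<open>Digit sequences and the decomposition of the iterates\<close>

text \<open>The digit \<open>True\<close> stands for the decreasing branch \<open>1/(1+x)\<close>, \<open>False\<close> for \<open>x/(1+x)\<close>.\<close>
definition branch :: "bool \<Rightarrow> real \<Rightarrow> real" where
  "branch b x = (if b then 1 / (1 + x) else x / (1 + x))"

text \<open>The branch of \<open>d 0\<close> is applied last, so that the images of [0, 1] are
  nested cylinders.\<close>

primrec cyl :: "(nat \<Rightarrow> bool) \<Rightarrow> nat \<Rightarrow> real \<Rightarrow> real" where
  "cyl d 0 x = x"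
| "cyl d (Suc n) x = cyl d n (branch (d n) x)"

text \<open>Denominator of the Moebius map \<open>cyl d n\<close>; its square is the reciprocal of
  the absolute derivative.\<close>

primrec den :: "(nat \<Rightarrow> bool) \<Rightarrow> nat \<Rightarrow> real \<Rightarrow> real" where
  "den d 0 x = 1"
| "den d (Suc n) x = den d n (branch (d n) x) * (1 + x)"

primrec den_coeffs :: "(nat \<Rightarrow> bool) \<Rightarrow> nat \<Rightarrow> real \<times> real" where
  "den_coeffs d 0 = (1, 0)"
| "den_coeffs d (Suc n) = (if d n then (fst (den_coeffs d n) + snd (den_coeffs d n), fst (den_coeffs d n))
                   else (fst (den_coeffs d n), fst (den_coeffs d n) + snd (den_coeffs d n)))"

lemma branch_mem: "x \<in> {0..1} \<Longrightarrow> branch b x \<in> {0..1}"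
  using inverse_branches_mem[of x] by (auto simp: branch_def)

lemma branch_nonneg: "0 \<le> x \<Longrightarrow> 0 \<le> branch b x"
  by (auto simp: branch_def)

lemma branch_True_antimono: "0 \<le> x \<Longrightarrow> x \<le> y \<Longrightarrow> branch True y \<le> branch True x"
  by (simp add: branch_def frac_le)

lemma branch_False_mono: "0 \<le> x \<Longrightarrow> x \<le> y \<Longrightarrow> branch False x \<le> branch False y"
  by (simp add: branch_def field_simps)

lemma branch_values:
  "branch True 1 = 1/2" "branch True (1/3) = 3/4" "branch True (3/4) = 4/7"
  "branch False 1 = 1/2" "branch False (1/2) = 1/3" "branch False (3/4) = 3/7"
  by (simp_all add: branch_def)

lemma branch_diff:
  assumes "0 \<le> x" "0 \<le> y"
  shows "\<bar>branch b x - branch b y\<bar> = \<bar>x - y\<bar> / ((1 + x) * (1 + y))"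
proof -
  have pos: "0 < (1 + x) * (1 + y)" "1 + x \<noteq> 0" "1 + y \<noteq> 0" using assms by auto
  have "branch b x - branch b y = (if b then y - x else x - y) / ((1 + x) * (1 + y))"
    using diff_frac_eq[OF pos(2,3), of 1 1] diff_frac_eq[OF pos(2,3), of x y]
    by (simp add: branch_def algebra_simps)
  then show ?thesis using pos by (auto simp: abs_divide abs_minus_commute)
qed

lemma cyl_mem: "x \<in> {0..1} \<Longrightarrow> cyl d n x \<in> {0..1}"
  by (induction n arbitrary: x) (auto simp: branch_mem simp del: atLeastAtMost_iff)

lemma den_pos: "0 \<le> x \<Longrightarrow> 0 < den d n x"
  by (induction n arbitrary: x) (auto simp: branch_nonneg)

text \<open>Exact for Moebius maps: distances contract by the geometric mean of the absolute
  derivatives at the two points.\<close>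

lemma cyl_diff:
  assumes "0 \<le> x" "0 \<le> y"
  shows "\<bar>cyl d n x - cyl d n y\<bar> = \<bar>x - y\<bar> / (den d n x * den d n y)"
  using assms
proof (induction n arbitrary: x y)
  case (Suc n)
  then show ?case
    using Suc.IH[of "branch (d n) x" "branch (d n) y"] branch_diff[of x y "d n"]
    by (simp add: branch_nonneg mult_ac)
qed simp

lemma den_eq: "0 \<le> x \<Longrightarrow> den d n x = fst (den_coeffs d n) + snd (den_coeffs d n) * x"
proof (induction n arbitrary: x)
  case (Suc n)
  have ne: "1 + x \<noteq> 0" using Suc by simp
  have IH: "den d n (branch (d n) x) = fst (den_coeffs d n) + snd (den_coeffs d n) * branch (d n) x"
    by (rule Suc.IH[OF branch_nonneg[OF Suc.prems]])
  have "branch (d n) x * (1 + x) = (if d n then 1 else x)" using ne by (simp add: branch_def)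
  then have "den d (Suc n) x = fst (den_coeffs d n) * (1 + x) + snd (den_coeffs d n) * (if d n then 1 else x)"
    by (simp add: IH distrib_right mult.assoc del: if_split)
  then show ?case by (simp add: algebra_simps)
qed simp

lemma cyl_cong: "(\<And>k. k < n \<Longrightarrow> d k = e k) \<Longrightarrow> cyl d n x = cyl e n x"
  by (induction n arbitrary: x) auto

text \<open>Without 00 only the continued fraction entries 1 (digit 1) and 2 (digits 01) occur, and
  orbits stay away from the neutral fixed point 0.\<close>

definition no00 :: "(nat \<Rightarrow> bool) \<Rightarrow> bool" where
  "no00 d \<longleftrightarrow> (\<forall>n. \<not> d n \<longrightarrow> d (Suc n))"

section \<open>Growth of the denominators\<close>

definition \<phi> :: real where "\<phi> = (1 + sqrt 5) / 2"

lemma phi_bounds: "1 < \<phi>" "\<phi> < 2" "\<phi> * \<phi> = \<phi> + 1"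
proof -
  have "2 < sqrt 5" "sqrt 5 < 3" by (auto simp: real_less_rsqrt real_less_lsqrt)
  then show "1 < \<phi>" "\<phi> < 2" by (auto simp: \<phi>_def)
  have "sqrt 5 * sqrt 5 = (5::real)" by simp
  then show "\<phi> * \<phi> = \<phi> + 1" by (simp add: \<phi>_def field_simps)
qed

text \<open>\<open>(\<phi>, 1)\<close> is the left eigenvector, for the eigenvalue \<open>\<phi>\<close>, of the action of the digit
  \<open>1\<close> on the pair of coefficients of \<open>den\<close>.\<close>
definition esize :: "(nat \<Rightarrow> bool) \<Rightarrow> nat \<Rightarrow> real" where
  "esize d n = \<phi> * fst (den_coeffs d n) + snd (den_coeffs d n)"

definition zeros :: "(nat \<Rightarrow> bool) \<Rightarrow> nat \<Rightarrow> nat" where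
  "zeros d n = card {k. k < n \<and> \<not> d k}"

lemma zeros_0 [simp]: "zeros d 0 = 0"
  by (simp add: zeros_def)

lemma zeros_Suc [simp]: "zeros d (Suc n) = (if d n then zeros d n else Suc (zeros d n))"
proof -
  have "{k. k < Suc n \<and> \<not> d k} = (if d n then {k. k < n \<and> \<not> d k} else insert n {k. k < n \<and> \<not> d k})"
    by (auto simp: less_Suc_eq)
  then show ?thesis by (auto simp: zeros_def)
qed

lemma den_coeffs_pos: "1 \<le> fst (den_coeffs d n)" "0 \<le> snd (den_coeffs d n)"
  by (induction n) auto

text \<open>The induction needs the sharper ratio 1 before a digit 0, because that digit adds the
  first coefficient to the second; the digit after it is then a 1.\<close>

lemma den_coeffs_ratio_aux:
  assumes "no00 d"
  shows "snd (den_coeffs d n) \<le> 2 * fst (den_coeffs d n) \<and> (\<not> d n \<longrightarrow> snd (den_coeffs d n) \<le> fst (den_coeffs d n))"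
proof (induction n)
  case (Suc n)
  then show ?case using assms den_coeffs_pos[of d n] by (auto simp: no00_def)
qed simp

lemma den_coeffs_ratio: "no00 d \<Longrightarrow> snd (den_coeffs d n) \<le> 2 * fst (den_coeffs d n)"
  using den_coeffs_ratio_aux by blast

lemma esize_Suc:
  "esize d (Suc n) = (if d n then \<phi> * esize d n else esize d n + fst (den_coeffs d n))"
proof -
  have "\<phi> * (\<phi> * fst (den_coeffs d n)) = \<phi> * fst (den_coeffs d n) + fst (den_coeffs d n)"
    unfolding mult.assoc[symmetric] phi_bounds(3) by (simp add: distrib_right)
  then show ?thesis by (simp add: esize_def distrib_left)
qed

lemma fst_le_esize: "fst (den_coeffs d n) \<le> esize d n"
proof -
  have "1 * fst (den_coeffs d n) \<le> \<phi> * fst (den_coeffs d n)"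
    using den_coeffs_pos[of d n] phi_bounds by (intro mult_right_mono) auto
  then show ?thesis using den_coeffs_pos(2)[of d n] unfolding esize_def by linarith
qed

lemma esize_ge_1: "1 \<le> esize d n"
  using fst_le_esize[of d n] den_coeffs_pos[of d n] by linarith

lemma den_le_esize:
  assumes "x \<in> {0..1}"
  shows "den d n x \<le> esize d n"
proof -
  have "snd (den_coeffs d n) * x \<le> snd (den_coeffs d n) * 1"
    using assms den_coeffs_pos[of d n] by (intro mult_left_mono) auto
  moreover have "1 * fst (den_coeffs d n) \<le> \<phi> * fst (den_coeffs d n)"
    using den_coeffs_pos[of d n] phi_bounds by (intro mult_right_mono) auto
  ultimately show ?thesis using assms den_eq[of x d n] unfolding esize_def by simp
qed

text \<open>Bounded distortion: 4 = 2 + 2 comes from \<phi> < 2 and from the ratio bound on the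
  coefficients.\<close>

lemma esize_le_den:
  assumes "no00 d" "0 \<le> x"
  shows "esize d n \<le> 4 * den d n x"
proof -
  have "\<phi> * fst (den_coeffs d n) \<le> 2 * fst (den_coeffs d n)"
    using den_coeffs_pos[of d n] phi_bounds by (intro mult_right_mono) auto
  moreover have "0 \<le> snd (den_coeffs d n) * x" using assms den_coeffs_pos[of d n] by simp
  moreover have "4 * den d n x = 4 * fst (den_coeffs d n) + 4 * (snd (den_coeffs d n) * x)"
    by (simp add: den_eq[OF assms(2)])
  ultimately show ?thesis using den_coeffs_ratio[OF assms(1), of n] unfolding esize_def by linarith
qed

text \<open>A digit 1 multiplies \<open>esize\<close> by exactly \<phi>; a digit 0 does not decrease
  it and so loses at most one factor \<phi>.\<close>

lemma esize_lower: "\<phi> ^ n \<le> \<phi> ^ zeros d n * esize d n"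
proof (induction n)
  case 0
  then show ?case using esize_ge_1[of d 0] by simp
next
  case (Suc n)
  show ?case
  proof (cases "d n")
    case True
    then show ?thesis using Suc phi_bounds by (simp add: esize_Suc mult.left_commute)
  next
    case False
    have "\<phi> * \<phi> ^ n \<le> \<phi> * (\<phi> ^ zeros d n * esize d n)"
      using Suc phi_bounds by (intro mult_left_mono) auto
    also have "\<dots> \<le> \<phi> * (\<phi> ^ zeros d n * (esize d n + fst (den_coeffs d n)))"
      using den_coeffs_pos[of d n] phi_bounds by (intro mult_left_mono) auto
    finally show ?thesis using False by (simp add: esize_Suc mult.assoc)
  qed
qed

text \<open>A digit 0 adds the first coefficient, which is at most \<open>esize\<close>, and so at
  most doubles it.\<close>

lemma esize_upper: "esize d n \<le> \<phi> * \<phi> ^ n * 2 ^ zeros d n"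
proof (induction n)
  case 0
  then show ?case by (simp add: esize_def)
next
  case (Suc n)
  show ?case
  proof (cases "d n")
    case True
    then show ?thesis using Suc phi_bounds by (simp add: esize_Suc mult.assoc mult_left_mono)
  next
    case False
    have "esize d (Suc n) \<le> 2 * esize d n" using False fst_le_esize[of d n] by (simp add: esize_Suc)
    also have "\<dots> \<le> 2 * (\<phi> * \<phi> ^ n * 2 ^ zeros d n)" using Suc by simp
    also have "\<dots> \<le> \<phi> * (2 * (\<phi> * \<phi> ^ n * 2 ^ zeros d n))"
    proof -
      have "0 \<le> 2 * (\<phi> * \<phi> ^ n * 2 ^ zeros d n)" using phi_bounds by simp
      then show ?thesis using phi_bounds mult_right_mono[of 1 \<phi>] by fastforce
    qed
    finally show ?thesis using False by (simp add: mult_ac)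
  qed
qed

lemma esize_mono: "esize d n \<le> esize d (Suc n)"
  using esize_ge_1[of d n] den_coeffs_pos[of d n] phi_bounds by (auto simp: esize_Suc)

lemma esize_two_steps:
  assumes "no00 d"
  shows "\<phi> * esize d n \<le> esize d (Suc (Suc n))"
proof (cases "d n")
  case True
  then show ?thesis using esize_mono[of d "Suc n"] by (simp add: esize_Suc[of d n])
next
  case False
  then have "d (Suc n)" using assms by (auto simp: no00_def)
  then show ?thesis using esize_mono[of d n] phi_bounds by (simp add: esize_Suc[of d "Suc n"])
qed

text \<open>Of two consecutive digits at least one is 1, so \<open>esize\<close> gains a factor
  \<phi> every two steps, however many zeros there are.\<close>

lemma esize_square_lower:
  assumes "no00 d"
  shows "\<phi> ^ n \<le> (esize d n)\<^sup>2"
proof (induction n rule: induct_nat_012)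
  case 0
  then show ?case using esize_ge_1[of d 0] by (simp add: one_le_power)
next
  case 1
  have "\<phi> \<le> esize d 1" using esize_mono[of d 0] by (simp add: esize_def)
  moreover have "esize d 1 \<le> (esize d 1)\<^sup>2"
    using esize_ge_1[of d 1] by (simp add: power2_eq_square)
  ultimately show ?case by simp
next
  case (ge2 n)
  have "\<phi> ^ Suc (Suc n) = \<phi>\<^sup>2 * \<phi> ^ n" by (simp add: power2_eq_square)
  also have "\<dots> \<le> \<phi>\<^sup>2 * (esize d n)\<^sup>2" using ge2 by (intro mult_left_mono) auto
  also have "\<dots> = (\<phi> * esize d n)\<^sup>2" by (simp add: power_mult_distrib)
  also have "\<dots> \<le> (esize d (Suc (Suc n)))\<^sup>2"
    using esize_two_steps[OF assms, of n] esize_ge_1[of d n] phi_bounds by (intro power_mono) auto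
  finally show ?case .
qed

lemma den_continuous: "continuous_on {0..1} (den d n)"
proof -
  have "continuous_on {0..1} (\<lambda>x. fst (den_coeffs d n) + snd (den_coeffs d n) * x)"
    by (intro continuous_intros)
  then show ?thesis by (rule continuous_on_eq) (simp add: den_eq)
qed

section \<open>Orientation and derivatives of the cylinder maps\<close>

definition bsgn :: "bool \<Rightarrow> real" where
  "bsgn b = (if b then - 1 else 1)"

primrec csgn :: "(nat \<Rightarrow> bool) \<Rightarrow> nat \<Rightarrow> real" where
  "csgn d 0 = 1"
| "csgn d (Suc n) = csgn d n * bsgn (d n)"

lemma bsgn_square: "bsgn b * bsgn b = 1"
  by (simp add: bsgn_def)

lemma csgn_square: "csgn d n * csgn d n = 1"
proof (induction n)
  case (Suc n)
  have "csgn d (Suc n) * csgn d (Suc n) = (csgn d n * csgn d n) * (bsgn (d n) * bsgn (d n))"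
    by (simp add: mult_ac)
  then show ?case using Suc by (simp add: bsgn_square)
qed simp

lemma branch_deriv:
  assumes "0 \<le> x"
  shows "(branch b has_real_derivative bsgn b / (1 + x)\<^sup>2) (at x within S)"
proof -
  have ne: "1 + x \<noteq> 0" using assms by simp
  show ?thesis
  proof (cases b)
    case True
    have "((\<lambda>x. 1 / (1 + x)) has_real_derivative - 1 / (1 + x)\<^sup>2) (at x within S)"
      using ne by (auto intro!: derivative_eq_intros simp: divide_simps power2_eq_square)
    then show ?thesis using True by (simp add: branch_def[abs_def] bsgn_def)
  next
    case False
    have "((\<lambda>x. x / (1 + x)) has_real_derivative 1 / (1 + x)\<^sup>2) (at x within S)"
      using ne by (auto intro!: derivative_eq_intros simp: divide_simps power2_eq_square)
    then show ?thesis using False by (simp add: branch_def[abs_def] bsgn_def)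
  qed
qed

lemma cyl_deriv:
  assumes "0 \<le> x"
  shows "(cyl d n has_real_derivative csgn d n / (den d n x)\<^sup>2) (at x)"
  using assms
proof (induction n arbitrary: x)
  case 0
  have "cyl d 0 = (\<lambda>x. x)" by (rule ext) simp
  then show ?case by simp
next
  case (Suc n)
  have "((\<lambda>x. cyl d n (branch (d n) x)) has_real_derivative
      csgn d n / (den d n (branch (d n) x))\<^sup>2 * (bsgn (d n) / (1 + x)\<^sup>2)) (at x)"
    by (rule DERIV_chain2[OF Suc.IH[OF branch_nonneg[OF Suc.prems]] branch_deriv[OF Suc.prems]])
  moreover have "cyl d (Suc n) = (\<lambda>x. cyl d n (branch (d n) x))" by (rule ext) simp
  ultimately show ?case by (simp add: power_mult_distrib)
qed

lemma cyl_continuous: "continuous_on {0..1} (cyl d n)"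
  by (intro continuous_at_imp_continuous_on ballI DERIV_isCont[OF cyl_deriv]) simp

lemma branch_continuous: "continuous_on {0..1} (branch b)"
  by (rule DERIV_continuous_on[OF branch_deriv]) auto

section \<open>Coded points, their orbits, main terms and side terms\<close>

lemma farey_br: "x \<in> {0..1} \<Longrightarrow> farey (branch b x) = x"
proof -
  assume x: "x \<in> {0..1}"
  then have ne: "1 + x \<noteq> 0" by auto
  have 1: "1 - x / (1 + x) = 1 / (1 + x)" "1 - 1 / (1 + x) = x / (1 + x)"
    using ne by (simp_all add: field_simps)
  show ?thesis
  proof (cases b)
    case True
    \<comment> \<open>At x = 1 both branches give 1/2, which \<open>farey\<close> treats by its
      first clause; for x < 1 the decreasing branch lies strictly above 1/2.\<close>
    show ?thesis
    proof (cases "x = 1")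
      case False
      then have "\<not> 1 / (1 + x) \<le> 1 / 2" using x by (auto simp: field_simps)
      then show ?thesis using True ne by (simp add: farey_def branch_def 1)
    qed (simp add: True farey_def branch_def)
  next
    case False
    then show ?thesis using inverse_branches_mem(3)[OF x] ne by (simp add: farey_def branch_def 1)
  qed
qed

lemma farey_cyl: "x \<in> {0..1} \<Longrightarrow> (farey ^^ n) (cyl d n x) = x"
proof (induction n arbitrary: x)
  case (Suc n)
  then show ?case using Suc.IH[of "branch (d n) x"] by (simp add: branch_mem farey_br del: atLeastAtMost_iff)
qed simp

text \<open>Membership in every cylinder expresses that d is the Farey code of \<tau>.\<close>

locale farey_point =
  fixes d :: "nat \<Rightarrow> bool" and \<tau> :: real
  assumes no00: "no00 d" and mem_cyl: "\<exists>y\<in>{0..1}. \<tau> = cyl d n y"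
begin

definition s :: "nat \<Rightarrow> real" where "s n = (farey ^^ n) \<tau>"

lemma s_mem: "s n \<in> {0..1}" and s_cyl: "cyl d n (s n) = \<tau>"
  using mem_cyl[of n] farey_cyl[of _ n d] unfolding s_def by fastforce+

lemma farey_s: "farey (s n) = s (Suc n)"
  by (simp add: s_def)

lemma s_br: "s n = branch (d n) (s (Suc n))"
proof -
  have "(farey ^^ n) (cyl d n (branch (d n) (s (Suc n)))) = branch (d n) (s (Suc n))"
    by (rule farey_cyl[OF branch_mem[OF s_mem]])
  then show ?thesis using s_cyl[of "Suc n"] by (simp add: s_def)
qed

lemma s_nonneg: "0 \<le> s n" and s_le_1: "s n \<le> 1"
  using s_mem[of n] by auto

lemma s_br_True: "d n \<Longrightarrow> s n = branch True (s (Suc n))"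
  and s_br_False: "\<not> d n \<Longrightarrow> s n = branch False (s (Suc n))"
  using s_br[of n] by auto

lemma s_ge_half: "d n \<Longrightarrow> 1/2 \<le> s n"
  using branch_True_antimono[OF s_nonneg s_le_1, of "Suc n"] by (simp add: s_br_True branch_values)

text \<open>The orbit bounds feed one another: digit 1 gives at least 1/2, hence always at least 1/3
  as 00 is excluded, hence at most 3/4, hence a gap between 3/7 and 4/7 that separates the two
  digits.\<close>

lemma s_ge_third: "1/3 \<le> s n"
proof (cases "d n")
  case True
  then show ?thesis using s_ge_half[of n] by linarith
next
  case False
  then have "d (Suc n)" using no00 by (simp add: no00_def)
  from branch_False_mono[OF _ s_ge_half[OF this]] show ?thesis
    by (simp add: s_br_False[OF False] branch_values)
qed

lemma s_le_34: "s n \<le> 3/4"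
proof (cases "d n")
  case True
  from branch_True_antimono[OF _ s_ge_third, of "Suc n"] show ?thesis
    by (simp add: s_br_True[OF True] branch_values)
next
  case False
  from branch_False_mono[OF s_nonneg s_le_1, of "Suc n"] show ?thesis
    by (simp add: s_br_False[OF False] branch_values)
qed

lemma s_digit_one: "d n \<Longrightarrow> 4/7 \<le> s n"
  using branch_True_antimono[OF s_nonneg s_le_34, of "Suc n"] by (simp add: s_br_True branch_values)

lemma s_digit_zero: "\<not> d n \<Longrightarrow> s n \<le> 3/7"
  using branch_False_mono[OF s_nonneg s_le_34, of "Suc n"] by (simp add: s_br_False branch_values)

lemma s_digit: "d n \<longleftrightarrow> 1/2 < s n"
  using s_digit_one[of n] s_digit_zero[of n] by (cases "d n") auto

text \<open>The other branch stays on the opposite side of 1/2, and 1/14 is the distance of 1/2 from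
  both 3/7 and 4/7.\<close>

lemma s_other_branch:
  assumes "x \<in> {0..1}"
  shows "1/14 \<le> \<bar>s n - branch (\<not> d n) x\<bar>"
  using inverse_branches_mem[OF assms] s_digit_one[of n] s_digit_zero[of n] unfolding branch_def by (cases "d n") auto

lemma tau_dist:
  assumes "0 \<le> x"
  shows "\<bar>\<tau> - cyl d n x\<bar> = \<bar>s n - x\<bar> / (den d n (s n) * den d n x)"
  using cyl_diff[OF _ assms, of "s n" d n] s_mem[of n] s_cyl[of n] by simp

text \<open>Contribution to P^n v of the one branch that follows the code of \<tau>. At x = s n its
  value is the placeholder 0, where the true value is infinite.\<close>

definition main_term :: "real \<Rightarrow> nat \<Rightarrow> real \<Rightarrow> real" where
  "main_term \<alpha> n x = \<bar>\<tau> - cyl d n x\<bar> powr (- \<alpha>) / (den d n x)\<^sup>2"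

lemma main_term_nonneg: "0 \<le> main_term \<alpha> n x"
  by (simp add: main_term_def)

text \<open>By \<open>cyl_diff\<close> the term is (AB)^\<alpha> / B^2 times |s n - x|^(-\<alpha>),
  with A and B the denominators at s n and x. Both agree with \<open>esize\<close> up to a factor 4,
  and 16 = 4^2.\<close>

lemma main_term_bounds:
  assumes \<alpha>: "0 < \<alpha>" "\<alpha> < 1" and x: "x \<in> {0..1}" "x \<noteq> s n"
  shows "main_term \<alpha> n x \<le> 16 * ((esize d n)\<^sup>2 powr (\<alpha> - 1) * \<bar>s n - x\<bar> powr (- \<alpha>))"
    and "(esize d n)\<^sup>2 powr (\<alpha> - 1) * \<bar>s n - x\<bar> powr (- \<alpha>) \<le> 16 * main_term \<alpha> n x"
proof -
  define A B E \<delta> where "A = den d n (s n)" and "B = den d n x" and "E = esize d n"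
    and "\<delta> = \<bar>s n - x\<bar> powr (- \<alpha>)"
  have AB: "0 < A" "0 < B" "A \<le> E" "B \<le> E" "E \<le> 4 * A" "E \<le> 4 * B" "1 \<le> E"
    using s_mem[of n] x
    by (auto simp: A_def B_def E_def intro!: den_pos den_le_esize esize_le_den[OF no00] esize_ge_1)
  have \<delta>: "0 \<le> \<delta>" by (simp add: \<delta>_def)
  have "main_term \<alpha> n x = (\<bar>s n - x\<bar> / (A * B)) powr (- \<alpha>) / B\<^sup>2"
    using x by (simp add: main_term_def tau_dist A_def B_def)
  also have "(\<bar>s n - x\<bar> / (A * B)) powr (- \<alpha>) = (A * B) powr \<alpha> * \<delta>"
    using AB by (simp add: powr_divide powr_minus_divide \<delta>_def)
  finally have eq: "main_term \<alpha> n x = (A * B) powr \<alpha> / B\<^sup>2 * \<delta>" by simp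
  have E: "(E\<^sup>2) powr (\<alpha> - 1) = (E\<^sup>2) powr \<alpha> / E\<^sup>2"
    using AB by (simp add: powr_diff)
  have B2: "E\<^sup>2 \<le> 16 * B\<^sup>2" "B\<^sup>2 \<le> E\<^sup>2"
  proof -
    have "E\<^sup>2 \<le> (4 * B)\<^sup>2" using AB by (intro power_mono) auto
    then show "E\<^sup>2 \<le> 16 * B\<^sup>2" by (simp add: power_mult_distrib)
    show "B\<^sup>2 \<le> E\<^sup>2" using AB by (intro power_mono) auto
  qed
  have AB_le: "A * B \<le> E\<^sup>2" using AB by (simp add: power2_eq_square mult_mono)
  have AB_ge: "E\<^sup>2 \<le> 16 * (A * B)"
  proof -
    have "E * E \<le> (4 * A) * (4 * B)" using AB by (intro mult_mono) auto
    then show ?thesis by (simp add: power2_eq_square)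
  qed
  have "(A * B) powr \<alpha> / B\<^sup>2 \<le> (E\<^sup>2) powr \<alpha> / (E\<^sup>2 / 16)"
    using AB AB_le B2 \<alpha> by (intro frac_le powr_mono2) auto
  then have "(A * B) powr \<alpha> / B\<^sup>2 * \<delta> \<le> 16 * ((E\<^sup>2) powr (\<alpha> - 1)) * \<delta>"
    unfolding E using \<delta> by (intro mult_right_mono) (auto simp: mult.commute)
  then show "main_term \<alpha> n x \<le> 16 * ((esize d n)\<^sup>2 powr (\<alpha> - 1) * \<bar>s n - x\<bar> powr (- \<alpha>))"
    unfolding eq by (simp add: E_def \<delta>_def)
  have "(E\<^sup>2) powr \<alpha> \<le> (16 * (A * B)) powr \<alpha>"
    using AB AB_ge \<alpha> by (intro powr_mono2) auto
  also have "\<dots> = 16 powr \<alpha> * (A * B) powr \<alpha>" using AB by (simp add: powr_mult)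
  also have "\<dots> \<le> 16 powr 1 * (A * B) powr \<alpha>"
    using \<alpha> by (intro mult_right_mono powr_mono) auto
  finally have "(E\<^sup>2) powr \<alpha> / E\<^sup>2 \<le> 16 * (A * B) powr \<alpha> / B\<^sup>2"
    using AB B2 by (intro frac_le) auto
  then have "(E\<^sup>2) powr (\<alpha> - 1) * \<delta> \<le> 16 * (A * B) powr \<alpha> / B\<^sup>2 * \<delta>"
    unfolding E using \<delta> by (intro mult_right_mono) auto
  then show "(esize d n)\<^sup>2 powr (\<alpha> - 1) * \<bar>s n - x\<bar> powr (- \<alpha>) \<le> 16 * main_term \<alpha> n x"
    unfolding eq by (simp add: E_def \<delta>_def)
qed

text \<open>The part of \<open>P (main_term n)\<close> coming from the half of the cylinder that does not contain \<open>\<tau>\<close>.\<close>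
definition side_term :: "real \<Rightarrow> nat \<Rightarrow> real \<Rightarrow> real" where
  "side_term \<alpha> n x = main_term \<alpha> n (branch (\<not> d n) x) / (1 + x)\<^sup>2"

lemma other_branch_ne:
  assumes "x \<in> {0..1}"
  shows "cyl d n (branch (\<not> d n) x) \<noteq> \<tau>"
proof -
  have "0 < \<bar>s n - branch (\<not> d n) x\<bar>" using s_other_branch[OF assms, of n] by linarith
  then have "0 < \<bar>\<tau> - cyl d n (branch (\<not> d n) x)\<bar>"
    using branch_mem[OF assms, of "\<not> d n"] s_mem[of n]
    by (subst tau_dist) (auto intro!: divide_pos_pos mult_pos_pos den_pos)
  then show ?thesis by auto
qed

lemma side_term_continuous: "continuous_on {0..1} (side_term \<alpha> n)"
proof -
  let ?b = "\<not> d n"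
  have sub: "branch ?b ` {0..1} \<subseteq> {0..1}" using branch_mem by blast
  have 1: "continuous_on {0..1} (\<lambda>x. cyl d n (branch ?b x))"
    by (rule continuous_on_compose2[OF cyl_continuous branch_continuous sub])
  have 2: "continuous_on {0..1} (\<lambda>x. den d n (branch ?b x))"
    by (rule continuous_on_compose2[OF den_continuous branch_continuous sub])
  have 3: "continuous_on {0..1} (\<lambda>x. \<bar>\<tau> - cyl d n (branch ?b x)\<bar>)"
    by (intro continuous_on_rabs continuous_on_diff continuous_on_const 1)
  have 4: "continuous_on {0..1} (\<lambda>x. \<bar>\<tau> - cyl d n (branch ?b x)\<bar> powr (- \<alpha>))"
  proof (rule continuous_on_powr[OF 3 continuous_on_const], rule ballI)
    fix x :: real assume "x \<in> {0..1}"
    from other_branch_ne[OF this, of n] show "\<bar>\<tau> - cyl d n (branch ?b x)\<bar> \<noteq> 0" by auto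
  qed
  have 5: "continuous_on {0..1} (\<lambda>x. main_term \<alpha> n (branch ?b x))"
    unfolding main_term_def
  proof (rule continuous_on_divide[OF 4 continuous_on_power[OF 2]], rule ballI)
    fix x :: real assume "x \<in> {0..1}"
    then have "0 < den d n (branch ?b x)" by (intro den_pos branch_nonneg) simp
    then show "(den d n (branch ?b x))\<^sup>2 \<noteq> 0" by simp
  qed
  have "continuous_on {0..1} (\<lambda>x. main_term \<alpha> n (branch ?b x) / (1 + x)\<^sup>2)"
    by (rule continuous_on_divide[OF 5]) (auto intro!: continuous_intros)
  then show ?thesis by (simp add: side_term_def[abs_def])
qed

lemma side_term_nonneg: "0 \<le> side_term \<alpha> n x"
  by (simp add: side_term_def main_term_nonneg)

text \<open>224 = 16 * 14, where 14 bounds the singular factor at distance at least 1/14. The ratio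
  \<phi>^(\<alpha>-1) < 1 makes the side terms summable uniformly in x.\<close>

lemma side_term_le:
  assumes \<alpha>: "0 < \<alpha>" "\<alpha> < 1" and x: "x \<in> {0..1}"
  shows "side_term \<alpha> n x \<le> 224 * (\<phi> powr (\<alpha> - 1)) ^ n"
proof -
  let ?y = "branch (\<not> d n) x"
  have y: "?y \<in> {0..1}" by (rule branch_mem[OF x])
  have dist: "1/14 \<le> \<bar>s n - ?y\<bar>" by (rule s_other_branch[OF x])
  have "side_term \<alpha> n x \<le> main_term \<alpha> n ?y"
  proof -
    have "1 \<le> (1 + x)\<^sup>2" using x by (simp add: one_le_power)
    then have "main_term \<alpha> n ?y / (1 + x)\<^sup>2 \<le> main_term \<alpha> n ?y / 1"
      by (intro frac_le main_term_nonneg) auto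
    then show ?thesis by (simp add: side_term_def)
  qed
  also have "\<dots> \<le> 16 * ((esize d n)\<^sup>2 powr (\<alpha> - 1) * \<bar>s n - ?y\<bar> powr (- \<alpha>))"
    using dist by (intro main_term_bounds \<alpha> y) auto
  also have "\<dots> \<le> 16 * ((\<phi> ^ n) powr (\<alpha> - 1) * 14)"
  proof (intro mult_mono)
    show "(esize d n)\<^sup>2 powr (\<alpha> - 1) \<le> (\<phi> ^ n) powr (\<alpha> - 1)"
      using \<alpha> phi_bounds esize_square_lower[OF no00] by (intro powr_mono2') auto
    have "\<bar>s n - ?y\<bar> powr (- \<alpha>) \<le> (1/14) powr (- \<alpha>)"
      using \<alpha> dist by (intro powr_mono2') auto
    also have "\<dots> = 14 powr \<alpha>" by (simp add: powr_minus_divide powr_divide)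
    also have "\<dots> \<le> 14 powr 1" using \<alpha> by (intro powr_mono) auto
    finally show "\<bar>s n - ?y\<bar> powr (- \<alpha>) \<le> 14" by simp
  qed auto
  also have "(\<phi> ^ n) powr (\<alpha> - 1) = (\<phi> powr (\<alpha> - 1)) ^ n"
    using phi_bounds by (simp add: powr_power powr_realpow[symmetric] powr_powr mult.commute)
  finally show ?thesis by simp
qed

section \<open>A primitive of the singularity and the total mass of the side terms\<close>

definition v_anti :: "real \<Rightarrow> real \<Rightarrow> real" where
  "v_anti \<alpha> y = sgn (y - \<tau>) * \<bar>y - \<tau>\<bar> powr (1 - \<alpha>) / (1 - \<alpha>)"

lemma v_anti_deriv:
  assumes "\<alpha> < 1" "y \<noteq> \<tau>"
  shows "(v_anti \<alpha> has_real_derivative \<bar>\<tau> - y\<bar> powr (- \<alpha>)) (at y)"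
proof (cases "y < \<tau>")
  case True
  have "((\<lambda>y. \<tau> - y) has_real_derivative - 1) (at y)"
    by (auto intro!: derivative_eq_intros)
  from DERIV_cmult[OF DERIV_chain2[OF has_real_derivative_powr this], of "- 1 / (1 - \<alpha>)" "1 - \<alpha>"]
  have "((\<lambda>y. - 1 / (1 - \<alpha>) * (\<tau> - y) powr (1 - \<alpha>)) has_real_derivative (\<tau> - y) powr (- \<alpha>)) (at y)"
    using True assms by simp
  moreover have "eventually (\<lambda>y. y < \<tau>) (nhds y)"
    using True by (rule eventually_nhds_in_open[of "{..<\<tau>}", simplified])
  then have "eventually (\<lambda>y. v_anti \<alpha> y = - 1 / (1 - \<alpha>) * (\<tau> - y) powr (1 - \<alpha>)) (nhds y)"
    by eventually_elim (simp add: v_anti_def)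
  ultimately show ?thesis using True by (simp add: DERIV_cong_ev)
next
  case False
  then have gt: "\<tau> < y" using assms by simp
  have "((\<lambda>y. y - \<tau>) has_real_derivative 1) (at y)"
    by (auto intro!: derivative_eq_intros)
  from DERIV_cmult[OF DERIV_chain2[OF has_real_derivative_powr this], of "1 / (1 - \<alpha>)" "1 - \<alpha>"]
  have "((\<lambda>y. 1 / (1 - \<alpha>) * (y - \<tau>) powr (1 - \<alpha>)) has_real_derivative (y - \<tau>) powr (- \<alpha>)) (at y)"
    using gt assms by simp
  moreover have "eventually (\<lambda>y. \<tau> < y) (nhds y)"
    using gt by (rule eventually_nhds_in_open[of "{\<tau><..}", simplified])
  then have "eventually (\<lambda>y. v_anti \<alpha> y = 1 / (1 - \<alpha>) * (y - \<tau>) powr (1 - \<alpha>)) (nhds y)"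
    by eventually_elim (simp add: v_anti_def)
  ultimately show ?thesis using gt by (simp add: DERIV_cong_ev)
qed

text \<open>At \<tau> continuity comes from the positive exponent 1 - \<alpha>; it lets increments
  of the primitive be taken across the singularity.\<close>

lemma v_anti_isCont:
  assumes "\<alpha> < 1"
  shows "isCont (v_anti \<alpha>) y"
proof (cases "y = \<tau>")
  case True
  have "((\<lambda>y. \<bar>y - \<tau>\<bar> powr (1 - \<alpha>) / (1 - \<alpha>)) \<longlongrightarrow> 0) (at \<tau>)"
  proof -
    have "((\<lambda>y. \<bar>y - \<tau>\<bar> powr (1 - \<alpha>) / (1 - \<alpha>)) \<longlongrightarrow> \<bar>\<tau> - \<tau>\<bar> powr (1 - \<alpha>) / (1 - \<alpha>)) (at \<tau>)"
      using assms by (intro tendsto_intros tendsto_powr') auto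
    then show ?thesis by simp
  qed
  then have "(v_anti \<alpha> \<longlongrightarrow> 0) (at \<tau>)"
    by (rule Lim_null_comparison[rotated])
      (use assms in \<open>auto simp: v_anti_def abs_mult abs_sgn_eq\<close>)
  then show ?thesis using True by (simp add: isCont_def v_anti_def)
next
  case False
  then show ?thesis using v_anti_deriv[OF assms] DERIV_isCont by blast
qed

text \<open>The two signs undo the orientations of \<open>cyl d n\<close> and of the other branch,
  so that the derivative is the nonnegative side term.\<close>

definition side_anti :: "real \<Rightarrow> nat \<Rightarrow> real \<Rightarrow> real" where
  "side_anti \<alpha> n x = csgn d n * bsgn (\<not> d n) * v_anti \<alpha> (cyl d n (branch (\<not> d n) x))"

lemma side_term_antideriv:
  assumes "\<alpha> < 1"
  shows "antideriv (side_anti \<alpha> n) (side_term \<alpha> n)"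
  unfolding antideriv_def
proof
  fix x :: real assume x: "x \<in> {0..1}"
  let ?b = "\<not> d n" and ?y = "branch (\<not> d n) x"
  have "0 \<le> x" "0 \<le> ?y" using x branch_nonneg by auto
  have "((\<lambda>x. cyl d n (branch ?b x)) has_real_derivative csgn d n / (den d n ?y)\<^sup>2 * (bsgn ?b / (1 + x)\<^sup>2)) (at x)"
    by (rule DERIV_chain2[OF cyl_deriv branch_deriv]) fact+
  from DERIV_chain2[OF v_anti_deriv[OF assms other_branch_ne[OF x]] this]
  have "((\<lambda>x. csgn d n * bsgn ?b * v_anti \<alpha> (cyl d n (branch ?b x))) has_real_derivative csgn d n * bsgn ?b *
      (\<bar>\<tau> - cyl d n ?y\<bar> powr (- \<alpha>) * (csgn d n / (den d n ?y)\<^sup>2 * (bsgn ?b / (1 + x)\<^sup>2)))) (at x)"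
    by (rule DERIV_cmult)
  moreover have "csgn d n * bsgn ?b *
      (\<bar>\<tau> - cyl d n ?y\<bar> powr (- \<alpha>) * (csgn d n / (den d n ?y)\<^sup>2 * (bsgn ?b / (1 + x)\<^sup>2)))
      = (csgn d n * csgn d n) * (bsgn ?b * bsgn ?b) * side_term \<alpha> n x"
    unfolding side_term_def main_term_def by simp
  ultimately have "(side_anti \<alpha> n has_real_derivative side_term \<alpha> n x) (at x)"
    unfolding side_anti_def[abs_def] csgn_square bsgn_square by simp
  then show "(side_anti \<alpha> n has_real_derivative side_term \<alpha> n x) (at x within {0..1})"
    by (rule has_field_derivative_at_within)
qed

text \<open>Each side piece is a cylinder minus the next one, so its mass is a difference of
  consecutive cylinder masses.\<close>

lemma side_anti_telescope:
  "(\<Sum>m<n. side_anti \<alpha> m 1 - side_anti \<alpha> m 0)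
     = (v_anti \<alpha> 1 - v_anti \<alpha> 0) - csgn d n * (v_anti \<alpha> (cyl d n 1) - v_anti \<alpha> (cyl d n 0))"
proof (induction n)
  case (Suc n)
  have branch: "branch True 0 = 1" "branch True 1 = 1/2" "branch False 0 = 0" "branch False 1 = 1/2"
    by (auto simp: branch_def)
  show ?case
    using Suc by (cases "d n") (auto simp: side_anti_def branch bsgn_def algebra_simps)
qed simp

text \<open>The cylinders shrink to \<tau>, where the primitive is continuous; hence no mass is lost
  to the singularity.\<close>

lemma side_anti_sums:
  assumes "\<alpha> < 1"
  shows "(\<lambda>m. side_anti \<alpha> m 1 - side_anti \<alpha> m 0) sums (v_anti \<alpha> 1 - v_anti \<alpha> 0)"
  unfolding sums_def side_anti_telescope
proof -
  have lim: "(\<lambda>n. cyl d n x) \<longlonglongrightarrow> \<tau>" if "x \<in> {0..1}" for x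
  proof -
    have "(\<lambda>n. \<bar>\<tau> - cyl d n x\<bar>) \<longlonglongrightarrow> 0"
    proof (rule tendsto_sandwich[where f = "\<lambda>_. 0"])
      show "\<forall>\<^sub>F n in sequentially. \<bar>\<tau> - cyl d n x\<bar> \<le> 16 * (1/\<phi>) ^ n"
      proof (rule always_eventually, rule allI)
        fix n
        let ?A = "den d n (s n)" and ?B = "den d n x" and ?E = "esize d n"
        have AB: "0 < ?A" "0 < ?B" "?E \<le> 4 * ?A" "?E \<le> 4 * ?B" "1 \<le> ?E"
          using s_mem[of n] that by (auto intro!: den_pos esize_le_den[OF no00] esize_ge_1)
        have "?E * ?E \<le> (4 * ?A) * (4 * ?B)" using AB by (intro mult_mono) auto
        then have "\<phi> ^ n \<le> 16 * (?A * ?B)"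
          using esize_square_lower[OF no00, of n] by (simp add: power2_eq_square)
        then have "\<phi> ^ n / 16 \<le> ?A * ?B" by simp
        moreover have "\<bar>s n - x\<bar> \<le> 1" using s_mem[of n] that by auto
        ultimately have "\<bar>s n - x\<bar> / (?A * ?B) \<le> 1 / (\<phi> ^ n / 16)"
          using phi_bounds AB by (intro frac_le) auto
        then show "\<bar>\<tau> - cyl d n x\<bar> \<le> 16 * (1/\<phi>) ^ n"
          using that by (simp add: tau_dist power_divide)
      qed
      have "(\<lambda>n. 16 * (1/\<phi>) ^ n) \<longlonglongrightarrow> 16 * 0"
        using phi_bounds by (intro tendsto_mult tendsto_const LIMSEQ_power_zero) auto
      then show "(\<lambda>n. 16 * (1/\<phi>) ^ n) \<longlonglongrightarrow> 0" by simp
    qed auto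
    then have "(\<lambda>n. \<tau> - cyl d n x) \<longlonglongrightarrow> 0" by (rule tendsto_rabs_zero_cancel)
    from tendsto_diff[OF tendsto_const[of \<tau>] this] show ?thesis by simp
  qed
  have "(\<lambda>n. v_anti \<alpha> (cyl d n 1) - v_anti \<alpha> (cyl d n 0)) \<longlonglongrightarrow> v_anti \<alpha> \<tau> - v_anti \<alpha> \<tau>"
    by (intro tendsto_diff isCont_tendsto_compose[OF v_anti_isCont[OF assms]] lim) auto
  then have "(\<lambda>n. v_anti \<alpha> (cyl d n 1) - v_anti \<alpha> (cyl d n 0)) \<longlonglongrightarrow> 0" by simp
  then have "(\<lambda>n. csgn d n * (v_anti \<alpha> (cyl d n 1) - v_anti \<alpha> (cyl d n 0))) \<longlonglongrightarrow> 0"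
  proof (rule Lim_null_comparison[rotated, OF tendsto_norm_zero])
    have "\<bar>csgn d n\<bar> = 1" for n
      using csgn_square[of d n] by (auto simp: square_eq_1_iff)
    then show "\<forall>\<^sub>F n in sequentially. norm (csgn d n * (v_anti \<alpha> (cyl d n 1) - v_anti \<alpha> (cyl d n 0)))
        \<le> norm (v_anti \<alpha> (cyl d n 1) - v_anti \<alpha> (cyl d n 0))"
      by (simp add: abs_mult)
  qed
  from tendsto_diff[OF tendsto_const this]
  show "(\<lambda>n. v_anti \<alpha> 1 - v_anti \<alpha> 0 - csgn d n * (v_anti \<alpha> (cyl d n 1) - v_anti \<alpha> (cyl d n 0))) \<longlonglongrightarrow> v_anti \<alpha> 1 - v_anti \<alpha> 0"
    by simp
qed

text \<open>The fundamental theorem is applied on either side of \<tau>; nonnegativity then passes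
  from the gauge integral to the Lebesgue integral.\<close>

lemma v_int_eq:
  assumes \<alpha>: "\<alpha> < 1"
  shows "v_int \<tau> \<alpha> = v_anti \<alpha> 1 - v_anti \<alpha> 0"
proof -
  let ?f = "\<lambda>x. \<bar>\<tau> - x\<bar> powr (- \<alpha>)"
  have \<tau>: "\<tau> \<in> {0..1}" using s_mem[of 0] by (simp add: s_def)
  have part: "(?f has_integral (v_anti \<alpha> b - v_anti \<alpha> a)) {a..b}"
    if "a \<le> b" "\<tau> \<notin> {a<..<b}" for a b
  proof (rule fundamental_theorem_of_calculus_interior[OF that(1)])
    show "continuous_on {a..b} (v_anti \<alpha>)"
      by (intro continuous_at_imp_continuous_on ballI v_anti_isCont \<alpha>)
    show "(v_anti \<alpha> has_vector_derivative ?f x) (at x)" if "x \<in> {a<..<b}" for x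
      using v_anti_deriv[OF \<alpha>, of x] \<open>\<tau> \<notin> {a<..<b}\<close> that
      by (auto simp: has_real_derivative_iff_has_vector_derivative)
  qed
  have "(?f has_integral (v_anti \<alpha> \<tau> - v_anti \<alpha> 0) + (v_anti \<alpha> 1 - v_anti \<alpha> \<tau>)) {0..1}"
    by (rule has_integral_combine[of 0 \<tau> 1]) (use \<tau> in \<open>auto intro!: part\<close>)
  then have int: "(?f has_integral (v_anti \<alpha> 1 - v_anti \<alpha> 0)) {0..1}" by simp
  have "?f absolutely_integrable_on {0..1}"
    using int by (intro nonnegative_absolutely_integrable_1) auto
  moreover have meas: "?f \<in> borel_measurable borel" by measurable
  ultimately have "set_integrable lborel {0..1} ?f"
    unfolding set_integrable_def by (subst (asm) integrable_completion) auto
  then have "(LINT x:{0..1}|lborel. ?f x) = integral {0..1} ?f"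
    by (rule set_borel_integral_eq_integral)
  also have "\<dots> = v_anti \<alpha> 1 - v_anti \<alpha> 0" using int by (rule integral_unique)
  finally show ?thesis by (simp add: v_int_def)
qed

section \<open>Limit of the regular part\<close>

definition side_sum :: "real \<Rightarrow> nat \<Rightarrow> real \<Rightarrow> real" where
  "side_sum \<alpha> n x = (\<Sum>m<n. (transfer ^^ (n - 1 - m)) (side_term \<alpha> m) x)"

lemma side_sum_Suc: "side_sum \<alpha> (Suc n) x = transfer (side_sum \<alpha> n) x + side_term \<alpha> n x"
proof -
  have "(\<Sum>m<n. (transfer ^^ (n - m)) (side_term \<alpha> m) x) = transfer (side_sum \<alpha> n) x"
  proof -
    have "(\<Sum>m<n. (transfer ^^ (n - m)) (side_term \<alpha> m) x) = (\<Sum>m<n. (transfer ^^ Suc (n - 1 - m)) (side_term \<alpha> m) x)"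
      by (intro sum.cong refl) (metis Suc_diff_Suc diff_Suc_eq_diff_pred lessThan_iff)
    also have "\<dots> = transfer (side_sum \<alpha> n) x"
      unfolding transfer_funpow_Suc transfer_def[of "side_sum \<alpha> n"] side_sum_def
      by (simp add: sum.distrib sum_divide_distrib add_divide_distrib)
    finally show ?thesis .
  qed
  then show ?thesis by (simp add: side_sum_def)
qed

text \<open>Tannery's theorem: for fixed m the limit is the m-th side mass divided by x, a linear
  factor times r^m dominates, and the side masses add up to the integral of v.\<close>

lemma side_sum_limit:
  assumes \<alpha>: "0 < \<alpha>" "\<alpha> < 1" and x: "x \<in> {1/3..1}"
  shows "(\<lambda>n. ln (real n) * side_sum \<alpha> n x) \<longlonglongrightarrow> v_int \<tau> \<alpha> * h1 x"
proof -
  define r where "r = \<phi> powr (\<alpha> - 1)"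
  have r: "0 < r" "r < 1"
    using phi_bounds \<alpha> powr_less_mono[of "\<alpha> - 1" 0 \<phi>] by (auto simp: r_def)
  have x01: "x \<in> {0..1}" using x by auto
  obtain C where C: "C > 0" "\<And>n. ln (real n + 2) * (transfer ^^ n) (\<lambda>_. 1) x \<le> C"
    using one_bound[OF x] by blast
  define I where "I m = (side_anti \<alpha> m 1 - side_anti \<alpha> m 0) / x" for m
  define a where "a m n = (if m < n then ln (real n) * (transfer ^^ (n - 1 - m)) (side_term \<alpha> m) x else 0)" for m n :: nat
  define M where "M m = 224 * r ^ m * (C * (1 + 2 * (real m + 2)))" for m :: nat
  have "(\<lambda>n. suminf (\<lambda>m. a m n)) \<longlonglongrightarrow> suminf I"
  proof (intro conjunct2[OF conjunct2[OF tannerys_theorem]])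
    fix m
    have *: "(\<lambda>n. ln (real n) * (transfer ^^ n) (side_term \<alpha> m) x) \<longlonglongrightarrow> I m"
      unfolding I_def by (intro continuous_asymptotics side_term_continuous side_term_antideriv \<alpha> x)
    \<comment> \<open>The m-th side term has been iterated only n - 1 - m times; the delay m + 1
      does not change the logarithm in the limit.\<close>
    have "(\<lambda>n. ln (real (n + Suc m)) / ln (real n)) \<longlonglongrightarrow> 1" by real_asymp
    from tendsto_mult[OF this *]
    have "(\<lambda>n. ln (real (n + Suc m)) / ln (real n) * (ln (real n) * (transfer ^^ n) (side_term \<alpha> m) x)) \<longlonglongrightarrow> I m" by simp
    moreover have "\<forall>\<^sub>F n in sequentially. ln (real (n + Suc m)) / ln (real n) * (ln (real n) * (transfer ^^ n) (side_term \<alpha> m) x)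
        = a m (n + Suc m)"
      using eventually_ge_at_top[of 2] by eventually_elim (simp add: a_def)
    ultimately have "(\<lambda>n. a m (n + Suc m)) \<longlonglongrightarrow> I m" by (rule Lim_transform_eventually)
    then show "a m \<longlonglongrightarrow> I m" by (rule LIMSEQ_offset)
  next
    have "norm (a m n) \<le> M m" for m n
    proof (cases "m < n")
      case True
      define k where "k = n - 1 - m"
      have n: "n = k + 1 + m" using True by (simp add: k_def)
      let ?p = "(transfer ^^ k) (\<lambda>_. 1) x"
      have p0: "0 \<le> ?p" by (rule transfer_funpow_nonneg[OF _ x01]) simp
      have ln2: "1/2 \<le> ln (real k + 2)"
      proof -
        have "1/2 \<le> ln (2::real)" using ln2_ge_two_thirds by simp
        also have "ln 2 \<le> ln (real k + 2)" by simp
        finally show ?thesis .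
      qed
      have pC: "?p \<le> 2 * C"
      proof -
        have "1/2 * ?p \<le> ln (real k + 2) * ?p" using ln2 p0 by (intro mult_right_mono)
        then show ?thesis using C(2)[of k] by linarith
      qed
      \<comment> \<open>Since n <= (k+2)(m+2), the logarithm splits into a part absorbed by the
        decay of P^k 1 and a part at most linear in m, absorbed by r^m.\<close>
      have "ln (real n) \<le> ln ((real k + 2) * (real m + 2))"
        by (subst ln_le_cancel_iff) (auto simp: n algebra_simps add_pos_nonneg)
      also have "\<dots> = ln (real k + 2) + ln (real m + 2)" by (simp add: ln_mult)
      also have "\<dots> \<le> ln (real k + 2) + (real m + 2)" using ln_le_minus_one[of "real m + 2"] by simp
      finally have "ln (real n) * ?p \<le> (ln (real k + 2) + (real m + 2)) * ?p"
        using p0 by (rule mult_right_mono)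
      also have "\<dots> = ln (real k + 2) * ?p + (real m + 2) * ?p" by (simp add: distrib_right)
      also have "\<dots> \<le> C + (real m + 2) * (2 * C)" using C(2)[of k] pC by (intro add_mono mult_left_mono) auto
      finally have lp: "ln (real n) * ?p \<le> C * (1 + 2 * (real m + 2))" by (simp add: algebra_simps)
      have "\<bar>(transfer ^^ k) (side_term \<alpha> m) x\<bar> \<le> 224 * r ^ m * ?p"
        using side_term_le[OF \<alpha>, of _ m] side_term_nonneg[of \<alpha> m] by (intro transfer_funpow_abs_le x01) (auto simp: r_def)
      then have "ln (real n) * \<bar>(transfer ^^ k) (side_term \<alpha> m) x\<bar> \<le> ln (real n) * (224 * r ^ m * ?p)"
        using True by (intro mult_left_mono) auto
      also have "\<dots> = 224 * r ^ m * (ln (real n) * ?p)" by simp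
      also have "\<dots> \<le> M m" unfolding M_def using r lp by (intro mult_left_mono) auto
      finally show ?thesis using True by (simp add: a_def k_def abs_mult)
    next
      case False
      then show ?thesis using C r by (simp add: a_def M_def)
    qed
    then show "\<forall>\<^sub>F (m, n) in at_top \<times>\<^sub>F sequentially. norm (a m n) \<le> M m"
      by (intro always_eventually) auto
    have "summable (\<lambda>m. (224 * C * 5) * r ^ m + (224 * C * 2) * (real m * r ^ m))"
    proof (intro summable_add summable_mult)
      show "summable (\<lambda>m. r ^ m)" using r by (simp add: summable_geometric)
      show "summable (\<lambda>m. real m * r ^ m)"
      proof -
        have "summable (\<lambda>m. real (Suc m) * r ^ m)"
          using geometric_deriv_sums[of r] r by (auto intro: sums_summable)
        from summable_diff[OF this summable_geometric[of r]] show ?thesis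
          using r by (simp add: algebra_simps)
      qed
    qed
    moreover have "M = (\<lambda>m. (224 * C * 5) * r ^ m + (224 * C * 2) * (real m * r ^ m))"
      by (rule ext) (simp add: M_def algebra_simps)
    ultimately show "summable M" by simp
  qed auto
  moreover have "suminf (\<lambda>m. a m n) = ln (real n) * side_sum \<alpha> n x" for n
  proof -
    have "suminf (\<lambda>m. a m n) = (\<Sum>m<n. a m n)"
      by (rule suminf_finite) (auto simp: a_def)
    then show ?thesis by (simp add: a_def side_sum_def sum_distrib_left)
  qed
  moreover have "suminf I = v_int \<tau> \<alpha> * h1 x"
    using sums_divide[OF side_anti_sums[OF \<alpha>(2)], of x] v_int_eq[OF \<alpha>(2)]
    by (simp add: I_def[abs_def] h1_def sums_iff)
  ultimately show ?thesis by simp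
qed

text \<open>At each step the branch following the code of \<tau> passes on the main term, and the
  other branch creates the next side term. Only the former can reach the infinite value.\<close>

lemma P1_funpow_v:
  assumes "x \<in> {0..1}"
  shows "(P1 ^^ n) (v \<tau> \<alpha>) x
     = (if x = s n then \<infinity> else ereal (main_term \<alpha> n x)) + ereal (side_sum \<alpha> n x)"
  using assms
proof (induction n arbitrary: x)
  case 0
  then show ?case by (simp add: v_def main_term_def side_sum_def s_def)
next
  case (Suc n)
  let ?c = "1 / (1 + x)\<^sup>2" and ?y = "branch (d n) x" and ?z = "branch (\<not> d n) x"
  have c: "0 < ?c" using Suc.prems by auto
  have y: "?y \<in> {0..1}" and z: "?z \<in> {0..1}" by (rule branch_mem[OF Suc.prems])+
  have "P1 f x = ereal ?c * f ?y + ereal ?c * f ?z" for f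
    unfolding P1_def branch_def by (cases "d n") (simp_all only: if_True if_False add.commute not_True_eq_False not_False_eq_True)
  then have step: "(P1 ^^ Suc n) (v \<tau> \<alpha>) x
      = ereal ?c * (P1 ^^ n) (v \<tau> \<alpha>) ?y + ereal ?c * (P1 ^^ n) (v \<tau> \<alpha>) ?z"
    by simp
  have "?z \<noteq> s n" using s_other_branch[OF Suc.prems, of n] by auto
  then have Z: "(P1 ^^ n) (v \<tau> \<alpha>) ?z = ereal (main_term \<alpha> n ?z + side_sum \<alpha> n ?z)"
    using Suc.IH[OF z] by simp
  have PR: "transfer (side_sum \<alpha> n) x = ?c * side_sum \<alpha> n ?y + ?c * side_sum \<alpha> n ?z"
    unfolding transfer_def branch_def by (cases "d n") (simp_all add: add_divide_distrib)
  have yx: "?y = s n \<longleftrightarrow> x = s (Suc n)"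
  proof
    assume "?y = s n"
    then have "farey ?y = farey (s n)" by (rule arg_cong)
    then show "x = s (Suc n)" unfolding farey_br[OF Suc.prems] farey_s .
  next
    assume "x = s (Suc n)"
    then show "?y = s n" unfolding s_br[of n] by (rule arg_cong)
  qed
  show ?case
  proof (cases "x = s (Suc n)")
    case True
    then have "(P1 ^^ n) (v \<tau> \<alpha>) ?y = \<infinity>" using Suc.IH[OF y] yx by simp
    moreover have "ereal ?c * \<infinity> = \<infinity>" using c by simp
    ultimately show ?thesis unfolding step Z using True by (simp del: times_ereal.simps)
  next
    case False
    then have Y: "(P1 ^^ n) (v \<tau> \<alpha>) ?y = ereal (main_term \<alpha> n ?y + side_sum \<alpha> n ?y)"
      using Suc.IH[OF y] yx by simp
    have 1: "main_term \<alpha> (Suc n) x = ?c * main_term \<alpha> n ?y" by (simp add: main_term_def power_mult_distrib)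
    have 2: "side_term \<alpha> n x = ?c * main_term \<alpha> n ?z" by (simp add: side_term_def)
    have "?c * (main_term \<alpha> n ?y + side_sum \<alpha> n ?y) + ?c * (main_term \<alpha> n ?z + side_sum \<alpha> n ?z)
        = main_term \<alpha> (Suc n) x + side_sum \<alpha> (Suc n) x"
      unfolding side_sum_Suc PR 1 2 by (simp only: distrib_left)
    then show ?thesis
      unfolding step Y Z times_ereal.simps plus_ereal.simps using False by (simp only: if_False plus_ereal.simps)
  qed
qed

end

section \<open>Continued fractions and limit points of sparse codes\<close>

text \<open>Nested nonempty compact cylinders have a common point.\<close>

lemma farey_point_exists:
  assumes "no00 d"
  obtains \<tau> where "farey_point d \<tau>"
proof -
  let ?C = "\<lambda>n. cyl d n ` {0..1}"
  have "\<Inter> (range ?C) \<noteq> {}"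
  proof (rule compact_nest)
    show "compact (?C n)" for n by (rule compact_continuous_image[OF cyl_continuous]) simp
    show "?C n \<noteq> {}" for n by simp
    have "?C (Suc n) \<subseteq> ?C n" for n
    proof
      fix y assume "y \<in> ?C (Suc n)"
      then obtain x where "x \<in> {0..1}" "y = cyl d n (branch (d n) x)" by auto
      then show "y \<in> ?C n" using branch_mem by blast
    qed
    then show "m \<le> n \<Longrightarrow> ?C n \<subseteq> ?C m" for m n by (rule lift_Suc_antimono_le)
  qed
  then obtain \<tau> where "\<And>n. \<tau> \<in> ?C n" by blast
  then have "farey_point d \<tau>" using assms unfolding farey_point_def by blast
  then show ?thesis by (rule that)
qed

lemma cyl_shift: "cyl d (n + m) x = cyl d n (cyl (\<lambda>k. d (n + k)) m x)"
  by (induction m arbitrary: x) auto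

section \<open>Irrationality and continued fraction entries of coded points\<close>

context farey_point
begin

lemma tau_bounds: "1/3 \<le> \<tau>" "\<tau> \<le> 3/4"
  using s_ge_third[of 0] s_le_34[of 0] by (auto simp: s_def)

text \<open>The map shifts the code, so \<open>s n\<close> can be compared digit by digit with other
  coded points.\<close>

lemma shift_point: "farey_point (\<lambda>k. d (n + k)) (s n)"
proof
  show "no00 (\<lambda>k. d (n + k))" using no00 by (simp add: no00_def)
  fix m
  let ?y = "cyl (\<lambda>k. d (n + k)) m (s (n + m))"
  have "(farey ^^ n) (cyl d n ?y) = ?y" by (rule farey_cyl[OF cyl_mem[OF s_mem]])
  moreover have "cyl d n ?y = \<tau>" using s_cyl[of "n + m"] by (simp add: cyl_shift)
  ultimately show "\<exists>y\<in>{0..1}. s n = cyl (\<lambda>k. d (n + k)) m y"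
    using s_mem[of "n + m"] by (auto simp: s_def simp del: atLeastAtMost_iff)
qed

text \<open>Infinite descent: the Farey map sends a/b to a/(b-a) or (b-a)/a, with a smaller
  denominator, while the orbit stays in [1/3, 3/4] and never reaches 0 or 1.\<close>

lemma s_irrational: "s n \<notin> \<rat>"
proof
  have no: "s n \<noteq> real a / real b" for n a b
  proof (induction b arbitrary: n a rule: less_induct)
    case (less b)
    show ?case
    proof
      assume eq: "s n = real a / real b"
      have b: "b > 0" using eq s_ge_third[of n] by (cases "b = 0") auto
      have ab: "0 < a" "a < b"
      proof -
        show "0 < a" using eq s_ge_third[of n] by (cases "a = 0") auto
        have "real a / real b < 1" using eq s_le_34[of n] by linarith
        then show "a < b" using b by simp
      qed
      have branch: "real (b - a) = real b - real a" using ab by (simp add: of_nat_diff)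
      show False
      proof (cases "s n \<le> 1/2")
        case True
        have "s (Suc n) = (real a / real b) / (1 - real a / real b)"
          using farey_s[of n] True eq by (simp add: farey_def)
        also have "1 - real a / real b = (real b - real a) / real b"
          using b by (simp add: diff_divide_distrib)
        finally have "s (Suc n) = real a / real (b - a)" using b by (simp add: branch)
        then show False using less.IH[of "b - a" "Suc n" a] ab by simp
      next
        case False
        have "s (Suc n) = (1 - real a / real b) / (real a / real b)"
          using farey_s[of n] False eq by (simp add: farey_def)
        also have "1 - real a / real b = (real b - real a) / real b"
          using b by (simp add: diff_divide_distrib)
        finally have "s (Suc n) = real (b - a) / real a" using b by (simp add: branch)
        then show False using less.IH[of a "Suc n" "b - a"] ab by simp
      qed
    qed
  qed
  assume "s n \<in> \<rat>"
  then obtain a b :: nat where "\<bar>s n\<bar> = real a / real b" by (rule Rats_abs_nat_div_natE) blast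
  then show False using no[of n a b] s_nonneg[of n] by simp
qed

lemma tau_irrational: "\<tau> \<notin> \<rat>"
  using s_irrational[of 0] by (simp add: s_def)

lemma inverse_s_one: "d n \<Longrightarrow> 1 / s n = 1 + s (Suc n)"
  using s_nonneg[of "Suc n"] by (simp add: s_br_True branch_def)

lemma inverse_s_zero:
  assumes "\<not> d n"
  shows "1 / s n = 2 + s (n + 2)"
proof -
  have "d (Suc n)" using assms no00 by (simp add: no00_def)
  then have "1 / s (Suc n) = 1 + s (n + 2)" using inverse_s_one[of "Suc n"] by simp
  moreover have "1 / s n = 1 + 1 / s (Suc n)"
    using s_ge_third[of "Suc n"] by (simp add: s_br_False[OF assms] branch_def field_simps)
  ultimately show ?thesis by simp
qed

text \<open>Farey time of the k-th Gauss step: entry 1 consumes the digit 1, entry 2 the block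
  01.\<close>

primrec gauss_time :: "nat \<Rightarrow> nat" where
  "gauss_time 0 = 0"
| "gauss_time (Suc k) = gauss_time k + (if d (gauss_time k) then 1 else 2)"

lemma frac_add_nat: "0 \<le> x \<Longrightarrow> x < 1 \<Longrightarrow> frac (real k + x) = x"
  by (simp add: frac_unique_iff)

lemma gauss_s: "gauss (s n) = s (n + (if d n then 1 else 2))"
proof (cases "d n")
  case True
  then show ?thesis
    using frac_add_nat[of "s (Suc n)" 1] s_nonneg[of "Suc n"] s_le_34[of "Suc n"]
    by (simp add: gauss_def inverse_s_one)
next
  case False
  then show ?thesis
    using frac_add_nat[of "s (n + 2)" 2] s_nonneg[of "n + 2"] s_le_34[of "n + 2"]
    by (simp add: gauss_def inverse_s_zero)
qed

lemma gauss_funpow: "(gauss ^^ k) \<tau> = s (gauss_time k)"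
  by (induction k) (simp_all add: gauss_s s_def[of 0])

lemma cf_entry_eq: "cf_entry \<tau> k = (if d (gauss_time k) then 1 else 2)"
proof (cases "d (gauss_time k)")
  case True
  have "\<lfloor>1 + s (Suc (gauss_time k))\<rfloor> = 1"
    using s_nonneg[of "Suc (gauss_time k)"] s_le_34[of "Suc (gauss_time k)"] by (simp add: floor_eq_iff)
  then show ?thesis using True by (simp add: cf_entry_def gauss_funpow inverse_s_one)
next
  case False
  have "\<lfloor>2 + s (gauss_time k + 2)\<rfloor> = 2"
    using s_nonneg[of "gauss_time k + 2"] s_le_34[of "gauss_time k + 2"] by (simp add: floor_eq_iff)
  then show ?thesis using False by (simp add: cf_entry_def gauss_funpow inverse_s_zero)
qed

lemma bounded_cf_tau: "bounded_cf \<tau>"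
  unfolding bounded_cf_def by (rule exI[of _ 2]) (simp add: cf_entry_eq)

text \<open>A time skipped by the Gauss map is the second place of a block 01; as 00 is excluded,
  every zero therefore sits at a Gauss time.\<close>

lemma gauss_time_cover: "(\<exists>k. gauss_time k = n) \<or> (\<exists>k. Suc (gauss_time k) = n \<and> \<not> d (gauss_time k))"
proof (induction n)
  case 0
  then show ?case by (metis gauss_time.simps(1))
next
  case (Suc n)
  then show ?case
  proof (elim disjE exE conjE)
    fix k assume "gauss_time k = n"
    then show ?thesis by (cases "d n") (auto intro: exI[of _ "Suc k"])
  next
    fix k assume "Suc (gauss_time k) = n" "\<not> d (gauss_time k)"
    then have "gauss_time (Suc k) = Suc n" by simp
    then show ?thesis by blast
  qed
qed

lemma gauss_time_zero:
  assumes "\<not> d r"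
  obtains k where "gauss_time k = r"
  using gauss_time_cover[of r] assms no00 by (auto simp: no00_def)

lemma gauss_time_bounds: "gauss_time k + p \<le> gauss_time (k + p)" "gauss_time (k + p) \<le> gauss_time k + 2 * p"
  by (induction p) auto

end

text \<open>By \<open>gaps\<close> the distances between zeros tend to infinity, which leaves limit
  points at most one zero; by \<open>zeros_le\<close> the zeros are too rare to change the
  exponential rate of \<open>esize\<close>.\<close>

locale sparse_point = farey_point +
  assumes zeros_unbounded: "\<exists>r\<ge>n. \<not> d r"
    and gaps: "\<exists>N. \<forall>r\<ge>N. \<forall>r'>r. \<not> d r \<longrightarrow> \<not> d r' \<longrightarrow> r + G < r'"
    and zeros_le: "real (zeros d n) \<le> sqrt (real n) + 1"
begin

lemma not_eventually_periodic: "\<not> eventually_periodic_cf \<tau>"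
  unfolding eventually_periodic_cf_def
proof (safe)
  fix N p :: nat assume p: "0 < p" and per: "\<forall>n\<ge>N. cf_entry \<tau> (n + p) = cf_entry \<tau> n"
  \<comment> \<open>p entries span at most 2p digits, so a period p would repeat a zero within
    distance 2p.\<close>
  obtain M where M: "\<And>r r'. r \<ge> M \<Longrightarrow> r' > r \<Longrightarrow> \<not> d r \<Longrightarrow> \<not> d r' \<Longrightarrow> r + 2 * p < r'"
    using gaps[of "2 * p"] by blast
  \<comment> \<open>The bound 2N puts the Gauss index k of r beyond N, because
    \<open>gauss_time k\<close> is at most 2k.\<close>
  obtain r where r: "r \<ge> max M (2 * N)" "\<not> d r" using zeros_unbounded by blast
  obtain k where k: "gauss_time k = r" using gauss_time_zero[OF r(2)] by blast
  have "gauss_time k \<le> 2 * k" using gauss_time_bounds(2)[of 0 k] by simp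
  then have "N \<le> k" using k r by simp
  then have "cf_entry \<tau> (k + p) = 2" using per k r by (simp add: cf_entry_eq)
  then have "\<not> d (gauss_time (k + p))" by (simp add: cf_entry_eq split: if_splits)
  then have "r + 2 * p < gauss_time (k + p)"
    using M[of r "gauss_time (k + p)"] r gauss_time_bounds(1)[of k p] k p by simp
  then show False using gauss_time_bounds(2)[of k p] k by simp
qed

end

section \<open>Codes of the limit points\<close>

lemma isCont_farey:
  assumes "0 < y" "y < 1" "y \<noteq> 1/2"
  shows "isCont farey y"
proof (cases "y < 1/2")
  case True
  have "eventually (\<lambda>x. x < 1/2) (nhds y)"
    using True eventually_nhds_in_open[of "{..<1/2::real}" y] by simp
  then have "eventually (\<lambda>x. farey x = x / (1 - x)) (nhds y)"
    by eventually_elim (simp add: farey_def)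
  moreover have "isCont (\<lambda>x. x / (1 - x)) y" using assms by (intro continuous_intros) auto
  ultimately show ?thesis by (simp add: isCont_cong)
next
  case False
  then have gt: "1/2 < y" using assms by simp
  have "eventually (\<lambda>x. 1/2 < x) (nhds y)"
    using gt eventually_nhds_in_open[of "{1/2::real<..}" y] by simp
  then have "eventually (\<lambda>x. farey x = (1 - x) / x) (nhds y)"
    by eventually_elim (simp add: farey_def)
  moreover have "isCont (\<lambda>x. (1 - x) / x) y" using assms by (intro continuous_intros) auto
  ultimately show ?thesis by (simp add: isCont_cong)
qed

context farey_point
begin

lemma s_closed_mem: "s n \<in> {1/3..3/7} \<union> {4/7..3/4}"
  using s_digit_one[of n] s_digit_zero[of n] s_ge_third[of n] s_le_34[of n] by (cases "d n") auto

text \<open>The orbit stays in a closed set avoiding 0, 1/2 and 1, on which \<open>farey\<close> is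
  continuous; hence shifted orbits converge to the orbit of the limit point.\<close>

lemma Omega_sequence:
  assumes "x \<in> Omega1 \<tau>"
  obtains l where "\<And>k. l k \<ge> k" "\<And>m. (\<lambda>k. s (l k + m)) \<longlonglongrightarrow> (farey ^^ m) x"
    "\<And>m. (farey ^^ m) x \<in> {1/3..3/7} \<union> {4/7..3/4}"
proof -
  have "\<exists>l\<ge>k. dist (s l) x < 1 / real (Suc k)" for k
  proof -
    have "x \<in> closure {(farey ^^ l) \<tau> | l. l \<ge> k}" using assms by (auto simp: Omega1_def)
    then have "\<exists>y\<in>{(farey ^^ l) \<tau> | l. l \<ge> k}. dist y x < 1 / real (Suc k)"
      unfolding closure_approachable by (elim allE[of _ "1 / real (Suc k)"]) simp
    then show ?thesis by (auto simp: s_def)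
  qed
  then obtain l where l: "\<And>k. l k \<ge> k" "\<And>k. dist (s (l k)) x < 1 / real (Suc k)" by metis
  have cl: "closed ({1/3..3/7} \<union> {4/7..3/4} :: real set)" by (intro closed_Un closed_atLeastAtMost)
  have mem: "y \<in> {1/3..3/7} \<union> {4/7..3/4}" if "(\<lambda>k. s (l k + m)) \<longlonglongrightarrow> y" for m y
    by (rule Lim_in_closed_set[OF cl _ _ that]) (simp_all add: s_closed_mem del: Un_iff atLeastAtMost_iff)
  have lim: "(\<lambda>k. s (l k + m)) \<longlonglongrightarrow> (farey ^^ m) x" for m
  proof (induction m)
    case 0
    have "(\<lambda>k. dist (s (l k)) x) \<longlonglongrightarrow> 0"
    proof (rule tendsto_sandwich[where f = "\<lambda>_. 0"])
      show "(\<lambda>k. 1 / real (Suc k)) \<longlonglongrightarrow> 0" by real_asymp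
    qed (use l(2) in \<open>auto intro: less_imp_le always_eventually\<close>)
    then show ?case using tendsto_dist_iff by auto
  next
    case (Suc m)
    have "isCont farey ((farey ^^ m) x)"
      using mem[OF Suc] by (intro isCont_farey) auto
    from isCont_tendsto_compose[OF this Suc] show ?case by (simp add: farey_s)
  qed
  show ?thesis by (rule that[OF l(1) lim mem[OF lim]])
qed

end

context sparse_point
begin

text \<open>Digits pass to the limit because the orbits keep away from 1/2. Two zeros in the limit
  code would put zeros of d at a fixed distance arbitrarily far out, against
  \<open>gaps\<close>.\<close>

lemma Omega_code:
  assumes "x \<in> Omega1 \<tau>"
  obtains e j where "farey_point e x" "\<And>k. \<not> e k \<Longrightarrow> k = j"
proof -
  obtain l where l: "\<And>k. l k \<ge> k" and lim: "\<And>m. (\<lambda>k. s (l k + m)) \<longlonglongrightarrow> (farey ^^ m) x"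
    and mem: "\<And>m. (farey ^^ m) x \<in> {1/3..3/7} \<union> {4/7..3/4}"
    using Omega_sequence[OF assms] by blast
  define e where "e m \<longleftrightarrow> 1/2 < (farey ^^ m) x" for m
  have ev0: "\<forall>\<^sub>F k in sequentially. \<not> d (l k + m)" if "\<not> e m" for m
  proof -
    have "(farey ^^ m) x < 1/2" using that mem[of m] by (auto simp: e_def)
    from order_tendstoD(2)[OF lim this] show ?thesis
      by eventually_elim (simp add: s_digit)
  qed
  have uniq: "\<not> (m < m')" if "\<not> e m" "\<not> e m'" for m m'
  proof
    assume "m < m'"
    obtain N where N: "\<And>r r'. r \<ge> N \<Longrightarrow> r' > r \<Longrightarrow> \<not> d r \<Longrightarrow> \<not> d r' \<Longrightarrow> r + (m' - m) < r'"
      using gaps[of "m' - m"] by blast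
    have "\<forall>\<^sub>F k in sequentially. \<not> d (l k + m) \<and> \<not> d (l k + m') \<and> k \<ge> N"
      using ev0[OF that(1)] ev0[OF that(2)] eventually_ge_at_top[of N] by eventually_elim simp
    then obtain k where k: "\<not> d (l k + m)" "\<not> d (l k + m')" "k \<ge> N"
      by (auto simp: eventually_sequentially)
    then show False using N[of "l k + m" "l k + m'"] l[of k] \<open>m < m'\<close> by simp
  qed
  \<comment> \<open>The default 0 serves the code without zeros, for which the condition on j is
    vacuous.\<close>
  define j where "j = (if \<exists>k. \<not> e k then SOME k. \<not> e k else 0)"
  have j: "k = j" if "\<not> e k" for k
  proof -
    have "\<not> e j" unfolding j_def using that someI_ex[of "\<lambda>k. \<not> e k"] by auto
    then show ?thesis using uniq[OF that, of j] uniq[of j k] that by linarith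
  qed
  have step: "branch (e m) ((farey ^^ Suc m) x) = (farey ^^ m) x" for m
  proof -
    define y where "y = (farey ^^ m) x"
    have y: "y \<in> {1/3..3/7} \<union> {4/7..3/4}" unfolding y_def by (rule mem)
    have "branch (1/2 < y) (farey y) = y"
    proof (cases "1/2 < y")
      case True
      then have "1 + (1 - y) / y = 1 / y" by (simp add: field_simps)
      then show ?thesis using True by (simp add: branch_def farey_def)
    next
      case False
      then have "y < 1" by simp
      then have "1 + y / (1 - y) = 1 / (1 - y)" by (simp add: field_simps)
      then show ?thesis using False \<open>y < 1\<close> by (simp add: branch_def farey_def)
    qed
    then show ?thesis by (simp add: e_def y_def)
  qed
  have cyl: "cyl e m ((farey ^^ m) x) = x" for m
    by (induction m) (simp_all only: cyl.simps step funpow_0)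
  have "farey_point e x"
  proof
    show "no00 e" unfolding no00_def using j by (metis n_not_Suc_n)
    fix n
    have "(farey ^^ n) x \<in> {0..1}" using mem[of n] by auto
    then show "\<exists>y\<in>{0..1}. x = cyl e n y" using cyl[of n] by metis
  qed
  then show ?thesis using j by (rule that)
qed

end

text \<open>Both points are images under one cylinder map, with distortion constant 16 = 4^2. At a
  disagreement the remainders are separated by the gap from 3/7 to 4/7, of width 1/7.\<close>

lemma common_prefix_dist:
  assumes "farey_point d t" "farey_point e x" and eq: "\<And>k. k < m \<Longrightarrow> d k = e k"
  shows "\<bar>t - x\<bar> \<le> 16 / (esize e m)\<^sup>2"
    and "d m \<noteq> e m \<Longrightarrow> 1 / (7 * (esize e m)\<^sup>2) \<le> \<bar>t - x\<bar>"
proof -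
  interpret D: farey_point d t by fact
  interpret X: farey_point e x by fact
  define A B E where "A = den e m (D.s m)" and "B = den e m (X.s m)" and "E = esize e m"
  have AB: "0 < A" "0 < B" "A \<le> E" "B \<le> E" "E \<le> 4 * A" "E \<le> 4 * B" "1 \<le> E"
    using D.s_mem[of m] X.s_mem[of m]
    by (auto simp: A_def B_def E_def intro!: den_pos den_le_esize esize_le_den[OF X.no00] esize_ge_1)
  have t: "t = cyl e m (D.s m)" using D.s_cyl[of m] cyl_cong[of m d e "D.s m"] eq by simp
  have x: "x = cyl e m (X.s m)" using X.s_cyl[of m] by simp
  have dist: "\<bar>t - x\<bar> = \<bar>D.s m - X.s m\<bar> / (A * B)"
    unfolding A_def B_def by (subst t, subst x, rule cyl_diff[OF D.s_nonneg X.s_nonneg])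
  have "E * E \<le> (4 * A) * (4 * B)" using AB by (intro mult_mono) auto
  then have ge: "E\<^sup>2 / 16 \<le> A * B" by (simp add: power2_eq_square)
  have le: "A * B \<le> E\<^sup>2" unfolding power2_eq_square using AB by (intro mult_mono) auto
  have "\<bar>D.s m - X.s m\<bar> \<le> 1" using D.s_mem[of m] X.s_mem[of m] by auto
  then have "\<bar>D.s m - X.s m\<bar> / (A * B) \<le> 1 / (E\<^sup>2 / 16)"
    using AB ge by (intro frac_le) auto
  then show "\<bar>t - x\<bar> \<le> 16 / (esize e m)\<^sup>2" by (simp add: dist E_def)
  assume "d m \<noteq> e m"
  then have "1/7 \<le> \<bar>D.s m - X.s m\<bar>"
    using D.s_digit_one[of m] D.s_digit_zero[of m] X.s_digit_one[of m] X.s_digit_zero[of m]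
    by (cases "d m"; cases "e m") auto
  then have "(1/7) / E\<^sup>2 \<le> \<bar>D.s m - X.s m\<bar> / (A * B)"
    using AB le by (intro frac_le mult_pos_pos) auto
  then show "1 / (7 * (esize e m)\<^sup>2) \<le> \<bar>t - x\<bar>" by (simp add: dist E_def)
qed

lemma zeros_le_one:
  assumes "\<And>k. \<not> e k \<Longrightarrow> k = j"
  shows "zeros e m \<le> 1"
proof -
  have "{k. k < m \<and> \<not> e k} \<subseteq> {j}" using assms by auto
  then have "card {k. k < m \<and> \<not> e k} \<le> card {j}" by (intro card_mono) auto
  then show ?thesis by (simp add: zeros_def)
qed

section \<open>Size of the singular term\<close>

lemma powr_square: "(a powr t)\<^sup>2 = a powr (t * 2)" for a t :: real
  unfolding power2_eq_square powr_add[symmetric] by (simp add: mult.commute)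

context sparse_point
begin

lemma Omega_mem:
  assumes "x \<in> Omega1 \<tau>"
  shows "x \<in> {1/3..1}" "x \<in> {0..1}"
proof -
  obtain e j where "farey_point e x" using Omega_code[OF assms] by blast
  then have "1/3 \<le> x" "x \<le> 3/4" by (rule farey_point.tau_bounds)+
  then show "x \<in> {1/3..1}" "x \<in> {0..1}" by auto
qed

text \<open>The first disagreement is at some M <= m, and there \<open>esize\<close> of e is at most
  4 \<phi>^m because e has at most one zero. Hence 112 = 7 * 16.\<close>

lemma disagreement_bound:
  assumes X: "farey_point e x" and j: "\<And>k. \<not> e k \<Longrightarrow> k = j"
    and ne: "d (n + m) \<noteq> e m" and \<alpha>: "0 < \<alpha>" "\<alpha> < 1"
  shows "x \<noteq> s n" "\<bar>s n - x\<bar> powr (- \<alpha>) \<le> 112 * \<phi> powr (2 * \<alpha> * real m)"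
proof -
  define M where "M = (LEAST m. d (n + m) \<noteq> e m)"
  have M: "d (n + M) \<noteq> e M" "M \<le> m" "\<And>k. k < M \<Longrightarrow> d (n + k) = e k"
  proof -
    show "d (n + M) \<noteq> e M" unfolding M_def using ne by (rule LeastI)
    show "M \<le> m" unfolding M_def using ne by (rule Least_le)
    show "d (n + k) = e k" if "k < M" for k using not_less_Least[OF that[unfolded M_def]] by blast
  qed
  define E where "E = esize e M"
  have dist: "1 / (7 * E\<^sup>2) \<le> \<bar>s n - x\<bar>"
    unfolding E_def by (rule common_prefix_dist(2)[OF shift_point X M(3) M(1)])
  have E1: "1 \<le> E" unfolding E_def by (rule esize_ge_1)
  have phi1: "1 \<le> \<phi>" "0 < \<phi>" "\<phi> \<le> 2" using phi_bounds by auto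
  have "E \<le> \<phi> * \<phi> ^ M * 2 ^ zeros e M" unfolding E_def by (rule esize_upper)
  also have "\<dots> \<le> 2 * \<phi> ^ m * 2 ^ 1"
    using phi1 M(2) zeros_le_one[OF j]
    by (intro mult_mono power_increasing) auto
  finally have "E \<le> 4 * \<phi> ^ m" by simp
  then have "E\<^sup>2 \<le> (4 * \<phi> ^ m)\<^sup>2" using E1 by (intro power_mono) auto
  then have E2: "E\<^sup>2 \<le> 16 * (\<phi> ^ m)\<^sup>2" by (simp add: power_mult_distrib)
  have ph: "0 < (\<phi> ^ m)\<^sup>2" using phi1 by simp
  have "1 / (7 * (16 * (\<phi> ^ m)\<^sup>2)) \<le> 1 / (7 * E\<^sup>2)"
    using E1 E2 ph by (intro frac_le) auto
  then have dist': "1 / (112 * (\<phi> ^ m)\<^sup>2) \<le> \<bar>s n - x\<bar>" using dist by simp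
  have pos: "0 < 1 / (112 * (\<phi> ^ m)\<^sup>2)" using ph by simp
  then show "x \<noteq> s n" using dist' by auto
  have "\<bar>s n - x\<bar> powr (- \<alpha>) \<le> (1 / (112 * (\<phi> ^ m)\<^sup>2)) powr (- \<alpha>)"
    using \<alpha> dist' pos by (intro powr_mono2') auto
  also have "\<dots> = (112 * (\<phi> ^ m)\<^sup>2) powr \<alpha>"
    using ph by (simp add: powr_minus_divide powr_divide)
  also have "\<dots> = 112 powr \<alpha> * ((\<phi> ^ m)\<^sup>2) powr \<alpha>" using ph by (simp add: powr_mult)
  also have "\<dots> \<le> 112 powr 1 * ((\<phi> ^ m)\<^sup>2) powr \<alpha>"
    using \<alpha> by (intro mult_right_mono powr_mono) auto
  also have "((\<phi> ^ m)\<^sup>2) powr \<alpha> = \<phi> powr (2 * \<alpha> * real m)"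
  proof -
    have "(\<phi> ^ m)\<^sup>2 = \<phi> powr (real m * 2)"
      unfolding powr_realpow[OF phi1(2), symmetric] by (rule powr_square)
    then show ?thesis by (simp add: powr_powr mult_ac)
  qed
  finally show "\<bar>s n - x\<bar> powr (- \<alpha>) \<le> 112 * \<phi> powr (2 * \<alpha> * real m)" by simp
qed

lemma esize_powr_upper:
  assumes "\<alpha> < 1"
  shows "(esize d n)\<^sup>2 powr (\<alpha> - 1) \<le> \<phi> powr (- (2 * (1 - \<alpha>) * (real n - real (zeros d n))))"
proof -
  have phi1: "0 < \<phi>" using phi_bounds by simp
  have "\<phi> powr real n \<le> \<phi> powr real (zeros d n) * esize d n"
    using esize_lower[of n d] phi1 by (simp add: powr_realpow)
  then have "\<phi> powr (real n - real (zeros d n)) \<le> esize d n"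
    using phi1 by (simp add: powr_diff divide_le_eq mult.commute)
  then have "(\<phi> powr (real n - real (zeros d n)))\<^sup>2 \<le> (esize d n)\<^sup>2" by (intro power_mono) auto
  then have "(esize d n)\<^sup>2 powr (\<alpha> - 1) \<le> ((\<phi> powr (real n - real (zeros d n)))\<^sup>2) powr (\<alpha> - 1)"
    using assms phi1 by (intro powr_mono2') auto
  also have "(\<phi> powr (real n - real (zeros d n)))\<^sup>2 = \<phi> powr ((real n - real (zeros d n)) * 2)"
    by (rule powr_square)
  finally show ?thesis by (simp add: powr_powr algebra_simps)
qed

lemma ln_phi_pos: "0 < ln \<phi>"
  using phi_bounds by simp

lemma zeros_small:
  assumes "0 < \<epsilon>"
  shows "\<forall>\<^sub>F n in sequentially. real (zeros d n) \<le> \<epsilon> * real n"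
proof -
  have "\<forall>\<^sub>F n in sequentially. sqrt (real n) + 1 \<le> \<epsilon> * real n" using assms by real_asymp
  then show ?thesis by eventually_elim (rule order_trans[OF zeros_le])
qed

lemma exp_decay:
  assumes "0 < c"
  shows "(\<lambda>n. ln (real n) * (K * \<phi> powr (- (c * real n)))) \<longlonglongrightarrow> 0"
proof -
  define a where "a = c * ln \<phi>"
  have a: "0 < a" using assms ln_phi_pos by (simp add: a_def)
  have "(\<lambda>n. ln (real n) * (K * exp (- (a * real n)))) \<longlonglongrightarrow> 0" using a by real_asymp
  moreover have "\<phi> powr (- (c * real n)) = exp (- (a * real n))" for n
    using phi_bounds by (simp add: powr_def a_def mult_ac)
  ultimately show ?thesis by simp
qed

text \<open>b n bounds the wait for the next zero, and \<kappa> is its linear rate. The distance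
  factor is at most about \<phi>^(2\<alpha>\<kappa>n) and the \<open>esize\<close> factor about
  \<phi>^(-2(1-\<alpha>)n), so the bound decays if \<kappa>\<alpha> < 1 - \<alpha>.\<close>

lemma main_term_negligible:
  assumes \<alpha>: "0 < \<alpha>" "\<alpha> < 1" and \<kappa>: "0 \<le> \<kappa>" "\<kappa> * \<alpha> < 1 - \<alpha>"
    and next0: "\<And>n. \<exists>r. n \<le> r \<and> r \<le> n + b n \<and> \<not> d r"
    and b: "\<And>\<epsilon>. 0 < \<epsilon> \<Longrightarrow> \<forall>\<^sub>F n in sequentially. real (b n) \<le> (\<kappa> + \<epsilon>) * real n"
    and x: "x \<in> Omega1 \<tau>"
  shows "(\<lambda>n. ln (real n) * main_term \<alpha> n x) \<longlonglongrightarrow> 0"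
proof -
  obtain e j where X: "farey_point e x" and j: "\<And>k. \<not> e k \<Longrightarrow> k = j"
    using Omega_code[OF x] by blast
  \<comment> \<open>The next zero of d disagrees with e unless it meets the only possible zero of e,
    at j; in that case a zero beyond j disagrees.\<close>
  have dis: "\<exists>m. d (n + m) \<noteq> e m \<and> m \<le> max (b n) (j + 1 + b (n + (j + 1)))" for n
  proof -
    obtain r where r: "n \<le> r" "r \<le> n + b n" "\<not> d r" using next0[of n] by blast
    show ?thesis
    proof (cases "e (r - n)")
      case True
      then show ?thesis using r by (intro exI[of _ "r - n"]) auto
    next
      case False
      then have rn: "r - n = j" by (rule j)
      obtain r' where r': "n + (j + 1) \<le> r'" "r' \<le> n + (j + 1) + b (n + (j + 1))" "\<not> d r'"
        using next0[of "n + (j + 1)"] by blast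
      have "r' - n \<noteq> j" using r'(1) by simp
      then have "e (r' - n)" using j by blast
      then show ?thesis using r' by (intro exI[of _ "r' - n"]) auto
    qed
  qed
  \<comment> \<open>The leading exponent is -2cn. With \<epsilon> = c/8 the errors total at most
    4\<epsilon>n = cn/2, which leaves more than the decay -cn claimed below.\<close>
  define c where "c = (1 - \<alpha> - \<kappa> * \<alpha>)"
  define \<epsilon> where "\<epsilon> = c / 8"
  have c: "0 < c" using \<kappa> by (simp add: c_def)
  then have \<epsilon>: "0 < \<epsilon>" by (simp add: \<epsilon>_def)
  have ev1: "\<forall>\<^sub>F n in sequentially. real (b n) \<le> (\<kappa> + \<epsilon>) * real n" by (rule b[OF \<epsilon>])
  then have ev2: "\<forall>\<^sub>F n in sequentially. real (b (n + (j + 1))) \<le> (\<kappa> + \<epsilon>) * real (n + (j + 1))"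
    unfolding eventually_sequentially by (meson trans_le_add1)
  have ev3: "\<forall>\<^sub>F n in sequentially. real (j + 1) + (\<kappa> + \<epsilon>) * real (n + (j + 1)) \<le> (\<kappa> + 2 * \<epsilon>) * real n"
  proof -
    have "\<forall>\<^sub>F n in sequentially. real (j + 1) + (\<kappa> + \<epsilon>) * real (j + 1) \<le> \<epsilon> * real n"
      using \<epsilon> by real_asymp
    then show ?thesis by eventually_elim (simp add: algebra_simps)
  qed
  have upper: "\<forall>\<^sub>F n in sequentially. ln (real n) * main_term \<alpha> n x \<le> ln (real n) * (1792 * \<phi> powr (- (c * real n)))"
    using ev1 ev2 ev3 zeros_small[OF \<epsilon>] eventually_ge_at_top[of 1]
  proof eventually_elim
    case (elim n)
    obtain m where m: "d (n + m) \<noteq> e m" "m \<le> max (b n) (j + 1 + b (n + (j + 1)))" using dis by blast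
    have "real m \<le> (\<kappa> + 2 * \<epsilon>) * real n"
    proof -
      have "real m \<le> max (real (b n)) (real (j + 1) + real (b (n + (j + 1))))"
      proof -
        have "real m \<le> real (max (b n) (j + 1 + b (n + (j + 1))))" using m(2) by (simp only: of_nat_le_iff)
        then show ?thesis by (simp only: of_nat_max of_nat_add)
      qed
      moreover have "(\<kappa> + \<epsilon>) * real n \<le> (\<kappa> + 2 * \<epsilon>) * real n" using \<epsilon> by (intro mult_right_mono) auto
      ultimately show ?thesis using elim(1-3) by linarith
    qed
    then have am: "2 * \<alpha> * real m \<le> 2 * \<alpha> * ((\<kappa> + 2 * \<epsilon>) * real n)"
      using \<alpha> by (intro mult_left_mono) auto
    have az: "2 * (1 - \<alpha>) * real (zeros d n) \<le> 2 * (1 - \<alpha>) * (\<epsilon> * real n)"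
      using elim(4) \<alpha> by (intro mult_left_mono) auto
    note D = disagreement_bound[OF X j m(1) \<alpha>]
    have "main_term \<alpha> n x \<le> 16 * ((esize d n)\<^sup>2 powr (\<alpha> - 1) * \<bar>s n - x\<bar> powr (- \<alpha>))"
      by (rule main_term_bounds(1)[OF \<alpha> Omega_mem(2)[OF x] D(1)])
    also have "\<dots> \<le> 16 * (\<phi> powr (- (2 * (1 - \<alpha>) * (real n - real (zeros d n)))) * (112 * \<phi> powr (2 * \<alpha> * real m)))"
      using esize_powr_upper[OF \<alpha>(2)] D(2) by (intro mult_left_mono mult_mono) auto
    also have "\<dots> = 1792 * \<phi> powr (- (2 * (1 - \<alpha>) * (real n - real (zeros d n))) + 2 * \<alpha> * real m)"
      unfolding powr_add by simp
    also have "\<dots> \<le> 1792 * \<phi> powr (- (c * real n))"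
    proof (intro mult_left_mono powr_mono)
      have arith: "- L + B \<le> - C"
        if "U + V \<le> 2 * t" "8 * t = C" "0 \<le> C" "C = N - aN - kN" "L = 2 * (N - aN) - A"
          "B' = 2 * kN + 2 * V" "A' = 2 * U" "B \<le> B'" "A \<le> A'"
        for A A' B B' C L N U V aN kN t :: real
        using that by simp
      have 1: "(1 - \<alpha>) * (\<epsilon> * real n) + 2 * \<alpha> * (\<epsilon> * real n) \<le> 2 * (\<epsilon> * real n)"
      proof -
        have "(1 + \<alpha>) * (\<epsilon> * real n) \<le> 2 * (\<epsilon> * real n)" using \<alpha> \<epsilon> by (intro mult_right_mono) auto
        then show ?thesis by (simp add: algebra_simps)
      qed
      have 2: "8 * (\<epsilon> * real n) = c * real n" by (simp add: \<epsilon>_def)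
      have 3: "0 \<le> c * real n" using c by simp
      have 4: "c * real n = real n - \<alpha> * real n - \<kappa> * \<alpha> * real n" by (simp add: c_def algebra_simps)
      have 5: "2 * (1 - \<alpha>) * (real n - real (zeros d n)) = 2 * (real n - \<alpha> * real n) - 2 * (1 - \<alpha>) * real (zeros d n)"
        by (simp add: algebra_simps)
      have 6: "2 * \<alpha> * ((\<kappa> + 2 * \<epsilon>) * real n) = 2 * (\<kappa> * \<alpha> * real n) + 2 * (2 * \<alpha> * (\<epsilon> * real n))"
        by (simp add: algebra_simps)
      have 7: "2 * (1 - \<alpha>) * (\<epsilon> * real n) = 2 * ((1 - \<alpha>) * (\<epsilon> * real n))" by simp
      show "- (2 * (1 - \<alpha>) * (real n - real (zeros d n))) + 2 * \<alpha> * real m \<le> - (c * real n)"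
        by (rule arith[OF 1 2 3 4 5 6 7 am az])
      show "1 \<le> \<phi>" using phi_bounds by simp
    qed simp
    finally show ?case using elim(5) by (intro mult_left_mono) auto
  qed
  show ?thesis
  proof (rule tendsto_sandwich[OF _ upper tendsto_const exp_decay[OF c]])
    show "\<forall>\<^sub>F n in sequentially. 0 \<le> ln (real n) * main_term \<alpha> n x"
      using eventually_ge_at_top[of 1] by eventually_elim (simp add: main_term_nonneg)
  qed
qed

text \<open>The code of \<open>s n\<close> has infinitely many zeros, that of a limit point at most
  one; so the iterates are finite at limit points.\<close>

lemma Omega_ne_orbit:
  assumes "x \<in> Omega1 \<tau>"
  shows "x \<noteq> s n"
proof -
  obtain e j where X: "farey_point e x" and j: "\<And>k. \<not> e k \<Longrightarrow> k = j"
    using Omega_code[OF assms] by blast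
  obtain r where r: "r \<ge> n + j + 1" "\<not> d r" using zeros_unbounded by blast
  have "r - n \<noteq> j" using r(1) by simp
  then have "e (r - n)" using j by blast
  then have "d (n + (r - n)) \<noteq> e (r - n)" using r by simp
  from disagreement_bound(1)[OF X j this, of "1/2"] show ?thesis by simp
qed

section \<open>Limit, lower limit and upper limit of the scaled iterates\<close>

lemma P1_scaled:
  assumes "x \<in> Omega1 \<tau>"
  shows "ereal (ln (real n)) * (P1 ^^ n) (v \<tau> \<alpha>) x
    = ereal (ln (real n) * main_term \<alpha> n x + ln (real n) * side_sum \<alpha> n x)"
  using P1_funpow_v[OF Omega_mem(2)[OF assms], of n \<alpha>] Omega_ne_orbit[OF assms, of n]
  by (simp add: distrib_left)

lemma P1_limit:
  assumes \<alpha>: "0 < \<alpha>" "\<alpha> < 1" and x: "x \<in> Omega1 \<tau>"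
    and r: "strict_mono r" "(\<lambda>n. ln (real (r n)) * main_term \<alpha> (r n) x) \<longlonglongrightarrow> 0"
  shows "(\<lambda>n. ereal (ln (real (r n))) * (P1 ^^ r n) (v \<tau> \<alpha>) x) \<longlonglongrightarrow> ereal (v_int \<tau> \<alpha> * h1 x)"
proof -
  have "(\<lambda>n. ln (real (r n)) * side_sum \<alpha> (r n) x) \<longlonglongrightarrow> v_int \<tau> \<alpha> * h1 x"
    using LIMSEQ_subseq_LIMSEQ[OF side_sum_limit[OF \<alpha> Omega_mem(1)[OF x]] r(1)] by (simp add: o_def)
  from tendsto_add[OF r(2) this] show ?thesis
    unfolding P1_scaled[OF x] by simp
qed

text \<open>Dropping the nonnegative main term gives the lower bound. It is attained along the n for
  which d has a zero at n + j + 1: there e has a 1 at j + 1, the agreement stays bounded and the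
  main term decays.\<close>

lemma P1_liminf:
  assumes \<alpha>: "0 < \<alpha>" "\<alpha> < 1" and x: "x \<in> Omega1 \<tau>"
  shows "liminf (\<lambda>n. ereal (ln (real n)) * (P1 ^^ n) (v \<tau> \<alpha>) x) = ereal (v_int \<tau> \<alpha> * h1 x)"
    (is "liminf ?f = ?L")
proof (rule antisym)
  have "(\<lambda>n. ereal (ln (real n) * side_sum \<alpha> n x)) \<longlonglongrightarrow> ?L"
    using side_sum_limit[OF \<alpha> Omega_mem(1)[OF x]] by simp
  then have "?L = liminf (\<lambda>n. ereal (ln (real n) * side_sum \<alpha> n x))"
    by (intro lim_imp_Liminf[symmetric]) auto
  also have "\<dots> \<le> liminf ?f"
  proof (rule Liminf_mono)
    show "\<forall>\<^sub>F n in sequentially. ereal (ln (real n) * side_sum \<alpha> n x) \<le> ?f n"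
      unfolding P1_scaled[OF x] using eventually_ge_at_top[of 1]
      by eventually_elim (simp add: main_term_nonneg)
  qed
  finally show "?L \<le> liminf ?f" .
  obtain e j where X: "farey_point e x" and j: "\<And>k. \<not> e k \<Longrightarrow> k = j"
    using Omega_code[OF x] by blast
  define J where "J = j + 1"
  have eJ: "e J" using j[of J] by (auto simp: J_def)
  define N where "N = {n. \<not> d (n + J)}"
  have "infinite N"
    unfolding infinite_nat_iff_unbounded_le
  proof
    fix m
    obtain r where "r \<ge> m + J" "\<not> d r" using zeros_unbounded by blast
    then show "\<exists>n\<ge>m. n \<in> N" by (intro exI[of _ "r - J"]) (auto simp: N_def)
  qed
  then obtain r :: "nat \<Rightarrow> nat" where r: "strict_mono r" "\<And>n. r n \<in> N"
    using infinite_enumerate by blast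
  have phi0: "0 < \<phi>" using phi_bounds by simp
  define K where "K = 16 * (112 * \<phi> powr (2 * \<alpha> * real J))"
  have bound: "main_term \<alpha> n x \<le> K * \<phi> powr (- ((1 - \<alpha>) * real n))" if "n \<in> N" for n
  proof -
    have "d (n + J) \<noteq> e J" using that eJ by (simp add: N_def)
    note D = disagreement_bound[OF X j this \<alpha>]
    have "main_term \<alpha> n x \<le> 16 * ((esize d n)\<^sup>2 powr (\<alpha> - 1) * \<bar>s n - x\<bar> powr (- \<alpha>))"
      by (rule main_term_bounds(1)[OF \<alpha> Omega_mem(2)[OF x] D(1)])
    also have "\<dots> \<le> 16 * (\<phi> powr (- ((1 - \<alpha>) * real n)) * (112 * \<phi> powr (2 * \<alpha> * real J)))"
    proof (intro mult_left_mono mult_mono D(2))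
      have "(esize d n)\<^sup>2 powr (\<alpha> - 1) \<le> (\<phi> ^ n) powr (\<alpha> - 1)"
        using \<alpha> phi_bounds esize_square_lower[OF no00] by (intro powr_mono2') auto
      also have "\<dots> = \<phi> powr (- ((1 - \<alpha>) * real n))"
        unfolding powr_realpow[OF phi0, symmetric] powr_powr by (simp add: algebra_simps)
      finally show "(esize d n)\<^sup>2 powr (\<alpha> - 1) \<le> \<phi> powr (- ((1 - \<alpha>) * real n))" .
    qed auto
    finally show ?thesis by (simp add: K_def mult_ac)
  qed
  have "(\<lambda>n. ln (real (r n)) * main_term \<alpha> (r n) x) \<longlonglongrightarrow> 0"
  proof (rule tendsto_sandwich[where f = "\<lambda>_. 0"])
    show "(\<lambda>n. ln (real (r n)) * (K * \<phi> powr (- ((1 - \<alpha>) * real (r n))))) \<longlonglongrightarrow> 0"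
      using LIMSEQ_subseq_LIMSEQ[OF exp_decay[of "1 - \<alpha>" K] r(1)] \<alpha> by (simp add: o_def)
    have ev: "\<forall>\<^sub>F n in sequentially. r n \<ge> 1"
      using eventually_ge_at_top[of 1] by eventually_elim (rule order_trans[OF _ strict_mono_imp_increasing[OF r(1)]])
    show "\<forall>\<^sub>F n in sequentially. 0 \<le> ln (real (r n)) * main_term \<alpha> (r n) x"
      using ev by eventually_elim (simp add: main_term_nonneg)
    show "\<forall>\<^sub>F n in sequentially. ln (real (r n)) * main_term \<alpha> (r n) x
        \<le> ln (real (r n)) * (K * \<phi> powr (- ((1 - \<alpha>) * real (r n))))"
      using ev by eventually_elim (intro mult_left_mono bound r(2), simp)
  qed auto
  from P1_limit[OF \<alpha> x r(1) this] have "liminf (?f \<circ> r) = ?L"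
    by (intro lim_imp_Liminf) (auto simp: o_def)
  then show "liminf ?f \<le> ?L" using liminf_subseq_mono[OF r(1), of ?f] by simp
qed

text \<open>Agreement in n - 2 digits gives a distance factor of order \<phi>^(2\<alpha>n), against
  \<phi>^(-2(1-\<alpha>)n) from \<open>esize\<close>. The product grows like
  \<phi>^((4\<alpha>-2)n), up to a loss exponential in sqrt n caused by the zeros of d.\<close>

lemma P1_limsup_infinite:
  assumes \<alpha>: "1/2 < \<alpha>" "\<alpha> < 1" and x: "x \<in> Omega1 \<tau>"
    and X: "farey_point e x" and j: "\<And>k. \<not> e k \<Longrightarrow> k = j"
    and inf: "infinite {n. \<forall>k<n - 2. d (n + k) = e k}"
  shows "limsup (\<lambda>n. ereal (ln (real n)) * (P1 ^^ n) (v \<tau> \<alpha>) x) = \<infinity>" (is "limsup ?f = \<infinity>")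
proof -
  have \<alpha>0: "0 < \<alpha>" using \<alpha> by simp
  have phi1: "1 \<le> \<phi>" "0 < \<phi>" using phi_bounds by auto
  obtain r :: "nat \<Rightarrow> nat" where r: "strict_mono r" "\<And>n. \<forall>k<r n - 2. d (r n + k) = e k"
    using infinite_enumerate[OF inf] by blast
  \<comment> \<open>256 = 16 * 16 collects the two distortion losses, 12 bounds the constant losses
    in the exponent, and 4 sqrt n comes from the zero count.\<close>
  define g where "g n = \<phi> powr ((4 * \<alpha> - 2) * real n - 12 - 4 * sqrt (real n)) / 256" for n :: nat
  have lower: "g n \<le> main_term \<alpha> n x" if n: "n \<ge> 3" "\<forall>k<n - 2. d (n + k) = e k" for n
  proof -
    define m E where "m = n - 2" and "E = esize e m"
    have E1: "1 \<le> E" unfolding E_def by (rule esize_ge_1)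
    have "\<bar>s n - x\<bar> \<le> 16 / E\<^sup>2"
      unfolding E_def m_def using n(2) by (intro common_prefix_dist(1)[OF shift_point X]) blast
    moreover have ne: "x \<noteq> s n" by (rule Omega_ne_orbit[OF x])
    ultimately have "(16 / E\<^sup>2) powr (- \<alpha>) \<le> \<bar>s n - x\<bar> powr (- \<alpha>)"
      using \<alpha>0 by (intro powr_mono2') auto
    moreover have "(16 / E\<^sup>2) powr (- \<alpha>) = (E\<^sup>2) powr \<alpha> / 16 powr \<alpha>"
      using E1 by (simp add: powr_minus_divide powr_divide)
    moreover have "(E\<^sup>2) powr \<alpha> / 16 powr 1 \<le> (E\<^sup>2) powr \<alpha> / 16 powr \<alpha>"
      using \<alpha> by (intro divide_left_mono powr_mono) auto
    ultimately have "(E\<^sup>2) powr \<alpha> / 16 powr 1 \<le> \<bar>s n - x\<bar> powr (- \<alpha>)" by linarith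
    then have 1: "(E\<^sup>2) powr \<alpha> / 16 \<le> \<bar>s n - x\<bar> powr (- \<alpha>)" by simp
    have "\<phi> ^ m \<le> \<phi> ^ zeros e m * E" unfolding E_def by (rule esize_lower)
    also have "\<dots> \<le> \<phi> ^ 1 * E"
      using phi1 zeros_le_one[OF j, where m = m] E1 by (intro mult_right_mono power_increasing) auto
    finally have "\<phi> powr real m \<le> \<phi> powr 1 * E" using phi1 by (simp add: powr_realpow)
    then have "\<phi> powr (real m - 1) \<le> E" using phi1 by (simp add: powr_diff divide_le_eq mult.commute)
    moreover have "real m - 1 = real n - 3" using n by (simp add: m_def of_nat_diff)
    ultimately have "(\<phi> powr (real n - 3))\<^sup>2 \<le> E\<^sup>2" by (intro power_mono) auto
    then have "((\<phi> powr (real n - 3))\<^sup>2) powr \<alpha> \<le> (E\<^sup>2) powr \<alpha>"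
      using \<alpha>0 by (intro powr_mono2) auto
    moreover have "((\<phi> powr (real n - 3))\<^sup>2) powr \<alpha> = \<phi> powr ((real n - 3) * 2 * \<alpha>)"
    proof -
      have "(\<phi> powr (real n - 3))\<^sup>2 = \<phi> powr ((real n - 3) * 2)"
        by (rule powr_square)
      then show ?thesis by (simp add: powr_powr)
    qed
    ultimately have 2: "\<phi> powr ((real n - 3) * 2 * \<alpha>) / 16 \<le> \<bar>s n - x\<bar> powr (- \<alpha>)" using 1 by simp
    define z where "z = zeros d n"
    have "esize d n \<le> \<phi> * \<phi> ^ n * 2 ^ z" unfolding z_def by (rule esize_upper)
    \<comment> \<open>2 <= \<phi>^2 turns the doublings into powers of \<phi>.\<close>
    also have "\<dots> \<le> \<phi> * \<phi> ^ n * (\<phi> * \<phi>) ^ z"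
      using phi_bounds by (intro mult_left_mono power_mono) auto
    also have "\<dots> = \<phi> powr (real n + 1 + 2 * real z)"
    proof -
      have "(\<phi> * \<phi>) ^ z = \<phi> ^ (2 * z)" by (simp add: power_mult power2_eq_square)
      moreover have "\<phi> powr (real n + 1 + 2 * real z) = \<phi> ^ n * \<phi> * \<phi> ^ (2 * z)"
        using powr_realpow[OF phi1(2), of n] powr_realpow[OF phi1(2), of "2 * z"] phi1
        unfolding powr_add by simp
      ultimately show ?thesis by simp
    qed
    finally have "(esize d n)\<^sup>2 \<le> (\<phi> powr (real n + 1 + 2 * real z))\<^sup>2"
      using esize_ge_1[of d n] by (intro power_mono) auto
    moreover have "0 < (esize d n)\<^sup>2" using esize_ge_1[of d n] by simp
    ultimately have "((\<phi> powr (real n + 1 + 2 * real z))\<^sup>2) powr (\<alpha> - 1) \<le> (esize d n)\<^sup>2 powr (\<alpha> - 1)"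
      using \<alpha> by (intro powr_mono2') auto
    moreover have "((\<phi> powr (real n + 1 + 2 * real z))\<^sup>2) powr (\<alpha> - 1) = \<phi> powr ((real n + 1 + 2 * real z) * 2 * (\<alpha> - 1))"
    proof -
      have "(\<phi> powr (real n + 1 + 2 * real z))\<^sup>2 = \<phi> powr ((real n + 1 + 2 * real z) * 2)"
        by (rule powr_square)
      then show ?thesis by (simp add: powr_powr)
    qed
    ultimately have 3: "\<phi> powr ((real n + 1 + 2 * real z) * 2 * (\<alpha> - 1)) \<le> (esize d n)\<^sup>2 powr (\<alpha> - 1)" by simp
    have "\<phi> powr ((4 * \<alpha> - 2) * real n - 12 - 4 * sqrt (real n))
        \<le> \<phi> powr ((real n + 1 + 2 * real z) * 2 * (\<alpha> - 1) + (real n - 3) * 2 * \<alpha>)"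
    proof (intro powr_mono phi1)
      have z: "real z \<le> sqrt (real n) + 1" unfolding z_def by (rule zeros_le)
      have "(real n + 1 + 2 * real z) * 2 * (\<alpha> - 1) + (real n - 3) * 2 * \<alpha>
          = (4 * \<alpha> - 2) * real n - 2 - 4 * \<alpha> - 4 * ((1 - \<alpha>) * real z)" by (simp add: algebra_simps)
      moreover have "(1 - \<alpha>) * real z \<le> 1 * real z" using \<alpha> by (intro mult_right_mono) auto
      ultimately show "(4 * \<alpha> - 2) * real n - 12 - 4 * sqrt (real n)
          \<le> (real n + 1 + 2 * real z) * 2 * (\<alpha> - 1) + (real n - 3) * 2 * \<alpha>"
        using z \<alpha> by linarith
    qed
    also have "\<dots> = 16 * (\<phi> powr ((real n + 1 + 2 * real z) * 2 * (\<alpha> - 1)) * (\<phi> powr ((real n - 3) * 2 * \<alpha>) / 16))"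
      unfolding powr_add by simp
    also have "\<dots> \<le> 16 * ((esize d n)\<^sup>2 powr (\<alpha> - 1) * \<bar>s n - x\<bar> powr (- \<alpha>))"
      using 2 3 by (intro mult_left_mono mult_mono) auto
    also have "\<dots> \<le> 16 * (16 * main_term \<alpha> n x)"
      by (intro mult_left_mono main_term_bounds(2)[OF \<alpha>0 \<alpha>(2) Omega_mem(2)[OF x] ne]) simp
    finally show ?thesis by (simp add: g_def)
  qed
  have ginf: "filterlim g at_top sequentially"
  proof -
    define a where "a = ln \<phi>"
    have a: "0 < a" using ln_phi_pos by (simp add: a_def)
    define t where "t = 4 * \<alpha> - 2"
    have t: "0 < t" using \<alpha> by (simp add: t_def)
    have "filterlim (\<lambda>n. t * real n - 12 - 4 * sqrt (real n)) at_top sequentially" using t by real_asymp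
    from filterlim_tendsto_pos_mult_at_top[OF tendsto_const[of a] a this]
    have "filterlim (\<lambda>n. exp (a * (t * real n - 12 - 4 * sqrt (real n)))) at_top sequentially"
      by (rule filterlim_compose[OF exp_at_top])
    from filterlim_tendsto_pos_mult_at_top[OF tendsto_const[of "1/256"] _ this]
    have "filterlim (\<lambda>n. 1/256 * exp (a * (t * real n - 12 - 4 * sqrt (real n)))) at_top sequentially"
      by simp
    moreover have "g = (\<lambda>n. 1/256 * exp (a * (t * real n - 12 - 4 * sqrt (real n))))"
      unfolding g_def[abs_def] powr_def a_def t_def using phi1(2) by (simp add: mult.commute[of "ln \<phi>"])
    ultimately show ?thesis by (simp only:)
  qed
  have ev: "\<forall>\<^sub>F n in sequentially. ereal (g (r n)) \<le> ?f (r n)"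
    using eventually_ge_at_top[of 3]
  proof eventually_elim
    case (elim n)
    have rn: "r n \<ge> 3" using elim strict_mono_imp_increasing[OF r(1), of n] by simp
    have "1 < ln (real (r n))"
    proof -
      have "real (r n) = real (r n - 3) + 3" using rn by (simp add: of_nat_diff)
      then show ?thesis using one_less_ln[of "r n - 3"] by (simp only:)
    qed
    then have "1 * main_term \<alpha> (r n) x \<le> ln (real (r n)) * main_term \<alpha> (r n) x"
      by (intro mult_right_mono main_term_nonneg) simp
    moreover have "0 \<le> side_sum \<alpha> (r n) x"
      unfolding side_sum_def by (rule sum_nonneg) (rule transfer_funpow_nonneg[OF side_term_nonneg Omega_mem(2)[OF x]])
    then have "0 \<le> ln (real (r n)) * side_sum \<alpha> (r n) x" using \<open>1 < ln (real (r n))\<close> by simp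
    moreover have "g (r n) \<le> main_term \<alpha> (r n) x" by (rule lower[OF rn r(2)])
    ultimately have "g (r n) \<le> ln (real (r n)) * main_term \<alpha> (r n) x + ln (real (r n)) * side_sum \<alpha> (r n) x"
      by linarith
    then show ?case unfolding P1_scaled[OF x] ereal_less_eq(3) .
  qed
  have "filterlim (\<lambda>n. g (r n)) at_top sequentially"
    by (rule filterlim_compose[OF ginf filterlim_subseq[OF r(1)]])
  then have "(\<lambda>n. ereal (g (r n))) \<longlonglongrightarrow> \<infinity>"
    by (rule tendsto_PInfty_eq_at_top[THEN iffD2])
  from tendsto_sandwich[OF ev _ this tendsto_const]
  have "(\<lambda>n. ?f (r n)) \<longlonglongrightarrow> \<infinity>" by (simp only: ereal_less_eq(1) eventually_True)
  then have "limsup (\<lambda>n. ?f (r n)) = \<infinity>" by (rule lim_imp_Limsup[OF sequentially_bot])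
  then have "\<infinity> \<le> limsup ?f" using limsup_subseq_mono[OF r(1), of ?f] unfolding o_def by (simp only:)
  then show ?thesis by (simp only: ereal_infty_less_eq)
qed

end

section \<open>Construction of the sparse codes\<close>

lemma zeros_le_sqrt:
  assumes "\<And>k. \<not> d k \<longleftrightarrow> (\<exists>i. k = p i)" "\<And>i. i\<^sup>2 \<le> p i"
  shows "real (zeros d n) \<le> sqrt (real n) + 1"
proof -
  define N where "N = nat \<lfloor>sqrt (real n)\<rfloor>"
  have "{k. k < n \<and> \<not> d k} \<subseteq> p ` {..N}"
  proof
    fix k assume "k \<in> {k. k < n \<and> \<not> d k}"
    then obtain i where i: "k = p i" "k < n" using assms(1) by auto
    then have "real i ^ 2 \<le> real n" using assms(2)[of i] by (metis less_imp_le of_nat_le_iff of_nat_power order_trans)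
    then have "real i \<le> sqrt (real n)" by (rule real_le_rsqrt)
    then have "i \<le> N" unfolding N_def by (simp add: le_nat_floor)
    then show "k \<in> p ` {..N}" using i by auto
  qed
  then have "zeros d n \<le> card (p ` {..N})" unfolding zeros_def by (intro card_mono) auto
  also have "\<dots> \<le> N + 1" using card_image_le[of "{..N}" p] by simp
  finally have "real (zeros d n) \<le> real N + 1" by linarith
  moreover have "real N \<le> sqrt (real n)" by (simp add: N_def)
  ultimately show ?thesis by linarith
qed

text \<open>A gap above i + 1 after the i-th zero excludes 00 already at i = 0 and makes the
  distances unbounded; i^2 <= p i gives the square-root count.\<close>

lemma sparse_point_intro:
  fixes p :: "nat \<Rightarrow> nat"
  assumes d: "\<And>k. \<not> d k \<longleftrightarrow> (\<exists>i. k = p i)" and sq: "\<And>i. i\<^sup>2 \<le> p i"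
    and gap: "\<And>i. p i + i + 1 < p (Suc i)"
  obtains \<tau> where "sparse_point d \<tau>"
proof -
  have "p i < p (Suc i)" for i using gap[of i] by linarith
  then have mono: "strict_mono p" by (simp add: strict_mono_Suc_iff)
  have far: "r + i + 1 < r'" if r: "r = p i" and r': "\<not> d r'" and less: "r < r'" for r r' i
  proof -
    obtain i' where i': "r' = p i'" using r' d by blast
    then have "i < i'" using r less strict_mono_less[OF mono] by simp
    then have "p (Suc i) \<le> r'" using i' strict_mono_less_eq[OF mono] by simp
    then show ?thesis using gap[of i] r by simp
  qed
  have "no00 d"
    unfolding no00_def
  proof (intro allI impI)
    fix n assume "\<not> d n"
    then obtain i where "n = p i" using d by blast
    then show "d (Suc n)" using far[of n i "Suc n"] by auto
  qed
  then obtain \<tau> where "farey_point d \<tau>" by (rule farey_point_exists)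
  then interpret farey_point d \<tau> .
  have "sparse_point d \<tau>"
  proof
    fix n
    have "n \<le> p n" by (rule strict_mono_imp_increasing[OF mono])
    then show "\<exists>r\<ge>n. \<not> d r" using d by blast
    show "real (zeros d n) \<le> sqrt (real n) + 1" by (rule zeros_le_sqrt[OF d sq])
  next
    fix G
    show "\<exists>N. \<forall>r\<ge>N. \<forall>r'>r. \<not> d r \<longrightarrow> \<not> d r' \<longrightarrow> r + G < r'"
    proof (intro exI[of _ "p G"] allI impI)
      fix r r' assume r: "p G \<le> r" "r < r'" "\<not> d r" "\<not> d r'"
      then obtain i where i: "r = p i" using d by blast
      then have "G \<le> i" using r strict_mono_less_eq[OF mono] by simp
      then show "r + G < r'" using far[OF i r(4,2)] by simp
    qed
  qed
  then show ?thesis by (rule that)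
qed

lemma square_le_power2: "i\<^sup>2 \<le> (2::nat) ^ (i + 1)"
proof (cases "3 \<le> i")
  case True
  then show ?thesis
  proof (induction i rule: nat_induct_at_least)
    case (Suc i)
    have "3 * i \<le> i * i" using Suc.hyps by (rule mult_right_mono) simp
    then have "Suc (2 * i) \<le> i * i" using Suc.hyps by linarith
    then have "(Suc i)\<^sup>2 \<le> 2 * i\<^sup>2" by (simp add: power2_eq_square)
    then show ?case using Suc.IH by simp
  qed simp
next
  case False
  then have "i = 0 \<or> i = 1 \<or> i = 2" by auto
  then show ?thesis by auto
qed

lemma power2_between:
  assumes "(2::nat) ^ i < 2 ^ l" "(2::nat) ^ l < 2 ^ (i + 2)"
  shows "l = i + 1"
proof -
  have "i < l" using power_less_imp_less_exp[OF _ assms(1)] by simp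
  moreover have "l < i + 2" using power_less_imp_less_exp[OF _ assms(2)] by simp
  ultimately show ?thesis by simp
qed

text \<open>Between consecutive powers of 2 there are only digits 1, in stretches about as long as
  their starting point. A window starting just after a power matches the code without zeros; one
  starting j places before a power matches a single zero at j.\<close>

lemma power_code_agreement:
  assumes d: "\<And>k. \<not> d k \<longleftrightarrow> (\<exists>i. k = (2::nat) ^ (i + 1))" and j: "\<And>k. \<not> e k \<Longrightarrow> k = j"
  shows "infinite {n. \<forall>k<n - 2. d (n + k) = e k}"
  unfolding infinite_nat_iff_unbounded_le
proof
  fix m
  show "\<exists>n\<ge>m. n \<in> {n. \<forall>k<n - 2. d (n + k) = e k}"
  proof (cases "e j")
    case True
    then have e: "e k" for k using j by blast
    \<comment> \<open>The summand 1 skips the zero at 2^(m+1); the window ends at 2n - 3 = 2^(m+2) -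
      1, just before the next zero.\<close>
    let ?n = "2 ^ (m + 1) + 1 :: nat"
    have "d (?n + k)" if "k < ?n - 2" for k
    proof (rule ccontr)
      assume "\<not> d (?n + k)"
      then obtain l where l: "?n + k = 2 ^ (l + 1)" using d by blast
      have "(2::nat) ^ (m + 1) < 2 ^ (l + 1)" "(2::nat) ^ (l + 1) < 2 ^ (m + 2)"
        unfolding l[symmetric] using that by simp_all
      from power_less_imp_less_exp[OF _ this(1)] power_less_imp_less_exp[OF _ this(2)]
      show False by simp
    qed
    moreover have "m \<le> ?n" using less_exp[of "m + 1"] by linarith
    ultimately show ?thesis using e by (intro exI[of _ ?n]) simp
  next
    case False
    define q where "q = (2::nat) ^ (m + j)"
    \<comment> \<open>The zero at 2q is seen at place j. As q > j, the window starts after q and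
      ends before 4q, so it contains no other power of 2.\<close>
    define n where "n = 2 * q - j"
    have q: "m + j < q" unfolding q_def by (rule less_exp)
    have "d (n + k) = e k" if k: "k < n - 2" for k
    proof -
      have "\<not> d (n + k) \<longleftrightarrow> k = j"
      proof
        assume "\<not> d (n + k)"
        then obtain l where l: "n + k = 2 ^ (l + 1)" using d by blast
        have "q < 2 ^ (l + 1)" "2 ^ (l + 1) < 4 * q"
          unfolding l[symmetric] n_def using q k by (simp_all add: n_def)
        then have "l + 1 = m + j + 1" unfolding q_def by (intro power2_between) simp_all
        then have "n + k = 2 * q" using l by (simp add: q_def)
        then show "k = j" using q by (simp add: n_def)
      next
        assume "k = j"
        then have "n + k = 2 * q" using q by (simp add: n_def)
        then have "n + k = 2 ^ ((m + j) + 1)" by (simp add: q_def)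
        then show "\<not> d (n + k)" using d by blast
      qed
      moreover have "\<not> e k \<longleftrightarrow> k = j" using j False by blast
      ultimately show ?thesis by blast
    qed
    moreover have "m \<le> n" using q by (simp add: n_def)
    ultimately show ?thesis by blast
  qed
qed

lemma next_square:
  "\<exists>r. n \<le> r \<and> r \<le> n + (2 * nat \<lfloor>sqrt (real n)\<rfloor> + 1) \<and> (\<exists>i::nat. r = (i + 1)\<^sup>2)"
proof -
  define N where "N = nat \<lfloor>sqrt (real n)\<rfloor>"
  have N: "real N \<le> sqrt (real n)" "sqrt (real n) < real N + 1"
    unfolding N_def by (simp_all add: floor_less_iff)
  have "(real N)\<^sup>2 \<le> (sqrt (real n))\<^sup>2" using N by (intro power_mono) auto
  then have 1: "N\<^sup>2 \<le> n" by (simp flip: of_nat_power)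
  have "(sqrt (real n))\<^sup>2 \<le> (real N + 1)\<^sup>2" using N by (intro power_mono) auto
  then have "real n \<le> real ((N + 1)\<^sup>2)" by (simp add: add.commute)
  then have 2: "n \<le> (N + 1)\<^sup>2" by (simp only: of_nat_le_iff)
  have "(N + 1)\<^sup>2 = N\<^sup>2 + (2 * N + 1)" by (simp add: power2_eq_square)
  then have "(N + 1)\<^sup>2 \<le> n + (2 * N + 1)" using 1 by linarith
  then show ?thesis using 2 unfolding N_def[symmetric] by blast
qed

lemma next_power2:
  "\<exists>r. n \<le> r \<and> r \<le> n + (n + 2) \<and> (\<exists>i. r = (2::nat) ^ (i + 1))"
proof (cases "n = 0")
  case True
  then show ?thesis by (intro exI[of _ 2]) (auto intro: exI[of _ 0])
next
  case False
  then obtain i where "2 ^ i \<le> n" "n < 2 ^ (i + 1)" using ex_power_ivl1[of 2 n] by auto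
  then show ?thesis by (intro exI[of _ "2 ^ (i + 1)"]) auto
qed

theorem theorem3p3:
  shows "\<exists>\<beta> \<rho> :: real.
     \<beta> \<in> {0<..1} \<and> \<rho> \<in> {0<..1} \<and>
     \<beta> \<notin> \<rat> \<and> \<rho> \<notin> \<rat> \<and>
     bounded_cf \<beta> \<and> bounded_cf \<rho> \<and>
     \<not> eventually_periodic_cf \<beta> \<and> \<not> eventually_periodic_cf \<rho> \<and>
     (\<forall>\<alpha> \<in> {0<..<1}. \<forall>x \<in> Omega1 \<beta>.
        ((\<lambda>n. ereal (ln (real n)) * (P1 ^^ n) (v \<beta> \<alpha>) x)
           \<longlongrightarrow> ereal (v_int \<beta> \<alpha> * h1 x)) sequentially) \<and>
     (\<forall>\<alpha> \<in> {0<..<1/2}. \<forall>x \<in> Omega1 \<rho>.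
        ((\<lambda>n. ereal (ln (real n)) * (P1 ^^ n) (v \<rho> \<alpha>) x)
           \<longlongrightarrow> ereal (v_int \<rho> \<alpha> * h1 x)) sequentially) \<and>
     (\<forall>\<alpha> \<in> {1/2<..<1}. \<forall>x \<in> Omega1 \<rho>.
        liminf (\<lambda>n. ereal (ln (real n)) * (P1 ^^ n) (v \<rho> \<alpha>) x)
           = ereal (v_int \<rho> \<alpha> * h1 x) \<and>
        limsup (\<lambda>n. ereal (ln (real n)) * (P1 ^^ n) (v \<rho> \<alpha>) x) = \<infinity>)"
proof -
  \<comment> \<open>Starting at 1 for the squares and at 2 for the powers makes the gap condition
    hold at i = 0 too.\<close>
  define d1 where "d1 k \<longleftrightarrow> \<not> (\<exists>i::nat. k = (i + 1)\<^sup>2)" for k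
  define d2 where "d2 k \<longleftrightarrow> \<not> (\<exists>i. k = (2::nat) ^ (i + 1))" for k
  have d1: "\<not> d1 k \<longleftrightarrow> (\<exists>i. k = (i + 1)\<^sup>2)" for k by (simp add: d1_def)
  have d2: "\<not> d2 k \<longleftrightarrow> (\<exists>i. k = 2 ^ (i + 1))" for k by (simp add: d2_def)
  obtain \<beta> where "sparse_point d1 \<beta>"
    using d1 by (rule sparse_point_intro) (auto simp: power2_eq_square)
  then interpret B: sparse_point d1 \<beta> .
  have "2 ^ (i + 1) + i + 1 < (2::nat) ^ (Suc i + 1)" for i
    using less_exp[of "i + 1"] by simp
  with d2 square_le_power2 obtain \<rho> where "sparse_point d2 \<rho>" by (rule sparse_point_intro)
  then interpret R: sparse_point d2 \<rho> .
  have lim1: "(\<lambda>n. ereal (ln (real n)) * (P1 ^^ n) (v \<beta> \<alpha>) x) \<longlonglongrightarrow> ereal (v_int \<beta> \<alpha> * h1 x)"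
    if "0 < \<alpha>" "\<alpha> < 1" "x \<in> Omega1 \<beta>" for \<alpha> x
  proof (rule B.P1_limit[OF that, where r = "\<lambda>n. n"])
    show "(\<lambda>n. ln (real n) * B.main_term \<alpha> n x) \<longlonglongrightarrow> 0"
    proof (rule B.main_term_negligible[OF that(1,2), of 0])
      show "\<exists>r. n \<le> r \<and> r \<le> n + (2 * nat \<lfloor>sqrt (real n)\<rfloor> + 1) \<and> \<not> d1 r" for n
        unfolding d1 by (rule next_square)
      fix \<epsilon> :: real assume "0 < \<epsilon>"
      then have "\<forall>\<^sub>F n in sequentially. 2 * sqrt (real n) + 1 \<le> \<epsilon> * real n" by real_asymp
      then show "\<forall>\<^sub>F n in sequentially. real (2 * nat \<lfloor>sqrt (real n)\<rfloor> + 1) \<le> (0 + \<epsilon>) * real n"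
      proof eventually_elim
        case (elim n)
        have "real_of_int \<lfloor>sqrt (real n)\<rfloor> \<le> sqrt (real n)" by simp
        then have "1 + 2 * real_of_int \<lfloor>sqrt (real n)\<rfloor> \<le> \<epsilon> * real n" using elim by linarith
        then show ?case by simp
      qed
    qed (use that in auto)
  qed (simp add: strict_mono_def)
  have lim2: "(\<lambda>n. ereal (ln (real n)) * (P1 ^^ n) (v \<rho> \<alpha>) x) \<longlonglongrightarrow> ereal (v_int \<rho> \<alpha> * h1 x)"
    if "0 < \<alpha>" "\<alpha> < 1/2" "x \<in> Omega1 \<rho>" for \<alpha> x
  proof (rule R.P1_limit[OF that(1) _ that(3), where r = "\<lambda>n. n"])
    show "(\<lambda>n. ln (real n) * R.main_term \<alpha> n x) \<longlonglongrightarrow> 0"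
    \<comment> \<open>\<kappa> = 1, since the next power of 2 may be about n away; the condition
      \<alpha> < 1 - \<alpha> is \<alpha> < 1/2.\<close>
    proof (rule R.main_term_negligible[OF that(1), of 1])
      show "\<exists>r. n \<le> r \<and> r \<le> n + (n + 2) \<and> \<not> d2 r" for n
        unfolding d2 by (rule next_power2)
      fix \<epsilon> :: real assume "0 < \<epsilon>"
      then show "\<forall>\<^sub>F n in sequentially. real (n + 2) \<le> (1 + \<epsilon>) * real n" by real_asymp
    qed (use that in auto)
  qed (use that in \<open>auto simp: strict_mono_def\<close>)
  have lims: "limsup (\<lambda>n. ereal (ln (real n)) * (P1 ^^ n) (v \<rho> \<alpha>) x) = \<infinity>"
    if \<alpha>: "1/2 < \<alpha>" "\<alpha> < 1" and x: "x \<in> Omega1 \<rho>" for \<alpha> x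
  proof -
    obtain e j where "farey_point e x" and j: "\<And>k. \<not> e k \<Longrightarrow> k = j"
      using R.Omega_code[OF x] by blast
    then show ?thesis
      by (intro R.P1_limsup_infinite[OF \<alpha> x] power_code_agreement[OF d2 j])
  qed
  show ?thesis
    using B.tau_bounds R.tau_bounds B.tau_irrational R.tau_irrational B.bounded_cf_tau
      R.bounded_cf_tau B.not_eventually_periodic R.not_eventually_periodic lim1 lim2 lims R.P1_liminf
    by (intro exI[of _ \<beta>] exI[of _ \<rho>] conjI ballI) auto
qed

end
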